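(* There exist quantities $\gamma(R)>0$ and $m(R)<\infty$, depending only on $R>1$, such that the following holds. Let $\mathbf{\Phi}$ be an $m\times N$ matrix with i.i.d. Gaussian entries $\mathcal{N}(0,1/m)$, let $\mathcal{H}=\mathbb{R}^m$, and let $R:=N/m>1$ be the redundancy of the dictionary. If $m\ge m(R)$ then, except with probability at most $10R^2\cdot\exp(-\gamma(R)m)$, we have for all $0<\tau\le1$ the equality $$\mathcal{A}^r_\tau(\mathbf{\Phi})=\ell^\tau(\mathbf{\Phi})=(\mathcal{H},\ell^p(\mathbf{\Phi}))_{\theta,\tau},\qquad r=\frac1\tau-\frac12=\theta\Big(\frac1p-\frac12\Big),\quad 0<\theta<1,$$ with equivalent (quasi-)norms. The constants driving the equivalence of the norms are universal: they only depend on $\tau$ and the redundancy factor $R$, but not on the individual dimensions $m$ and $N$. For $R\ge1.27$ we have $\gamma(R)>7\cdot10^{-6}$. For large $R$ we have $\gamma(R)\approx0.002$.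
   Context: $\mathbf{\Phi}$ has columns $\phi_1,\dots,\phi_N\in\mathcal{H}=\mathbb{R}^m$ (Euclidean norm $\|\cdot\|_{\mathcal{H}}$), and $\mathbf{\Phi}c=\sum_jc_j\phi_j$ for $c\in\mathbb{R}^N$. $\mathcal{N}(0,1/m)$ is the centered Gaussian law of variance $1/m$. Write $\|c\|_0$ for the number of nonzero entries of $c$ and $\|c\|_\tau=(\sum_j|c_j|^\tau)^{1/\tau}$. $\Sigma_k(\mathbf{\Phi})=\{\mathbf{\Phi}c:\|c\|_0\le k\}$ and $\sigma_k(f,\mathbf{\Phi})=\inf_{y\in\Sigma_k(\mathbf{\Phi})}\|f-y\|_{\mathcal{H}}$. Approximation space $\mathcal{A}^s_q(\mathbf{\Phi})$, $s>0$, $0<q<\infty$: the set of $f\in\mathcal{H}$ with norm $\|f\|_{\mathcal{A}^s_q(\mathbf{\Phi})}=\|f\|_{\mathcal{H}}+|f|_{\mathcal{A}^s_q(\mathbf{\Phi})}<\infty$, where $|f|_{\mathcal{A}^s_q(\mathbf{\Phi})}=\big(\sum_{k\ge1}[k^s\sigma_k(f,\mathbf{\Phi})]^qk^{-1}\big)^{1/q}$. Sparsity space $\ell^\tau(\mathbf{\Phi})$: the set of $f\in\mathcal{H}$ with $\|f\|_{\ell^\tau(\mathbf{\Phi})}=\inf\{\|c\|_\tau:\mathbf{\Phi}c=f\}<\infty$. Interpolation space: with $K(f,t)=\inf_{g\in\ell^p(\mathbf{\Phi})}\{\|f-g\|_{\mathcal{H}}+t\|g\|_{\ell^p(\mathbf{\Phi})}\}$,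 the space $(\mathcal{H},\ell^p(\mathbf{\Phi}))_{\theta,q}$, $0<\theta<1$, $0<q<\infty$, is the set of $f\in\mathcal{H}$ with $\|f\|_{(\mathcal{H},\ell^p(\mathbf{\Phi}))_{\theta,q}}=\big(\int_0^\infty[t^{-\theta}K(f,t)]^q\frac{dt}{t}\big)^{1/q}<\infty$. In finite dimension all norms are equivalent, so the content lies in the two-sided (quasi-)norm inequalities with constants independent of the dimensions.
   Formalization: The constants for the equivalence with the interpolation space may also depend on p (which with τ determines θ): with the unnormalised interpolation norm they blow up as θ→1 or θ→0, so dependence on τ and R alone is impossible. *)

theory Defs
  imports "HOL-Probability.Probability" "Jordan_Normal_Form.Matrix"
begin

unbundle no vec_syntax

text \<open>
  A dictionary is a real matrix \<open>\<Phi>\<close>; the ambient space \<open>H\<close> is \<open>carrier_vec (dim_row \<Phi>)\<close> with the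
  Euclidean norm, and coefficient sequences range over \<open>carrier_vec (dim_col \<Phi>)\<close>. The
  (quasi-)norms of the three families of spaces are valued in the extended nonnegative reals, and
  each space is the set of vectors on which its norm is finite.
\<close>

definition l2_norm :: "real vec \<Rightarrow> real" where
  "l2_norm v = L2_set (\<lambda>i. v $ i) {..<dim_vec v}"

definition lp_norm :: "real \<Rightarrow> real vec \<Rightarrow> real" where
  "lp_norm \<tau> c = (\<Sum>j<dim_vec c. \<bar>c $ j\<bar> powr \<tau>) powr (1 / \<tau>)"

definition l0_norm :: "real vec \<Rightarrow> nat" where
  "l0_norm c = card {j. j < dim_vec c \<and> c $ j \<noteq> 0}"

text \<open>Real powers of extended nonnegative reals; only used with exponent \<open>a > 0\<close>.\<close>

definition epowr :: "ennreal \<Rightarrow> real \<Rightarrow> ennreal" where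
  "epowr x a = (if x = \<top> then \<top> else ennreal (enn2real x powr a))"


definition sparse_combs :: "real mat \<Rightarrow> nat \<Rightarrow> real vec set" where
  "sparse_combs \<Phi> k = {\<Phi> *\<^sub>v c | c. c \<in> carrier_vec (dim_col \<Phi>) \<and> l0_norm c \<le> k}"

definition best_approx_error :: "real mat \<Rightarrow> nat \<Rightarrow> real vec \<Rightarrow> real" where
  "best_approx_error \<Phi> k f = (INF y\<in>sparse_combs \<Phi> k. l2_norm (f - y))"

text \<open>The series over \<open>k \<ge> 1\<close> is reindexed by \<open>k = Suc i\<close>.\<close>

definition approx_seminorm :: "real mat \<Rightarrow> real \<Rightarrow> real \<Rightarrow> real vec \<Rightarrow> ennreal" where
  "approx_seminorm \<Phi> s q f =
     epowr (\<Sum>i. ennreal ((real (Suc i) powr s * best_approx_error \<Phi> (Suc i) f) powr q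
                             / real (Suc i))) (1 / q)"

definition approx_norm :: "real mat \<Rightarrow> real \<Rightarrow> real \<Rightarrow> real vec \<Rightarrow> ennreal" where
  "approx_norm \<Phi> s q f = ennreal (l2_norm f) + approx_seminorm \<Phi> s q f"

definition approx_space :: "real mat \<Rightarrow> real \<Rightarrow> real \<Rightarrow> real vec set" where
  "approx_space \<Phi> s q = {f \<in> carrier_vec (dim_row \<Phi>). approx_norm \<Phi> s q f < \<top>}"


text \<open>The infimum of the empty set is \<open>\<top>\<close>, so vectors outside the range of \<open>\<Phi>\<close> have infinite norm.\<close>

definition sparsity_norm :: "real mat \<Rightarrow> real \<Rightarrow> real vec \<Rightarrow> ennreal" where
  "sparsity_norm \<Phi> \<tau> f =
     (INF c\<in>{c \<in> carrier_vec (dim_col \<Phi>). \<Phi> *\<^sub>v c = f}. ennreal (lp_norm \<tau> c))"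

definition sparsity_space :: "real mat \<Rightarrow> real \<Rightarrow> real vec set" where
  "sparsity_space \<Phi> \<tau> = {f \<in> carrier_vec (dim_row \<Phi>). sparsity_norm \<Phi> \<tau> f < \<top>}"


definition K_functional :: "real mat \<Rightarrow> real \<Rightarrow> real vec \<Rightarrow> real \<Rightarrow> ennreal" where
  "K_functional \<Phi> p f t =
     (INF g\<in>sparsity_space \<Phi> p. ennreal (l2_norm (f - g)) + ennreal t * sparsity_norm \<Phi> p g)"

definition interp_norm :: "real mat \<Rightarrow> real \<Rightarrow> real \<Rightarrow> real \<Rightarrow> real vec \<Rightarrow> ennreal" where
  "interp_norm \<Phi> p \<theta> q f =
     epowr (\<integral>\<^sup>+t\<in>{0<..}. epowr (ennreal (t powr (-\<theta>)) * K_functional \<Phi> p f t) q * ennreal (1 / t)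
              \<partial>lborel) (1 / q)"

definition interp_space :: "real mat \<Rightarrow> real \<Rightarrow> real \<Rightarrow> real \<Rightarrow> real vec set" where
  "interp_space \<Phi> p \<theta> q = {f \<in> carrier_vec (dim_row \<Phi>). interp_norm \<Phi> p \<theta> q f < \<top>}"


definition equal_with_equiv_norms ::
  "real \<Rightarrow> real vec set \<Rightarrow> (real vec \<Rightarrow> ennreal) \<Rightarrow> real vec set \<Rightarrow> (real vec \<Rightarrow> ennreal) \<Rightarrow> bool" where
  "equal_with_equiv_norms C V nV W nW \<longleftrightarrow>
     0 < C \<and> V = W \<and> (\<forall>f\<in>V. nV f \<le> ennreal C * nW f \<and> nW f \<le> ennreal C * nV f)"


text \<open>
  The joint law of \<open>m * N\<close> independent centered Gaussians of variance \<open>1 / m\<close> (the second parameter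
  of \<open>normal_density\<close> is the standard deviation). A sample \<open>\<omega>\<close> is the family of entries of the random
  matrix \<open>mat m N \<omega>\<close>.
\<close>

definition gaussian_entries :: "nat \<Rightarrow> nat \<Rightarrow> (nat \<times> nat \<Rightarrow> real) measure" where
  "gaussian_entries m N =
     (\<Pi>\<^sub>M ij\<in>{..<m} \<times> {..<N}. density lborel (\<lambda>x. ennreal (normal_density 0 (1 / sqrt (real m)) x)))"

end

theory Submission
  imports Defs "Jordan_Normal_Form.Determinant"
begin

text \<open>
  The matrix enters only through three bounds with a constant \<open>K\<close> depending on \<open>R\<close>: \<open>\<Phi>\<close> has norm at
  most \<open>K\<close>, every \<open>f\<close> has a preimage of norm at most \<open>K \<parallel>f\<parallel>\<close>, and \<open>\<parallel>c\<parallel> \<le> K \<parallel>\<Phi>c\<parallel>\<close> for all \<open>c\<close> with at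
  most \<open>m/2\<close> nonzero entries. Each bound is a union bound over lattice points: a net of resolution
  \<open>\<delta>\<close> in dimension \<open>n\<close> has at most \<open>(27/\<delta>)^n\<close> points, while a Gaussian image of \<open>a \<ge> m\<close> coordinates has
  relative norm at most \<open>t\<close> with probability at most \<open>(2t)^a\<close>. For \<open>\<delta>\<close> proportional to \<open>t\<close> the small-ball factor wins as
  \<open>t \<rightarrow> 0\<close>, since \<open>n = m < a = N\<close> for the transpose and \<open>n \<le> m/2 < a = m\<close> for sparse vectors. As \<open>K\<close> is
  free, the failure probability can be pushed below \<open>3 exp(-m)\<close> for every \<open>R > 1\<close>.

  These bounds give the Bernstein inequality \<open>\<parallel>g\<parallel>_\<ell>\<tau> \<le> C k^r \<parallel>g\<parallel>\<close> on \<open>k\<close>-term combinations and the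
  Jackson inequality \<open>\<sigma>_k(f) \<le> K k^(1/2-1/p) \<parallel>f\<parallel>_\<ell>p\<close>. Telescoping near-best approximants along
  \<open>k = 2^i\<close> bounds the sparsity norm by dyadic sums of \<open>\<sigma>\<close>, Jackson bounds these by dyadic sums of the
  K-functional, and truncating the decreasing rearrangement of any coefficient sequence bounds the
  latter by the sparsity norm again.
\<close>

section \<open>Linear images of independent Gaussians\<close>

text \<open>Three difficulties shape the proof. The constants may not depend on \<open>m\<close> and
  \<open>N\<close>; no near-isometry is asked of the matrix, only one-sided bounds. The one on
  preimages is a lower bound for the transpose: it makes \<open>A A^T\<close> invertible and yields
  the minimum-norm preimage. Second, for \<tau> < 1 the sparsity quasi-norm obeys no triangle
  inequality with constant 1; sums are therefore formed with \<tau>-th powers, which are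
  subadditive, and the root is taken only at the end. Third, the scales have to match. With s = 1/p
  - 1/2 the K-functional is sampled at t = 2^(-i s), which is the Jackson rate for k = 2^i, and the
  identity s \<theta> \<tau> = 1 - \<tau>/2 = r \<tau> makes the weights of the discretised
  interpolation integral equal to those of the dyadic approximation errors. The relation between r,
  \<theta> and p also forces p < \<tau>, which Hardy's inequality needs, and it fixes \<theta> once
  \<tau> and p are given, so no constant depends on \<theta> separately.\<close>

lemma nn_integral_normal_density_exp_square:
  fixes \<sigma> s :: real
  assumes "0 < \<sigma>" "0 < 1 + 2 * s * \<sigma>\<^sup>2"
  shows "(\<integral>\<^sup>+x. ennreal (normal_density 0 \<sigma> x) * ennreal (exp (- s * x\<^sup>2)) \<partial>lborel)
           = ennreal (1 / sqrt (1 + 2 * s * \<sigma>\<^sup>2))"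
proof -
  \<comment> \<open>Multiplying the density by exp(-s x^2) gives 1/d times the centered normal
    density of deviation \<sigma>/d. Negative s is allowed as long as d is real and
    positive.\<close>
  define d where "d = sqrt (1 + 2 * s * \<sigma>\<^sup>2)"
  have d: "0 < d" "d\<^sup>2 = 1 + 2 * s * \<sigma>\<^sup>2" using assms by (auto simp: d_def)
  have "normal_density 0 \<sigma> x * exp (- s * x\<^sup>2) = (1 / d) * normal_density 0 (\<sigma> / d) x" for x
  proof -
    have "- (x\<^sup>2) / (2 * \<sigma>\<^sup>2) + - s * x\<^sup>2 = - (x\<^sup>2) / (2 * (\<sigma> / d)\<^sup>2)"
      using assms d by (simp add: power_divide d(2) field_simps)
    moreover have "sqrt (2 * pi * (\<sigma> / d)\<^sup>2) = sqrt (2 * pi * \<sigma>\<^sup>2) / d"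
      using d(1) by (simp add: real_sqrt_mult real_sqrt_divide power_divide)
    ultimately show ?thesis
      using d(1) assms(1) by (simp add: normal_density_def exp_add[symmetric] field_simps)
  qed
  then have "(\<integral>\<^sup>+x. ennreal (normal_density 0 \<sigma> x) * ennreal (exp (- s * x\<^sup>2)) \<partial>lborel)
      = (\<integral>\<^sup>+x. ennreal (1 / d) * ennreal (normal_density 0 (\<sigma> / d) x) \<partial>lborel)"
    using d by (simp add: ennreal_mult'[symmetric] normal_density_nonneg)
  also have "\<dots> = ennreal (1 / d) * (\<integral>\<^sup>+x. ennreal (normal_density 0 (\<sigma> / d) x) \<partial>lborel)"
    by (rule nn_integral_cmult) simp
  also have "(\<integral>\<^sup>+x. ennreal (normal_density 0 (\<sigma> / d) x) \<partial>lborel) = 1"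
    using prob_space.emeasure_space_1[OF prob_space_normal_density[of "\<sigma> / d" 0]] d assms
    by (simp add: emeasure_density)
  finally show ?thesis by (simp add: d_def)
qed

locale iid_normal =
  fixes I :: "'i set" and \<sigma> :: real
  assumes fin: "finite I" and sig: "0 < \<sigma>"
begin

definition P where "P = (\<Pi>\<^sub>M i\<in>I. density lborel (\<lambda>x. ennreal (normal_density 0 \<sigma> x)))"

sublocale prob_space P
  unfolding P_def by (rule prob_space_PiM) (use sig in \<open>auto intro: prob_space_normal_density\<close>)

lemma component_measurable [measurable]: "i \<in> I \<Longrightarrow> (\<lambda>\<omega>. \<omega> i) \<in> borel_measurable P"
proof -
  assume "i \<in> I"
  then have "(\<lambda>\<omega>. \<omega> i) \<in> measurable P (density lborel (\<lambda>x. ennreal (normal_density 0 \<sigma> x)))"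
    unfolding P_def by (rule measurable_component_singleton)
  then show ?thesis by (simp cong: measurable_cong_sets)
qed

lemma component_distributed:
  assumes "i \<in> I" shows "distributed P lborel (\<lambda>\<omega>. \<omega> i) (normal_density 0 \<sigma>)"
proof -
  have "distr P (density lborel (\<lambda>x. ennreal (normal_density 0 \<sigma> x))) (\<lambda>\<omega>. \<omega> i)
     = density lborel (\<lambda>x. ennreal (normal_density 0 \<sigma> x))"
    unfolding P_def using fin assms sig by (intro distr_PiM_component) (auto intro: prob_space_normal_density)
  then have "distr P lborel (\<lambda>\<omega>. \<omega> i) = density lborel (\<lambda>x. ennreal (normal_density 0 \<sigma> x))"
    by (simp cong: distr_cong)
  then show ?thesis using assms by (auto simp: distributed_def)
qed

lemma components_indep: "indep_vars (\<lambda>_. borel) (\<lambda>i \<omega>. \<omega> i) I"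
proof (cases "I = {}")
  case True then show ?thesis unfolding indep_vars_def2 indep_sets_def by auto
next
  case False
  have d: "distr P borel (\<lambda>\<omega>. \<omega> i) = density lborel (\<lambda>x. ennreal (normal_density 0 \<sigma> x))" if "i \<in> I" for i
    using component_distributed[OF that] by (simp add: distributed_def cong: distr_cong)
  have "distr P (\<Pi>\<^sub>M i\<in>I. borel) (\<lambda>x. \<lambda>i\<in>I. x i) = distr P P (\<lambda>x. x)"
  proof (rule distr_cong)
    show "sets (Pi\<^sub>M I (\<lambda>i. borel)) = sets P" unfolding P_def by (intro sets_PiM_cong) auto
  qed (auto simp: P_def space_PiM PiE_def extensional_restrict)
  also have "\<dots> = P" by (rule distr_id)
  also have "P = (\<Pi>\<^sub>M i\<in>I. distr P borel (\<lambda>\<omega>. \<omega> i))"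
    unfolding P_def[symmetric] by (subst (1) P_def, rule PiM_cong) (auto simp: d)
  finally show ?thesis using False by (subst indep_vars_iff_distr_eq_PiM') auto
qed

lemma weighted_sum_distributed:
  assumes "K \<subseteq> I" "(\<Sum>i\<in>K. (w i)\<^sup>2) > 0"
  shows "distributed P lborel (\<lambda>\<omega>. \<Sum>i\<in>K. w i * \<omega> i) (normal_density 0 (\<sigma> * sqrt (\<Sum>i\<in>K. (w i)\<^sup>2)))"
proof -
  \<comment> \<open>Coordinates of weight 0 are dropped, because the theorem on sums of independent
    normal variables is applied to summands of positive deviation.\<close>
  define K' where "K' = {i \<in> K. w i \<noteq> 0}"
  have fK: "finite K" using fin assms finite_subset by blast
  have ne: "K' \<noteq> {}"
  proof
    assume "K' = {}"
    then have "(\<Sum>i\<in>K. (w i)\<^sup>2) = 0" by (intro sum.neutral) (auto simp: K'_def)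
    then show False using assms(2) by simp
  qed
  have "distributed P lborel (\<lambda>\<omega>. \<Sum>i\<in>K'. 0 + w i * \<omega> i)
      (normal_density (\<Sum>i\<in>K'. 0 + w i * 0) (sqrt (\<Sum>i\<in>K'. (\<bar>w i\<bar> * \<sigma>)\<^sup>2)))"
  proof (rule sum_indep_normal)
    show "finite K'" "K' \<noteq> {}" using ne fK by (auto simp: K'_def)
    show "indep_vars (\<lambda>i. borel) (\<lambda>i \<omega>. 0 + w i * \<omega> i) K'"
      by (rule indep_vars_compose2[OF indep_vars_subset[OF components_indep]])
        (use assms in \<open>auto simp: K'_def\<close>)
    show "0 < \<bar>w i\<bar> * \<sigma>" if "i \<in> K'" for i using that sig by (simp add: K'_def)
    show "distributed P lborel (\<lambda>\<omega>. 0 + w i * \<omega> i) (\<lambda>x. ennreal (normal_density (0 + w i * 0) (\<bar>w i\<bar> * \<sigma>) x))" if "i \<in> K'" for i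
      by (rule normal_density_affine[OF component_distributed]) (use that sig assms in \<open>auto simp: K'_def\<close>)
  qed
  moreover have "(\<Sum>i\<in>K'. 0 + w i * \<omega> i) = (\<Sum>i\<in>K. w i * \<omega> i)" for \<omega>
    unfolding K'_def by (simp add: fK sum.mono_neutral_cong_left)
  moreover have "sqrt (\<Sum>i\<in>K'. (\<bar>w i\<bar> * \<sigma>)\<^sup>2) = \<sigma> * sqrt (\<Sum>i\<in>K. (w i)\<^sup>2)"
  proof -
    have "(\<Sum>i\<in>K'. (\<bar>w i\<bar> * \<sigma>)\<^sup>2) = (\<Sum>i\<in>K. (w i)\<^sup>2 * \<sigma>\<^sup>2)"
      unfolding K'_def by (rule sum.mono_neutral_cong_left) (auto simp: fK power_mult_distrib)
    then show ?thesis using sig by (simp add: sum_distrib_right[symmetric] real_sqrt_mult)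
  qed
  ultimately show ?thesis by simp
qed

text \<open>Sums over disjoint blocks of coordinates are independent, and each is normal with
  variance \<sigma>^2 v, so the expectation is a product of \<open>card L\<close> equal
  factors.\<close>

lemma nn_integral_exp_sum_squares:
  assumes L: "finite L" and K: "\<And>l. l \<in> L \<Longrightarrow> K l \<subseteq> I" "disjoint_family_on K L"
    and v: "\<And>l. l \<in> L \<Longrightarrow> (\<Sum>i\<in>K l. (w i)\<^sup>2) = v" "0 < v" and s: "0 < 1 + 2 * s * \<sigma>\<^sup>2 * v"
  shows "(\<integral>\<^sup>+\<omega>. ennreal (exp (- s * (\<Sum>l\<in>L. (\<Sum>i\<in>K l. w i * \<omega> i)\<^sup>2))) \<partial>P)
           = ennreal ((1 / sqrt (1 + 2 * s * \<sigma>\<^sup>2 * v)) ^ card L)"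
proof -
  define Y where "Y l \<omega> = (\<Sum>i\<in>K l. w i * \<omega> i)" for l and \<omega> :: "'i \<Rightarrow> real"
  have "indep_vars (\<lambda>j. PiM (K j) (\<lambda>_. borel)) (\<lambda>j \<omega>. restrict (\<lambda>i. \<omega> i) (K j)) L"
    by (rule indep_vars_restrict[OF components_indep K])
  then have "indep_vars (\<lambda>_. borel) (\<lambda>l \<omega>. (\<lambda>x. ennreal (exp (- s * (\<Sum>i\<in>K l. w i * x i)\<^sup>2))) (restrict (\<lambda>i. \<omega> i) (K l))) L"
    by (rule indep_vars_compose2) measurable
  then have ind: "indep_vars (\<lambda>_. borel) (\<lambda>l \<omega>. ennreal (exp (- s * (Y l \<omega>)\<^sup>2))) L"
    by (simp add: Y_def cong: sum.cong)
  have one: "(\<integral>\<^sup>+\<omega>. ennreal (exp (- s * (Y l \<omega>)\<^sup>2)) \<partial>P) = ennreal (1 / sqrt (1 + 2 * s * \<sigma>\<^sup>2 * v))"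
    if l: "l \<in> L" for l
  proof -
    have D: "distributed P lborel (Y l) (normal_density 0 (\<sigma> * sqrt v))"
      using weighted_sum_distributed[of "K l" w] K v l by (simp add: Y_def[abs_def])
    have "(\<integral>\<^sup>+\<omega>. ennreal (exp (- s * (Y l \<omega>)\<^sup>2)) \<partial>P)
      = (\<integral>\<^sup>+x. ennreal (normal_density 0 (\<sigma> * sqrt v) x) * ennreal (exp (- s * x\<^sup>2)) \<partial>lborel)"
      by (rule distributed_nn_integral[OF D, symmetric]) simp
    also have "\<dots> = ennreal (1 / sqrt (1 + 2 * s * (\<sigma> * sqrt v)\<^sup>2))"
      using sig v s by (intro nn_integral_normal_density_exp_square) (auto simp: power_mult_distrib mult.assoc)
    finally show ?thesis using v by (simp add: power_mult_distrib mult.assoc)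
  qed
  have "(\<integral>\<^sup>+\<omega>. ennreal (exp (- s * (\<Sum>l\<in>L. (Y l \<omega>)\<^sup>2))) \<partial>P)
      = (\<integral>\<^sup>+\<omega>. (\<Prod>l\<in>L. ennreal (exp (- s * (Y l \<omega>)\<^sup>2))) \<partial>P)"
    using L by (simp add: prod_ennreal exp_sum[symmetric] sum_distrib_left sum_negf)
  also have "\<dots> = (\<Prod>l\<in>L. \<integral>\<^sup>+\<omega>. ennreal (exp (- s * (Y l \<omega>)\<^sup>2)) \<partial>P)"
    by (rule indep_vars_nn_integral[OF L ind]) simp
  also have "\<dots> = (\<Prod>l\<in>L. ennreal (1 / sqrt (1 + 2 * s * \<sigma>\<^sup>2 * v)))"
    by (rule prod.cong) (use one in auto)
  also have "\<dots> = ennreal ((1 / sqrt (1 + 2 * s * \<sigma>\<^sup>2 * v)) ^ card L)"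
    using s by (simp add: ennreal_power)
  finally show ?thesis by (simp add: Y_def)
qed

text \<open>Both signs of \<open>s\<close> are used: a positive \<open>s\<close> controls the event
  that the quadratic form is small, a negative one the event that it is large.\<close>

lemma exponential_Markov:
  assumes L: "finite L" and K: "\<And>l. l \<in> L \<Longrightarrow> K l \<subseteq> I" "disjoint_family_on K L"
    and v: "\<And>l. l \<in> L \<Longrightarrow> (\<Sum>i\<in>K l. (w i)\<^sup>2) = v" "0 < v" and s: "0 < 1 + 2 * s * \<sigma>\<^sup>2 * v"
    and A: "A \<in> events" "\<And>\<omega>. \<omega> \<in> A \<Longrightarrow> s * (\<Sum>l\<in>L. (\<Sum>i\<in>K l. w i * \<omega> i)\<^sup>2) \<le> c"
  shows "prob A \<le> exp c * (1 / sqrt (1 + 2 * s * \<sigma>\<^sup>2 * v)) ^ card L"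
proof -
  let ?Q = "\<lambda>\<omega>. \<Sum>l\<in>L. (\<Sum>i\<in>K l. w i * \<omega> i)\<^sup>2"
  have [measurable]: "?Q \<in> borel_measurable P"
    using K(1) by (intro borel_measurable_sum borel_measurable_power borel_measurable_times) (auto simp: subset_iff)
  have "emeasure P A = (\<integral>\<^sup>+\<omega>. indicator A \<omega> \<partial>P)" using A by simp
  also have "\<dots> \<le> (\<integral>\<^sup>+\<omega>. ennreal (exp c) * ennreal (exp (- s * ?Q \<omega>)) \<partial>P)"
  proof (rule nn_integral_mono)
    fix \<omega>
    show "indicator A \<omega> \<le> ennreal (exp c) * ennreal (exp (- s * ?Q \<omega>))"
    proof (cases "\<omega> \<in> A")
      case True
      have "1 \<le> exp (c + - s * ?Q \<omega>)" using A(2)[OF True] by simp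
      then show ?thesis using True
        by (simp add: ennreal_mult'[symmetric] exp_add[symmetric] del: mult_minus_left)
    qed simp
  qed
  also have "\<dots> = ennreal (exp c) * (\<integral>\<^sup>+\<omega>. ennreal (exp (- s * ?Q \<omega>)) \<partial>P)"
    by (rule nn_integral_cmult) measurable
  also have "\<dots> = ennreal (exp c * (1 / sqrt (1 + 2 * s * \<sigma>\<^sup>2 * v)) ^ card L)"
    using s by (subst nn_integral_exp_sum_squares[OF L K v s]) (auto simp: ennreal_mult')
  finally show ?thesis using s by (simp add: emeasure_eq_measure)
qed

text \<open>\<open>L\<close> indexes the coordinates of the image and \<open>S\<close> those of the
  argument \<open>z\<close>, while \<open>idx\<close> picks the matrix entry. One set of estimates
  thus serves the matrix, with \<open>idx l s = (l, s)\<close>, and its transpose, with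
  \<open>idx l s = (s, l)\<close>.\<close>

context
  fixes idx :: "'l \<Rightarrow> 's \<Rightarrow> 'i" and L S and z :: "'s \<Rightarrow> real" and m :: nat
  assumes L: "finite L" and S: "finite S" and inj: "inj_on (\<lambda>(l, s). idx l s) (L \<times> S)"
    and idx: "\<And>l s. l \<in> L \<Longrightarrow> s \<in> S \<Longrightarrow> idx l s \<in> I"
    and v: "0 < (\<Sum>s\<in>S. (z s)\<^sup>2)" and m: "0 < m" "\<sigma> = 1 / sqrt (real m)"
begin

lemma sum_squares_measurable [measurable]:
  "(\<lambda>\<omega>. \<Sum>l\<in>L. (\<Sum>s\<in>S. z s * \<omega> (idx l s))\<^sup>2) \<in> borel_measurable P"
  using idx by (intro borel_measurable_sum borel_measurable_power borel_measurable_times) auto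

lemma exponential_Markov_matrix:
  assumes s: "0 < 1 + 2 * s / real m"
    and A: "A \<in> events" "\<And>\<omega>. \<omega> \<in> A \<Longrightarrow>
      s * (\<Sum>l\<in>L. (\<Sum>j\<in>S. z j * \<omega> (idx l j))\<^sup>2) \<le> c * (\<Sum>s\<in>S. (z s)\<^sup>2)"
  shows "prob A \<le> exp c * (1 / sqrt (1 + 2 * s / real m)) ^ card L"
proof -
  \<comment> \<open>The general bound attaches weights to matrix entries. As \<open>idx\<close> is
    injective, an entry determines its argument coordinate and hence its weight.\<close>
  define w where "w i = z (snd (the_inv_into (L \<times> S) (\<lambda>(l, s). idx l s) i))" for i
  define K where "K l = idx l ` S" for l
  have w: "w (idx l j) = z j" if "l \<in> L" "j \<in> S" for l j
    using the_inv_into_f_f[OF inj, of "(l, j)"] that by (simp add: w_def)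
  have inj': "inj_on (idx l) S" if "l \<in> L" for l
  proof (rule inj_onI)
    fix j j' assume "j \<in> S" "j' \<in> S" "idx l j = idx l j'"
    then show "j = j'" using inj_onD[OF inj, of "(l, j)" "(l, j')"] that by simp
  qed
  have sumK: "(\<Sum>i\<in>K l. f i) = (\<Sum>j\<in>S. f (idx l j))" if "l \<in> L" for l and f :: "'i \<Rightarrow> real"
    unfolding K_def using sum.reindex[OF inj'[OF that]] by simp
  let ?v = "\<Sum>s\<in>S. (z s)\<^sup>2"
  have "prob A \<le> exp c * (1 / sqrt (1 + 2 * (s / ?v) * \<sigma>\<^sup>2 * ?v)) ^ card L"
  proof (rule exponential_Markov[of L K w])
    show "K l \<subseteq> I" if "l \<in> L" for l using idx that by (auto simp: K_def)
    have "l = l'" if "l \<in> L" "l' \<in> L" "j \<in> S" "j' \<in> S" "idx l j = idx l' j'" for l l' j j'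
      using inj_onD[OF inj, of "(l, j)" "(l', j')"] that by simp
    then show "disjoint_family_on K L"
      unfolding disjoint_family_on_def K_def by blast
    show "(\<Sum>i\<in>K l. (w i)\<^sup>2) = ?v" if "l \<in> L" for l using that by (simp add: sumK w)
    show "0 < 1 + 2 * (s / ?v) * \<sigma>\<^sup>2 * ?v" using s v m by (simp add: power_divide)
    show "s / ?v * (\<Sum>l\<in>L. (\<Sum>i\<in>K l. w i * \<omega> i)\<^sup>2) \<le> c" if "\<omega> \<in> A" for \<omega>
    proof -
      have "(\<Sum>l\<in>L. (\<Sum>i\<in>K l. w i * \<omega> i)\<^sup>2) = (\<Sum>l\<in>L. (\<Sum>j\<in>S. z j * \<omega> (idx l j))\<^sup>2)"
        by (rule sum.cong) (simp_all add: sumK w)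
      then show ?thesis using A(2)[OF that] v by (simp add: pos_divide_le_eq)
    qed
  qed (use L v A in auto)
  then show ?thesis using v m by (simp add: power_divide)
qed

text \<open>Exponential Markov with s = m/(2 t^2): the prefactor exp(m/2) is at most 2^(card L)
  because m \<le> card L, and each image coordinate contributes a factor 1/sqrt(1 + 1/t^2) \<le>
  t.\<close>

lemma small_ball:
  assumes t: "0 < t" and a: "m \<le> card L"
  defines "A \<equiv> {\<omega> \<in> space P. (\<Sum>l\<in>L. (\<Sum>j\<in>S. z j * \<omega> (idx l j))\<^sup>2) \<le> t\<^sup>2 * (\<Sum>s\<in>S. (z s)\<^sup>2)}"
  shows "A \<in> events" "prob A \<le> (2 * t) ^ card L"
proof -
  show A: "A \<in> events" unfolding A_def by measurable
  have "prob A \<le> exp (m / 2) * (1 / sqrt (1 + 2 * (m / (2 * t\<^sup>2)) / m)) ^ card L"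
  proof (rule exponential_Markov_matrix[OF _ A])
    show "m / (2 * t\<^sup>2) * (\<Sum>l\<in>L. (\<Sum>j\<in>S. z j * \<omega> (idx l j))\<^sup>2) \<le> (m / 2) * (\<Sum>s\<in>S. (z s)\<^sup>2)"
      if "\<omega> \<in> A" for \<omega>
    proof -
      have "m / (2 * t\<^sup>2) * (\<Sum>l\<in>L. (\<Sum>j\<in>S. z j * \<omega> (idx l j))\<^sup>2) \<le> m / (2 * t\<^sup>2) * (t\<^sup>2 * (\<Sum>s\<in>S. (z s)\<^sup>2))"
        using that by (intro mult_left_mono) (auto simp: A_def)
      then show ?thesis using t by simp
    qed
    show "0 < 1 + 2 * (m / (2 * t\<^sup>2)) / m" using t m by (intro add_pos_nonneg) auto
  qed
  also have "\<dots> \<le> 2 ^ card L * t ^ card L"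
  proof (rule mult_mono)
    have "exp (1::real) \<le> 4" using exp_le by simp
    then have "exp (1 / 2 :: real) \<le> 2"
      using power2_le_imp_le[of "exp (1 / 2 :: real)" 2] exp_double[of "1 / 2 :: real"] by simp
    then have "exp (1 / 2 :: real) ^ m \<le> 2 ^ m" by (intro power_mono) auto
    also have "\<dots> \<le> (2::real) ^ card L" using a by (intro power_increasing) auto
    finally show "exp (m / 2) \<le> (2::real) ^ card L" by (simp add: exp_of_nat_mult[symmetric])
    have "1 / t = sqrt (1 / t\<^sup>2)" using t by (simp add: real_sqrt_divide)
    also have "\<dots> \<le> sqrt (1 + 2 * (m / (2 * t\<^sup>2)) / m)" using m by simp
    finally have "1 / sqrt (1 + 2 * (m / (2 * t\<^sup>2)) / m) \<le> 1 / (1 / t)"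
      using t by (intro frac_le) auto
    then show "(1 / sqrt (1 + 2 * (m / (2 * t\<^sup>2)) / m)) ^ card L \<le> t ^ card L"
      by (intro power_mono) auto
  qed auto
  finally show "prob A \<le> (2 * t) ^ card L" by (simp add: power_mult_distrib)
qed

text \<open>Exponential Markov with s = -m/4, which leaves 1 + 2s/m = 1/2 and so a factor sqrt 2
  \<le> e per image coordinate.\<close>

lemma large_deviation:
  fixes T :: real
  assumes a: "card L = m"
  defines "A \<equiv> {\<omega> \<in> space P. (\<Sum>l\<in>L. (\<Sum>j\<in>S. z j * \<omega> (idx l j))\<^sup>2) \<ge> T\<^sup>2 * (\<Sum>s\<in>S. (z s)\<^sup>2)}"
  shows "A \<in> events" "prob A \<le> exp (m * (1 - T\<^sup>2 / 4))"
proof -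
  show A: "A \<in> events" unfolding A_def by measurable
  have "prob A \<le> exp (- (m * T\<^sup>2 / 4)) * (1 / sqrt (1 + 2 * (- m / 4) / m)) ^ card L"
  proof (rule exponential_Markov_matrix[OF _ A])
    show "- m / 4 * (\<Sum>l\<in>L. (\<Sum>j\<in>S. z j * \<omega> (idx l j))\<^sup>2) \<le> - (m * T\<^sup>2 / 4) * (\<Sum>s\<in>S. (z s)\<^sup>2)"
      if "\<omega> \<in> A" for \<omega>
    proof -
      have "m / 4 * (T\<^sup>2 * (\<Sum>s\<in>S. (z s)\<^sup>2)) \<le> m / 4 * (\<Sum>l\<in>L. (\<Sum>j\<in>S. z j * \<omega> (idx l j))\<^sup>2)"
        using that by (intro mult_left_mono) (auto simp: A_def)
      then show ?thesis by simp
    qed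
    show "0 < 1 + 2 * (- m / 4) / m" using m by simp
  qed
  also have "\<dots> = exp (- (m * T\<^sup>2 / 4)) * sqrt 2 ^ m"
    using m a by (simp add: real_sqrt_divide)
  also have "\<dots> \<le> exp (- (m * T\<^sup>2 / 4)) * exp 1 ^ m"
  proof -
    have "sqrt 2 \<le> (2::real)" using real_sqrt_le_mono[of 2 4] by simp
    also have "2 \<le> exp (1::real)" using exp_ge_add_one_self[of 1] by simp
    finally show ?thesis by (intro mult_left_mono power_mono) auto
  qed
  also have "\<dots> = exp (m * (1 - T\<^sup>2 / 4))"
    by (simp add: exp_of_nat_mult[symmetric] exp_add[symmetric] algebra_simps)
  finally show "prob A \<le> exp (m * (1 - T\<^sup>2 / 4))" .
qed

end

end

section \<open>Lattice nets\<close>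

text \<open>
  The \<open>\<ell>\<^sup>1\<close> bound is the one satisfied by the integer part of \<open>x / h\<close>, \<open>h = \<delta> / sqrt (card S)\<close>, for a
  Euclidean unit vector \<open>x\<close>.
\<close>

definition lattice_net :: "'s set \<Rightarrow> real \<Rightarrow> ('s \<Rightarrow> int) set" where
  "lattice_net S \<delta> = {z \<in> S \<rightarrow>\<^sub>E UNIV. (\<Sum>s\<in>S. \<bar>real_of_int (z s)\<bar>) \<le> card S / \<delta> + card S
      \<and> 0 < (\<Sum>s\<in>S. (real_of_int (z s))\<^sup>2)}"

text \<open>Two geometric series of ratio \<rho> = exp(-\<delta>); for \<delta> \<le> 1/2 the gap 1
  - \<rho> is at least 2\<delta>/3. This is the one-coordinate factor in the count of the
  net.\<close>

lemma sum_exp_abs_int_le: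
  fixes \<delta> :: real
  assumes "0 < \<delta>" "\<delta> \<le> 1 / 2"
  shows "(\<Sum>k\<in>{- int b..int b}. exp (- \<delta> * \<bar>real_of_int k\<bar>)) \<le> 3 / \<delta>"
proof -
  define \<rho> where "\<rho> = exp (- \<delta>)"
  have "\<rho> \<le> 1 / (1 + \<delta>)"
    using exp_ge_add_one_self[of \<delta>] assms unfolding \<rho>_def by (auto simp: exp_minus field_simps)
  moreover have "1 / (1 + \<delta>) = 1 - \<delta> / (1 + \<delta>)" using assms by (simp add: field_simps)
  moreover have "\<delta> / (3 / 2) \<le> \<delta> / (1 + \<delta>)" using assms by (intro divide_left_mono) auto
  ultimately have "2 * \<delta> / 3 \<le> 1 - \<rho>" by simp
  then have \<rho>: "2 * \<delta> / 3 \<le> 1 - \<rho>" "0 < \<rho>" "\<rho> < 1" using assms by (auto simp: \<rho>_def)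
  have "{- int b..int b} \<subseteq> int ` {..b} \<union> (\<lambda>j. - int j) ` {..b}"
  proof
    fix k assume "k \<in> {- int b..int b}"
    then show "k \<in> int ` {..b} \<union> (\<lambda>j. - int j) ` {..b}"
      by (cases "0 \<le> k") (auto intro!: image_eqI[of _ _ "nat \<bar>k\<bar>"])
  qed
  then have "(\<Sum>k\<in>{- int b..int b}. exp (- \<delta> * \<bar>real_of_int k\<bar>))
      \<le> (\<Sum>k\<in>int ` {..b} \<union> (\<lambda>j. - int j) ` {..b}. exp (- \<delta> * \<bar>real_of_int k\<bar>))"
    by (intro sum_mono2) auto
  also have "\<dots> \<le> (\<Sum>k\<in>int ` {..b}. exp (- \<delta> * \<bar>real_of_int k\<bar>)) + (\<Sum>k\<in>(\<lambda>j. - int j) ` {..b}. exp (- \<delta> * \<bar>real_of_int k\<bar>))"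
    by (subst sum_Un) (auto intro!: sum_nonneg)
  also have "\<dots> = 2 * (\<Sum>j\<le>b. \<rho> ^ j)"
    by (simp add: sum.reindex inj_on_def \<rho>_def exp_of_nat_mult[symmetric] mult.commute)
  also have "(\<Sum>j\<le>b. \<rho> ^ j) \<le> 1 / (1 - \<rho>)"
    using \<rho> by (simp add: sum_gp0 divide_right_mono)
  also have "1 / (1 - \<rho>) \<le> 1 / (2 * \<delta> / 3)" using \<rho> assms by (intro divide_left_mono) auto
  finally show ?thesis by simp
qed

text \<open>Counting by an exponential weight: the l1 bound gives each net point z the weight
  exp(-\<delta> |z|_1) \<ge> exp(-2 card S), while the total weight over a box factorises into at
  most (3/\<delta>)^(card S). The constant is 27 = 3 * 9 with exp 2 \<le> 9.\<close>

lemma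
  assumes S: "finite S" and d: "0 < \<delta>" "\<delta> \<le> 1 / 2"
  shows finite_lattice_net: "finite (lattice_net S \<delta>)"
    and card_lattice_net: "card (lattice_net S \<delta>) \<le> (27 / \<delta>) ^ card S"
proof -
  define b where "b = nat \<lceil>card S / \<delta> + card S\<rceil>"
  have b: "card S / \<delta> + card S \<le> b" unfolding b_def by (rule real_nat_ceiling_ge)
  have sub: "lattice_net S \<delta> \<subseteq> S \<rightarrow>\<^sub>E {- int b..int b}"
  proof
    fix z assume z: "z \<in> lattice_net S \<delta>"
    have "z s \<in> {- int b..int b}" if "s \<in> S" for s
    proof -
      have "\<bar>real_of_int (z s)\<bar> \<le> (\<Sum>s\<in>S. \<bar>real_of_int (z s)\<bar>)"
        by (rule member_le_sum) (use that S in auto)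
      also have "\<dots> \<le> b" using z b by (auto simp: lattice_net_def)
      finally have "\<bar>z s\<bar> \<le> int b" by linarith
      then show ?thesis by auto
    qed
    then show "z \<in> S \<rightarrow>\<^sub>E {- int b..int b}" using z by (auto simp: lattice_net_def PiE_iff)
  qed
  have fin: "finite (S \<rightarrow>\<^sub>E {- int b..int b})" using S by (intro finite_PiE) auto
  show "finite (lattice_net S \<delta>)" by (rule finite_subset[OF sub fin])
  have "card (lattice_net S \<delta>) * exp (- 2 * real (card S)) = (\<Sum>z\<in>lattice_net S \<delta>. exp (- 2 * real (card S)))"
    by simp
  also have "\<dots> \<le> (\<Sum>z\<in>lattice_net S \<delta>. \<Prod>s\<in>S. exp (- \<delta> * \<bar>real_of_int (z s)\<bar>))"
  proof (rule sum_mono)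
    fix z assume z: "z \<in> lattice_net S \<delta>"
    have "\<delta> * (\<Sum>s\<in>S. \<bar>real_of_int (z s)\<bar>) \<le> \<delta> * (card S / \<delta> + card S)"
      using z d by (intro mult_left_mono) (auto simp: lattice_net_def)
    also have "\<dots> = card S + \<delta> * card S" using d by (simp add: field_simps)
    also have "\<dots> \<le> real (card S) + 1 * real (card S)" using d by (intro add_left_mono mult_right_mono) auto
    finally show "exp (- 2 * real (card S)) \<le> (\<Prod>s\<in>S. exp (- \<delta> * \<bar>real_of_int (z s)\<bar>))"
      using S by (simp add: exp_sum[symmetric] sum_distrib_left sum_negf)
  qed
  also have "\<dots> \<le> (\<Sum>z\<in>S \<rightarrow>\<^sub>E {- int b..int b}. \<Prod>s\<in>S. exp (- \<delta> * \<bar>real_of_int (z s)\<bar>))"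
    by (intro sum_mono2 fin sub prod_nonneg) auto
  also have "\<dots> = (\<Prod>s\<in>S. \<Sum>k\<in>{- int b..int b}. exp (- \<delta> * \<bar>real_of_int k\<bar>))"
    by (rule prod_sum_PiE[symmetric]) (use S in auto)
  also have "\<dots> \<le> (\<Prod>s\<in>S. 3 / \<delta>)"
    by (intro prod_mono conjI sum_nonneg sum_exp_abs_int_le d) auto
  finally have "card (lattice_net S \<delta>) * exp (- 2 * real (card S)) \<le> (3 / \<delta>) ^ card S" by simp
  then have "real (card (lattice_net S \<delta>)) \<le> (3 / \<delta>) ^ card S * exp 2 ^ card S"
    by (simp add: exp_minus field_simps exp_of_nat_mult)
  also have "\<dots> \<le> (3 / \<delta>) ^ card S * 9 ^ card S"
  proof -
    have "exp 2 = exp (1::real) ^ 2" using exp_double[of "1::real"] by simp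
    also have "\<dots> \<le> 3 ^ 2" using exp_le by (intro power_mono) auto
    finally show ?thesis using d by (intro mult_left_mono power_mono) auto
  qed
  also have "\<dots> = (27 / \<delta>) ^ card S" by (simp add: power_mult_distrib[symmetric])
  finally show "card (lattice_net S \<delta>) \<le> (27 / \<delta>) ^ card S" .
qed

lemma L2_set_le_triangle:
  "L2_set f S \<le> L2_set g S + L2_set (\<lambda>s. f s - g s) S"
  using L2_set_triangle_ineq[of g "\<lambda>s. f s - g s" S] by simp

lemma L2_set_scale: "L2_set (\<lambda>s. c * f s) S = \<bar>c\<bar> * L2_set f S"
  by (simp add: L2_set_def power_mult_distrib sum_distrib_left[symmetric] real_sqrt_mult)

text \<open>Rounding x/h down moves each coordinate of x by at most h = \<delta>/sqrt n, hence x by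
  at most \<delta> in Euclidean norm. The l1 bound follows from Cauchy-Schwarz plus 1 per
  coordinate, and the lattice point is nonzero because \<delta> < 1.\<close>

lemma lattice_net_approx:
  assumes S: "finite S" and d: "0 < \<delta>" "\<delta> \<le> 1 / 2" and x: "L2_set x S = 1"
  obtains z h where "z \<in> lattice_net S \<delta>" "0 < h" "L2_set (\<lambda>s. x s - h * real_of_int (z s)) S \<le> \<delta>"
proof
  define n where "n = card S"
  have "S \<noteq> {}" using x by auto
  then have n: "0 < n" using S by (simp add: n_def card_gt_0_iff)
  define h where "h = \<delta> / sqrt n"
  show h: "0 < h" using d n by (simp add: h_def)
  define z where "z = (\<lambda>s\<in>S. \<lfloor>x s / h\<rfloor>)"
  have h2: "h * sqrt n = \<delta>" using n by (simp add: h_def)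
  have fl: "\<bar>x s / h - real_of_int \<lfloor>x s / h\<rfloor>\<bar> \<le> 1" for s by linarith
  show le: "L2_set (\<lambda>s. x s - h * real_of_int (z s)) S \<le> \<delta>"
  proof -
    have "L2_set (\<lambda>s. x s - h * real_of_int (z s)) S \<le> sqrt (\<Sum>s\<in>S. h\<^sup>2)"
      unfolding L2_set_def
    proof (intro real_sqrt_le_mono sum_mono)
      fix s assume s: "s \<in> S"
      have "\<bar>x s - h * real_of_int (z s)\<bar> = h * \<bar>x s / h - real_of_int \<lfloor>x s / h\<rfloor>\<bar>"
        using h s abs_mult[of h "x s / h - real_of_int \<lfloor>x s / h\<rfloor>"] by (simp add: z_def right_diff_distrib)
      also have "\<dots> \<le> h * 1" by (rule mult_left_mono[OF fl]) (use h in simp)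
      finally show "(x s - h * real_of_int (z s))\<^sup>2 \<le> h\<^sup>2"
        using h by (intro abs_le_square_iff[THEN iffD1]) simp
    qed
    also have "\<dots> = h * sqrt n" using h by (simp add: n_def real_sqrt_mult)
    finally show ?thesis by (simp add: h2)
  qed
  have "1 \<le> h * L2_set (\<lambda>s. real_of_int (z s)) S + \<delta>"
    using L2_set_le_triangle[of x S "\<lambda>s. h * real_of_int (z s)"] le x h by (simp add: L2_set_scale)
  then have "L2_set (\<lambda>s. real_of_int (z s)) S \<noteq> 0" using d by auto
  then have pos: "0 < (\<Sum>s\<in>S. (real_of_int (z s))\<^sup>2)"
    using sum_nonneg[of S "\<lambda>s. (real_of_int (z s))\<^sup>2"] by (simp add: L2_set_def)
  have "(\<Sum>s\<in>S. \<bar>real_of_int (z s)\<bar>) \<le> (\<Sum>s\<in>S. \<bar>x s\<bar> / h + 1)"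
  proof (rule sum_mono)
    fix s assume s: "s \<in> S"
    have "\<bar>real_of_int (z s)\<bar> \<le> \<bar>x s / h\<bar> + 1" 
    proof -
      have "\<bar>real_of_int \<lfloor>x s / h\<rfloor>\<bar> \<le> \<bar>x s / h\<bar> + 1" using fl[of s] by linarith
      then show ?thesis using s by (simp add: z_def)
    qed
    then show "\<bar>real_of_int (z s)\<bar> \<le> \<bar>x s\<bar> / h + 1" using h by simp
  qed
  also have "\<dots> = (\<Sum>s\<in>S. \<bar>x s\<bar>) / h + n" by (simp add: sum.distrib sum_divide_distrib n_def)
  also have "(\<Sum>s\<in>S. \<bar>x s\<bar>) \<le> sqrt n"
    using L2_set_mult_ineq[of x "\<lambda>_. 1" S] x by (simp add: L2_set_def n_def)
  also have "sqrt n / h = n / \<delta>" using n by (simp add: h_def)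
  finally have "(\<Sum>s\<in>S. \<bar>real_of_int (z s)\<bar>) \<le> n / \<delta> + n" using h by (simp add: divide_right_mono)
  then show "z \<in> lattice_net S \<delta>" using pos by (simp add: lattice_net_def n_def z_def)
qed

section \<open>From lattice points to all vectors\<close>

definition lin :: "'s set \<Rightarrow> ('l \<Rightarrow> 's \<Rightarrow> real) \<Rightarrow> ('s \<Rightarrow> real) \<Rightarrow> 'l \<Rightarrow> real" where
  "lin S a x l = (\<Sum>s\<in>S. x s * a l s)"

lemma lin_diff: "lin S a (\<lambda>s. x s - y s) = (\<lambda>l. lin S a x l - lin S a y l)"
  by (rule ext) (simp add: lin_def left_diff_distrib sum_subtractf)

lemma lin_scale: "lin S a (\<lambda>s. c * x s) = (\<lambda>l. c * lin S a x l)"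
  by (rule ext) (simp add: lin_def sum_distrib_left mult.assoc)

lemma lin_normalize:
  assumes P: "\<And>x. L2_set x S = 1 \<Longrightarrow> P (L2_set (lin S a x) L)"
    and x: "L2_set x S \<noteq> 0"
  shows "P (L2_set (lin S a x) L / L2_set x S)"
proof -
  let ?c = "1 / L2_set x S"
  have "P (L2_set (lin S a (\<lambda>s. ?c * x s)) L)"
    by (rule P) (use x in \<open>simp only: L2_set_scale\<close>, simp)
  moreover have "L2_set (lin S a (\<lambda>s. ?c * x s)) L = L2_set (lin S a x) L / L2_set x S"
    unfolding lin_scale L2_set_scale by simp
  ultimately show ?thesis by simp
qed

lemma lin_zero:
  assumes "finite S" "L2_set x S = 0" shows "L2_set (lin S a x) L = 0"
proof -
  have "x s = 0" if "s \<in> S" for s using assms that by (simp add: L2_set_eq_0_iff)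
  then show ?thesis by (simp add: lin_def L2_set_def)
qed

text \<open>The Frobenius norm is a crude bound whose size is irrelevant; it provides the finite
  starting value for the iteration in \<open>lin_upper_bound_from_net\<close>.\<close>

lemma lin_bounded:
  assumes S: "finite S"
  obtains M where "0 \<le> M" "\<And>x. L2_set (lin S a x) L \<le> M * L2_set x S"
proof
  show "0 \<le> L2_set (\<lambda>l. L2_set (a l) S) L" by (rule L2_set_nonneg)
  fix x
  have "L2_set (lin S a x) L \<le> L2_set (\<lambda>l. L2_set x S * L2_set (a l) S) L"
    unfolding L2_set_def
  proof (intro real_sqrt_le_mono sum_mono)
    fix l
    have "\<bar>lin S a x l\<bar> \<le> (\<Sum>s\<in>S. \<bar>x s\<bar> * \<bar>a l s\<bar>)"
      unfolding lin_def using sum_abs[of "\<lambda>s. x s * a l s" S] by (simp add: abs_mult)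
    also have "\<dots> \<le> L2_set x S * L2_set (a l) S" by (rule L2_set_mult_ineq)
    finally show "(lin S a x l)\<^sup>2 \<le> (sqrt (\<Sum>s\<in>S. (x s)\<^sup>2) * sqrt (\<Sum>s\<in>S. (a l s)\<^sup>2))\<^sup>2"
      by (intro abs_le_square_iff[THEN iffD1]) (simp add: L2_set_def)
  qed
  also have "\<dots> = L2_set (\<lambda>l. L2_set (a l) S) L * L2_set x S" by (simp only: L2_set_scale) simp
  finally show "L2_set (lin S a x) L \<le> L2_set (\<lambda>l. L2_set (a l) S) L * L2_set x S" .
qed

text \<open>A bound M for the operator norm improves to 3T/2 + M/2: a unit vector differs by at most
  1/2 from a multiple of a net point, and that multiple has norm at most 3/2. Iterating from any
  finite M converges to the fixed point 3T.\<close>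

lemma lin_upper_bound_from_net:
  assumes S: "finite S" and T: "0 \<le> T"
    and net: "\<And>z. z \<in> lattice_net S (1 / 2) \<Longrightarrow>
      L2_set (lin S a (\<lambda>s. real_of_int (z s))) L \<le> T * L2_set (\<lambda>s. real_of_int (z s)) S"
  shows "L2_set (lin S a x) L \<le> 3 * T * L2_set x S"
proof -
  have step: "L2_set (lin S a x) L \<le> (3 / 2 * T + M / 2) * L2_set x S"
    if M: "\<And>x. L2_set (lin S a x) L \<le> M * L2_set x S" "0 \<le> M" for M x
  proof (cases "L2_set x S = 0")
    case False
    have "L2_set (lin S a x) L / L2_set x S \<le> 3 / 2 * T + M / 2"
    proof (rule lin_normalize[OF _ False])
      fix x assume x: "L2_set x S = 1"
      obtain z h where z: "z \<in> lattice_net S (1 / 2)" "0 < h"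
        and le: "L2_set (\<lambda>s. x s - h * real_of_int (z s)) S \<le> 1 / 2"
        using lattice_net_approx[OF S _ _ x, of "1 / 2"] by auto
      let ?y = "\<lambda>s. h * real_of_int (z s)"
      have "L2_set (\<lambda>s. ?y s - x s) S = L2_set (\<lambda>s. x s - ?y s) S"
        by (simp add: L2_set_def power2_commute)
      then have y: "L2_set ?y S \<le> 3 / 2" using L2_set_le_triangle[of ?y S x] x le by simp
      have "L2_set (lin S a x) L \<le> L2_set (lin S a ?y) L + L2_set (lin S a (\<lambda>s. x s - ?y s)) L"
        using L2_set_le_triangle[of "lin S a x" L "lin S a ?y"] by (simp only: lin_diff)
      also have "L2_set (lin S a ?y) L \<le> T * L2_set ?y S"
        using net[OF z(1)] z(2) by (simp add: lin_scale L2_set_scale)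
      also have "T * L2_set ?y S \<le> T * (3 / 2)" using y T by (rule mult_left_mono)
      also have "L2_set (lin S a (\<lambda>s. x s - ?y s)) L \<le> M * L2_set (\<lambda>s. x s - ?y s) S" by (rule M)
      also have "\<dots> \<le> M * (1 / 2)" using le M(2) by (rule mult_left_mono)
      finally show "L2_set (lin S a x) L \<le> 3 / 2 * T + M / 2" by simp
    qed
    then show ?thesis using False L2_set_nonneg[of x S] by (simp add: pos_divide_le_eq)
  qed (simp add: lin_zero[OF S])
  obtain M where M: "0 \<le> M" "\<And>x. L2_set (lin S a x) L \<le> M * L2_set x S"
    using lin_bounded[OF S] by blast
  have iter: "\<forall>x. L2_set (lin S a x) L \<le> (3 * T + M / 2 ^ k) * L2_set x S" for k
  proof (induction k)
    case 0
    have "M * L2_set x S \<le> (3 * T + M / 2 ^ 0) * L2_set x S" for x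
      using T by (intro mult_right_mono) auto
    then show ?case using M(2) order_trans by blast
  next
    case (Suc k)
    then have "L2_set (lin S a x) L \<le> (3 / 2 * T + (3 * T + M / 2 ^ k) / 2) * L2_set x S" for x
      by (intro step) (use T M(1) in auto)
    then show ?case by (simp add: add_divide_distrib mult.commute)
  qed
  have "(\<lambda>k. (3 * T + M * (1 / 2) ^ k) * L2_set x S) \<longlonglongrightarrow> (3 * T + M * 0) * L2_set x S"
    by (intro tendsto_intros) auto
  then have "(\<lambda>k. (3 * T + M / 2 ^ k) * L2_set x S) \<longlonglongrightarrow> 3 * T * L2_set x S"
    by (simp add: power_divide)
  then show ?thesis by (rule LIMSEQ_le_const) (use iter in blast)
qed

text \<open>At resolution t/(4T) \<le> 1/2 the approximant of a unit vector has norm at least 1/2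
  and image of norm at least t/2, while the error has image of norm at most T * t/(4T) =
  t/4.\<close>

lemma lin_lower_bound_from_net:
  assumes S: "finite S" and T: "0 < t" "t \<le> 2 * T"
    and up: "\<And>x. L2_set (lin S a x) L \<le> T * L2_set x S"
    and net: "\<And>z. z \<in> lattice_net S (t / (4 * T)) \<Longrightarrow>
      t * L2_set (\<lambda>s. real_of_int (z s)) S \<le> L2_set (lin S a (\<lambda>s. real_of_int (z s))) L"
  shows "t / 4 * L2_set x S \<le> L2_set (lin S a x) L"
proof (cases "L2_set x S = 0")
  case False
  have "t / 4 \<le> L2_set (lin S a x) L / L2_set x S"
  proof (rule lin_normalize[OF _ False])
    fix x assume x: "L2_set x S = 1"
    let ?d = "t / (4 * T)"
    have d: "0 < ?d" "?d \<le> 1 / 2" using T by (auto simp: field_simps)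
    obtain z h where z: "z \<in> lattice_net S ?d" "0 < h"
      and le: "L2_set (\<lambda>s. x s - h * real_of_int (z s)) S \<le> ?d"
      using lattice_net_approx[OF S d x] by auto
    let ?y = "\<lambda>s. h * real_of_int (z s)"
    have y: "1 / 2 \<le> L2_set ?y S" using L2_set_le_triangle[of x S ?y] x le d by simp
    have "t * (1 / 2) \<le> t * L2_set ?y S" using y T by (intro mult_left_mono) auto
    also have "\<dots> \<le> L2_set (lin S a ?y) L"
      using net[OF z(1)] z(2) by (simp add: lin_scale L2_set_scale)
    also have "\<dots> \<le> L2_set (lin S a x) L + L2_set (lin S a (\<lambda>s. ?y s - x s)) L"
      using L2_set_le_triangle[of "lin S a ?y" L "lin S a x"] by (simp only: lin_diff)
    also have "L2_set (lin S a (\<lambda>s. ?y s - x s)) L \<le> T * L2_set (\<lambda>s. ?y s - x s) S" by (rule up)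
    also have "L2_set (\<lambda>s. ?y s - x s) S = L2_set (\<lambda>s. x s - ?y s) S"
      by (simp add: L2_set_def power2_commute)
    also have "T * \<dots> \<le> T * ?d" using le T by (intro mult_left_mono) auto
    also have "T * ?d = t / 4" using T by simp
    finally show "t / 4 \<le> L2_set (lin S a x) L" by simp
  qed
  then show ?thesis using False L2_set_nonneg[of x S] by (simp add: pos_le_divide_eq)
qed (simp add: lin_zero[OF S])

section \<open>Well-conditioned Gaussian matrices\<close>

text \<open>The aspect ratio R is part of the predicate because the Bernstein inequality compares
  \<open>N\<close> with \<open>k\<close> when \<open>k\<close> exceeds half the number of
  rows.\<close>

definition well_conditioned :: "real \<Rightarrow> real \<Rightarrow> real mat \<Rightarrow> bool" where
  "well_conditioned K R \<Phi> \<longleftrightarrow>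
     0 < dim_row \<Phi> \<and> real (dim_col \<Phi>) = R * real (dim_row \<Phi>) \<and>
     (\<forall>c\<in>carrier_vec (dim_col \<Phi>). l2_norm (\<Phi> *\<^sub>v c) \<le> K * l2_norm c) \<and>
     (\<forall>f\<in>carrier_vec (dim_row \<Phi>). \<exists>c\<in>carrier_vec (dim_col \<Phi>).
        \<Phi> *\<^sub>v c = f \<and> l2_norm c \<le> K * l2_norm f) \<and>
     (\<forall>c\<in>carrier_vec (dim_col \<Phi>). 2 * l0_norm c \<le> dim_row \<Phi> \<longrightarrow> l2_norm c \<le> K * l2_norm (\<Phi> *\<^sub>v c))"

section \<open>Euclidean norms, preimages and transposes\<close>

lemma l2_norm_mult_mat_vec:
  assumes "c \<in> carrier_vec N" "S \<subseteq> {..<N}" "\<And>j. j < N \<Longrightarrow> j \<notin> S \<Longrightarrow> c $ j = 0"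
  shows "l2_norm (mat m N \<omega> *\<^sub>v c) = L2_set (lin S (\<lambda>i j. \<omega> (i, j)) (\<lambda>j. c $ j)) {..<m}"
proof -
  have "(mat m N \<omega> *\<^sub>v c) $ i = lin S (\<lambda>i j. \<omega> (i, j)) (\<lambda>j. c $ j) i" if "i < m" for i
  proof -
    have "(mat m N \<omega> *\<^sub>v c) $ i = (\<Sum>j\<in>{..<N}. c $ j * \<omega> (i, j))"
      using that assms(1) by (simp add: scalar_prod_def mult.commute atLeast0LessThan)
    also have "\<dots> = (\<Sum>j\<in>S. c $ j * \<omega> (i, j))"
      by (rule sum.mono_neutral_right) (use assms in auto)
    finally show ?thesis by (simp add: lin_def)
  qed
  then show ?thesis unfolding l2_norm_def by (intro L2_set_cong) auto
qed

lemma l2_norm_support: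
  assumes "c \<in> carrier_vec N" "S \<subseteq> {..<N}" "\<And>j. j < N \<Longrightarrow> j \<notin> S \<Longrightarrow> c $ j = 0"
  shows "l2_norm c = L2_set (\<lambda>j. c $ j) S"
  unfolding l2_norm_def L2_set_def using assms
  by (intro arg_cong[where f = sqrt] sum.mono_neutral_right) auto

lemma scalar_prod_self: "scalar_prod v v = (l2_norm v)\<^sup>2"
  by (simp add: l2_norm_def scalar_prod_def L2_set_def sum_nonneg power2_eq_square atLeast0LessThan)

lemma scalar_prod_le_l2_norm:
  assumes "dim_vec v = dim_vec w" shows "scalar_prod v w \<le> l2_norm v * l2_norm w"
proof -
  have "scalar_prod v w \<le> (\<Sum>i<dim_vec w. \<bar>v $ i\<bar> * \<bar>w $ i\<bar>)"
    unfolding scalar_prod_def by (simp add: atLeast0LessThan) (intro sum_mono, simp add: abs_mult[symmetric])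
  also have "\<dots> \<le> l2_norm v * l2_norm w"
    unfolding l2_norm_def assms by (rule L2_set_mult_ineq)
  finally show ?thesis .
qed

lemma l2_norm_nonneg [simp]: "0 \<le> l2_norm v"
  by (simp add: l2_norm_def L2_set_nonneg)

lemma l2_norm_eq_0: "v \<in> carrier_vec n \<Longrightarrow> l2_norm v = 0 \<longleftrightarrow> v = 0\<^sub>v n"
  by (auto simp: l2_norm_def L2_set_eq_0_iff)

text \<open>The preimage is the minimum-norm one, c = A^T y with A A^T y = f. The lower bound on A^T
  makes A A^T injective, and |c|^2 = <y, f> \<le> |y| |f| \<le> |c| |f| / b by the same
  bound.\<close>

lemma bounded_preimage:
  assumes A: "A \<in> carrier_mat m n" and b: "0 < b"
    and low: "\<And>y. y \<in> carrier_vec m \<Longrightarrow> b * l2_norm y \<le> l2_norm (transpose_mat A *\<^sub>v y)"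
    and f: "f \<in> carrier_vec m"
  shows "\<exists>c\<in>carrier_vec n. A *\<^sub>v c = f \<and> l2_norm c \<le> l2_norm f / b"
proof -
  let ?T = "transpose_mat A"
  define G where "G = A * ?T"
  have G: "G \<in> carrier_mat m m" using A by (simp add: G_def)
  have GT: "G *\<^sub>v y = A *\<^sub>v (?T *\<^sub>v y)" if "y \<in> carrier_vec m" for y
    unfolding G_def by (rule assoc_mult_mat_vec) (use A that in auto)
  have sq: "(l2_norm (?T *\<^sub>v y))\<^sup>2 = scalar_prod y (G *\<^sub>v y)" if y: "y \<in> carrier_vec m" for y
    using transpose_vec_mult_scalar[OF A, of "?T *\<^sub>v y" y] y A by (simp add: GT scalar_prod_self[symmetric])
  have "det G \<noteq> 0"
  proof
    assume "det G = 0"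
    then obtain v where v: "v \<in> carrier_vec m" "v \<noteq> 0\<^sub>v m" "G *\<^sub>v v = 0\<^sub>v m"
      using det_0_iff_vec_prod_zero[OF G] by auto
    then have "l2_norm (?T *\<^sub>v v) = 0" using sq[OF v(1)] by simp
    then have "l2_norm v \<le> 0" using low[OF v(1)] b by (simp add: mult_le_0_iff)
    then show False using v l2_norm_eq_0[OF v(1)] l2_norm_nonneg[of v] by linarith
  qed
  then obtain B where B: "B \<in> carrier_mat m m" "G * B = 1\<^sub>m m"
    using det_non_zero_imp_unit[OF G, of "()"] by (auto simp: Units_def ring_mat_def)
  define y where "y = B *\<^sub>v f"
  have y: "y \<in> carrier_vec m" unfolding y_def by (rule mult_mat_vec_carrier[OF B(1) f])
  have Gy: "G *\<^sub>v y = f" unfolding y_def using assoc_mult_mat_vec[OF G B(1) f, symmetric] B f by simp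
  let ?c = "?T *\<^sub>v y"
  have "(l2_norm ?c)\<^sup>2 \<le> l2_norm y * l2_norm f"
    using sq[OF y] scalar_prod_le_l2_norm[of y f] y f Gy by simp
  also have "\<dots> \<le> l2_norm ?c / b * l2_norm f"
    using low[OF y] b by (intro mult_right_mono) (auto simp: field_simps)
  finally have *: "l2_norm ?c * l2_norm ?c \<le> l2_norm ?c * (l2_norm f / b)"
    by (simp add: power2_eq_square)
  have "l2_norm ?c \<le> l2_norm f / b"
  proof (cases "l2_norm ?c = 0")
    case False
    then have "0 < l2_norm ?c" using l2_norm_nonneg[of ?c] by linarith
    then show ?thesis using mult_left_le_imp_le[OF *] by blast
  qed (use b in simp)
  then show ?thesis using A y Gy by (intro bexI[of _ ?c]) (auto simp: GT)
qed

text \<open>For u = A^T y one has |u|^2 = <y, A u> \<le> |y| T |u|; it remains to cancel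
  |u|.\<close>

lemma lin_transpose_upper_bound:
  assumes T: "0 \<le> T" and up: "\<And>x. L2_set (lin S a x) L \<le> T * L2_set x S"
  shows "L2_set (lin L (\<lambda>s l. a l s) y) S \<le> T * L2_set y L"
proof -
  let ?u = "lin L (\<lambda>s l. a l s) y"
  have "(L2_set ?u S)\<^sup>2 = (\<Sum>s\<in>S. \<Sum>l\<in>L. ?u s * (y l * a l s))"
    by (simp add: L2_set_def sum_nonneg power2_eq_square sum_distrib_left[symmetric])
      (simp add: lin_def)
  also have "\<dots> = (\<Sum>l\<in>L. y l * lin S a ?u l)"
    by (subst sum.swap) (simp add: lin_def[of S] sum_distrib_left mult_ac)
  also have "\<dots> \<le> (\<Sum>l\<in>L. \<bar>y l\<bar> * \<bar>lin S a ?u l\<bar>)"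
    by (intro sum_mono) (simp add: abs_mult[symmetric])
  also have "\<dots> \<le> L2_set y L * L2_set (lin S a ?u) L" by (rule L2_set_mult_ineq)
  also have "\<dots> \<le> L2_set y L * (T * L2_set ?u S)" by (intro mult_left_mono up L2_set_nonneg)
  finally have *: "L2_set ?u S * L2_set ?u S \<le> L2_set ?u S * (T * L2_set y L)"
    by (simp add: power2_eq_square mult_ac)
  show ?thesis
  proof (cases "L2_set ?u S = 0")
    case True
    then show ?thesis using T by (simp add: L2_set_nonneg)
  next
    case False
    then have "0 < L2_set ?u S" using L2_set_nonneg[of ?u S] by linarith
    then show ?thesis using mult_left_le_imp_le[OF *] by blast
  qed
qed

section \<open>Union bounds over the nets\<close>

lemma (in finite_measure) measure_UN_le_card:
  assumes "finite Z" "\<And>z. z \<in> Z \<Longrightarrow> A z \<in> sets M" "\<And>z. z \<in> Z \<Longrightarrow> measure M (A z) \<le> b" "real (card Z) \<le> c" "0 \<le> b"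
  shows "measure M (\<Union>z\<in>Z. A z) \<le> c * b"
proof -
  have "measure M (\<Union>z\<in>Z. A z) \<le> (\<Sum>z\<in>Z. measure M (A z))"
    using assms by (intro finite_measure_subadditive_finite) auto
  also have "\<dots> \<le> card Z * b" using assms(3) by (rule sum_bounded_above)
  also have "\<dots> \<le> c * b" using assms by (intro mult_right_mono) auto
  finally show ?thesis .
qed

text \<open>The two quantities are the per-row bases of the union bounds for the transpose and for
  sparse vectors. Up to constants they are t^(R-1) and sqrt t, so both vanish as t tends to 0, the
  first because R > 1.\<close>

lemma ex_small_radius:
  fixes R T :: real
  assumes "1 < R" "0 < T"
  obtains t where "0 < t" "t \<le> T" "108 * T / t * (2 * t) powr R \<le> exp (- 1)"
    "2 powr R * (sqrt (108 * T / t) * (2 * t)) \<le> exp (- 1)"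
proof -
  have "((\<lambda>t. 108 * T * 2 powr R * t powr (R - 1)) \<longlongrightarrow> 108 * T * 2 powr R * 0) (at_right 0)"
    using assms by (intro tendsto_mult tendsto_const tendsto_zero_powrI[where b = "R - 1"]) (use assms in \<open>auto intro: eventually_at_right_less[THEN eventually_mono]\<close>)
  moreover have "((\<lambda>t. 2 powr R * (2 * sqrt (108 * T)) * sqrt t) \<longlongrightarrow> 2 powr R * (2 * sqrt (108 * T)) * sqrt 0) (at_right 0)"
    by (intro tendsto_intros)
  ultimately have "\<forall>\<^sub>F t in at_right 0. 108 * T * 2 powr R * t powr (R - 1) < exp (- 1)
      \<and> 2 powr R * (2 * sqrt (108 * T)) * sqrt t < exp (- 1) \<and> t \<in> {0<..<T}"
    using assms by (intro eventually_conj order_tendstoD(2) eventually_at_right_real) auto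
  then obtain t where t: "108 * T * 2 powr R * t powr (R - 1) < exp (- 1)"
      "2 powr R * (2 * sqrt (108 * T)) * sqrt t < exp (- 1)" "0 < t" "t < T"
    using eventually_happens[of _ "at_right (0::real)"] by auto
  show ?thesis
  proof
    have "108 * T / t * (2 * t) powr R = 108 * T * 2 powr R * (t powr R / t powr 1)"
      using t by (simp add: powr_mult)
    then show "108 * T / t * (2 * t) powr R \<le> exp (- 1)" using t by (simp add: powr_diff)
    have "sqrt (108 * T / t) * (2 * t) = 2 * sqrt (108 * T) * (t / sqrt t)"
      using t by (simp add: real_sqrt_divide)
    also have "t / sqrt t = sqrt t" using t by (simp add: real_div_sqrt)
    finally show "2 powr R * (sqrt (108 * T / t) * (2 * t)) \<le> exp (- 1)"
      using t(2) by (simp only: mult.assoc less_imp_le)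
  qed (use t in auto)
qed

lemma gaussian_well_conditioned:
  fixes R :: real
  assumes R: "1 < R"
  shows "\<exists>K\<ge>1. \<forall>m N. R = real N / real m \<longrightarrow>
    (\<exists>E\<in>sets (gaussian_entries m N). measure (gaussian_entries m N) E \<le> 3 * exp (- real m) \<and>
      (\<forall>\<omega>\<in>space (gaussian_entries m N) - E. well_conditioned K R (mat m N \<omega>)))"
proof -
  \<comment> \<open>The net of resolution 1/2 has at most 54^N \<le> exp(6 R m) points;
    \<open>T1\<close> makes the total exponent 6 R + 1 - T1^2/4 equal to -1 per row.\<close>
  define T1 where "T1 = 2 * sqrt (6 * R + 2)"
  have T1sq: "T1\<^sup>2 = 4 * (6 * R + 2)" using R by (simp add: T1_def power_mult_distrib)
  have "1 \<le> sqrt (6 * R + 2)" using R by simp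
  then have T1: "2 \<le> T1" unfolding T1_def by linarith
  define T where "T = 3 * T1"
  have T: "1 \<le> T" "0 < T" using T1 by (auto simp: T_def)
  obtain t where t: "0 < t" "t \<le> T" and tB: "108 * T / t * (2 * t) powr R \<le> exp (- 1)"
    and tC: "2 powr R * (sqrt (108 * T / t) * (2 * t)) \<le> exp (- 1)"
    using ex_small_radius[OF R T(2)] by blast
  define \<delta> where "\<delta> = t / (4 * T)"
  have d: "0 < \<delta>" "\<delta> \<le> 1 / 2" using t T by (auto simp: \<delta>_def field_simps)
  have d27: "27 / \<delta> = 108 * T / t" using t T by (simp add: \<delta>_def)
  have base: "1 \<le> 108 * T / t" using t T by (simp add: field_simps)
  show ?thesis
  \<comment> \<open>\<open>T\<close> bounds the operator norm; \<open>4 / t\<close> inverts the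
    factor t/4 in the lower bounds for the transpose and for sparse vectors.\<close>
  proof (intro exI[of _ "max T (4 / t)"] conjI allI impI)
    show "1 \<le> max T (4 / t)" using T by simp
    fix m N :: nat
    assume RN: "R = real N / real m"
    then have m: "0 < m" using R by (cases "m = 0") auto
    then have N: "real N = R * real m" using RN by simp
    then have "real m < real N" unfolding N using R m by simp
    then have mN: "m \<le> N" by simp
    interpret iid_normal "{..<m} \<times> {..<N}" "1 / sqrt m" by unfold_locales (use m in auto)
    have P: "P = gaussian_entries m N" by (simp add: P_def gaussian_entries_def)
    let ?rows = "\<lambda>(S :: nat set) (z :: nat \<Rightarrow> int) (\<omega> :: nat \<times> nat \<Rightarrow> real). \<Sum>i<m. (\<Sum>j\<in>S. real_of_int (z j) * \<omega> (i, j))\<^sup>2"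
    let ?cols = "\<lambda>(z :: nat \<Rightarrow> int) (\<omega> :: nat \<times> nat \<Rightarrow> real). \<Sum>j<N. (\<Sum>i<m. real_of_int (z i) * \<omega> (i, j))\<^sup>2"
    let ?sq = "\<lambda>S (z :: nat \<Rightarrow> int). \<Sum>s\<in>S. (real_of_int (z s))\<^sup>2"
    have inj1: "inj_on (\<lambda>(l, s). (l, s)) ({..<m} \<times> S)" for S :: "nat set" by (simp add: inj_on_def)
    have inj2: "inj_on (\<lambda>(l, s). (s, l)) ({..<N} \<times> {..<m})" by (simp add: inj_on_def)
    define A where "A z = {\<omega> \<in> space P. T1\<^sup>2 * ?sq {..<N} z \<le> ?rows {..<N} z \<omega>}" for z
    define B where "B z = {\<omega> \<in> space P. ?cols z \<omega> \<le> t\<^sup>2 * ?sq {..<m} z}" for z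
    define C where "C S z = {\<omega> \<in> space P. ?rows S z \<omega> \<le> t\<^sup>2 * ?sq S z}" for S z
    define EA where "EA = (\<Union>z\<in>lattice_net {..<N} (1 / 2). A z)"
    define EB where "EB = (\<Union>z\<in>lattice_net {..<m} \<delta>. B z)"
    define SS where "SS = {S. S \<subseteq> {..<N} \<and> 2 * card S \<le> m}"
    define EC where "EC = (\<Union>S\<in>SS. \<Union>z\<in>lattice_net S \<delta>. C S z)"
    have net: "0 < ?sq S z" if "z \<in> lattice_net S e" for S e z using that by (simp add: lattice_net_def)
    have A: "A z \<in> events" "prob (A z) \<le> exp (m * (1 - T1\<^sup>2 / 4))" if "z \<in> lattice_net {..<N} (1 / 2)" for z
      unfolding A_def
      by (rule large_deviation[OF finite_lessThan finite_lessThan inj1 _ net[OF that] m refl]; simp)+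
    have B: "B z \<in> events" "prob (B z) \<le> (2 * t) ^ N" if "z \<in> lattice_net {..<m} \<delta>" for z
      using small_ball[OF finite_lessThan finite_lessThan inj2 _ net[OF that] m refl t(1)] mN
      unfolding B_def by simp_all
    have fS: "finite S" if "S \<in> SS" for S using that finite_subset by (auto simp: SS_def)
    have C: "C S z \<in> events" "prob (C S z) \<le> (2 * t) ^ m" if "S \<in> SS" "z \<in> lattice_net S \<delta>" for S z
    proof -
      have S: "l \<in> {..<m} \<Longrightarrow> s \<in> S \<Longrightarrow> (l, s) \<in> {..<m} \<times> {..<N}" for l s
        using that(1) by (auto simp: SS_def)
      show "C S z \<in> events"
        unfolding C_def by (rule small_ball(1)[OF finite_lessThan fS[OF that(1)] inj1 S net[OF that(2)] m refl t(1)]) simp_all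
      have "prob (C S z) \<le> (2 * t) ^ card {..<m}"
        unfolding C_def by (rule small_ball(2)[OF finite_lessThan fS[OF that(1)] inj1 S net[OF that(2)] m refl t(1)]) simp_all
      then show "prob (C S z) \<le> (2 * t) ^ m" by simp
    qed
    have finC: "finite (lattice_net S \<delta>)" if "S \<in> SS" for S
      by (rule finite_lattice_net[OF fS[OF that] d])
    have finSS: "finite SS" unfolding SS_def by (rule finite_subset[of _ "Pow {..<N}"]) auto
    have EA: "EA \<in> events" unfolding EA_def by (rule sets.finite_UN) (use A finite_lattice_net[of "{..<N}" "1 / 2"] in auto)
    have EB: "EB \<in> events" unfolding EB_def by (rule sets.finite_UN) (use B finite_lattice_net[OF _ d, of "{..<m}"] in auto)
    have EC': "(\<Union>z\<in>lattice_net S \<delta>. C S z) \<in> events" if "S \<in> SS" for S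
      by (rule sets.finite_UN) (use C that finC in auto)
    have EC: "EC \<in> events" unfolding EC_def by (rule sets.finite_UN) (use EC' finSS in auto)
    have pow: "x ^ N = (x powr R) ^ m" if x: "0 < x" for x :: real
    proof -
      have "x ^ N = x powr (R * real m)" using powr_realpow[OF x, of N] by (simp only: N)
      also have "\<dots> = (x powr R) powr real m" by (rule powr_powr[symmetric])
      also have "\<dots> = (x powr R) ^ m" by (rule powr_realpow) (use x in simp)
      finally show ?thesis .
    qed
    have expm: "exp (- 1) ^ m = exp (- real m)" by (simp add: exp_of_nat_mult[symmetric])
    have pA: "prob EA \<le> exp (- real m)"
    proof -
      have "prob EA \<le> 54 ^ N * exp (m * (1 - T1\<^sup>2 / 4))"
        unfolding EA_def using card_lattice_net[of "{..<N}" "1 / 2"]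
        by (intro measure_UN_le_card A finite_lattice_net) auto
      also have "\<dots> \<le> exp 6 ^ N * exp (m * (1 - T1\<^sup>2 / 4))"
      proof (intro mult_right_mono power_mono)
        have "(54::real) \<le> 2 ^ 6" by simp
        also have "(2::real) ^ 6 \<le> exp 1 ^ 6" using exp_ge_add_one_self[of 1] by (intro power_mono) auto
        also have "exp 1 ^ 6 = exp (6::real)" by (simp add: exp_of_nat_mult[symmetric])
        finally show "(54::real) \<le> exp 6" .
      qed auto
      also have "\<dots> = exp (6 * (R * m) + m * (1 - T1\<^sup>2 / 4))"
        by (simp add: exp_of_nat_mult[symmetric] exp_add[symmetric] N mult.commute)
      also have "\<dots> = exp (- real m)" by (simp add: T1sq algebra_simps)
      finally show ?thesis .
    qed
    have pB: "prob EB \<le> exp (- real m)"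
    proof -
      have "prob EB \<le> (108 * T / t) ^ m * (2 * t) ^ N"
        unfolding EB_def using card_lattice_net[of "{..<m}" \<delta>] d t
        by (intro measure_UN_le_card B finite_lattice_net) (auto simp: d27)
      also have "(2 * t) ^ N = ((2 * t) powr R) ^ m"
        by (rule pow) (use t in simp)
      also have "(108 * T / t) ^ m * ((2 * t) powr R) ^ m = (108 * T / t * (2 * t) powr R) ^ m"
        by (simp only: power_mult_distrib)
      also have "\<dots> \<le> exp (- 1) ^ m" using tB t T by (intro power_mono) auto
      finally show ?thesis by (simp only: expm)
    qed
    have pC: "prob EC \<le> exp (- real m)"
    proof -
      have one: "prob (\<Union>z\<in>lattice_net S \<delta>. C S z) \<le> sqrt (108 * T / t) ^ m * (2 * t) ^ m" if S: "S \<in> SS" for S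
      proof -
        have "real (card (lattice_net S \<delta>)) \<le> (108 * T / t) ^ card S"
          using card_lattice_net[OF fS[OF S] d] by (simp only: d27)
        \<comment> \<open>As 2 card S \<le> m and the base is at least 1, the net costs at most the
          power m/2 of 108T/t, against the full power m of 2t gained from the small ball.\<close>
        also have "\<dots> = sqrt (108 * T / t) ^ (2 * card S)" using base by (simp add: power_mult)
        also have "\<dots> \<le> sqrt (108 * T / t) ^ m" using S base by (intro power_increasing) (auto simp: SS_def)
        finally show ?thesis
          using t S by (intro measure_UN_le_card C finC) auto
      qed
      have "card SS \<le> card (Pow {..<N})" by (rule card_mono) (auto simp: SS_def)
      then have "real (card SS) \<le> real (2 ^ N)" by (subst of_nat_le_iff) (simp add: card_Pow)
      then have cS: "real (card SS) \<le> (2 powr R) ^ m"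
        using pow[of 2] by simp
      have "prob EC \<le> (2 powr R) ^ m * (sqrt (108 * T / t) ^ m * (2 * t) ^ m)"
        unfolding EC_def by (rule measure_UN_le_card[OF finSS EC' one cS]) (use t T in auto)
      also have "\<dots> = (2 powr R * (sqrt (108 * T / t) * (2 * t))) ^ m"
        by (simp only: power_mult_distrib)
      also have "\<dots> \<le> exp (- 1) ^ m" using tC t T by (intro power_mono) auto
      finally show ?thesis by (simp only: expm)
    qed
    define E where "E = EA \<union> EB \<union> EC"
    have E: "E \<in> events" using EA EB EC by (simp add: E_def)
    have "prob E \<le> prob EA + prob EB + prob EC"
      unfolding E_def using measure_Un_le[of "EA \<union> EB" P EC] measure_Un_le[of EA P EB] EA EB EC by simp
    then have pE: "prob E \<le> 3 * exp (- real m)" using pA pB pC by linarith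
    have wc: "well_conditioned (max T (4 / t)) R (mat m N \<omega>)" if w: "\<omega> \<in> space P - E" for \<omega>
    proof -
      let ?K = "max T (4 / t)"
      let ?\<Phi> = "mat m N \<omega>"
      let ?a = "\<lambda>i j. \<omega> (i, j)"
      have wA: "?rows {..<N} z \<omega> \<le> T1\<^sup>2 * ?sq {..<N} z" if "z \<in> lattice_net {..<N} (1 / 2)" for z
      proof -
        have "\<omega> \<notin> A z" using w that unfolding E_def EA_def by blast
        then show ?thesis using w by (simp add: A_def not_le)
      qed
      have wB: "t\<^sup>2 * ?sq {..<m} z \<le> ?cols z \<omega>" if "z \<in> lattice_net {..<m} \<delta>" for z
      proof -
        have "\<omega> \<notin> B z" using w that unfolding E_def EB_def by blast
        then show ?thesis using w by (simp add: B_def not_le)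
      qed
      have wC: "t\<^sup>2 * ?sq S z \<le> ?rows S z \<omega>" if "S \<in> SS" "z \<in> lattice_net S \<delta>" for S z
      proof -
        have "\<omega> \<notin> C S z" using w that unfolding E_def EC_def by blast
        then show ?thesis using w by (simp add: C_def not_le)
      qed
      have sc: "sqrt (x\<^sup>2 * y) = x * sqrt y" if "0 \<le> x" for x y :: real
        using that by (simp add: real_sqrt_mult)
      have up: "L2_set (lin {..<N} ?a x) {..<m} \<le> T * L2_set x {..<N}" for x
        unfolding T_def
      proof (rule lin_upper_bound_from_net)
        fix z assume "z \<in> lattice_net {..<N} (1 / 2)"
        from real_sqrt_le_mono[OF wA[OF this]] T1
        show "L2_set (lin {..<N} ?a (\<lambda>s. real_of_int (z s))) {..<m} \<le> T1 * L2_set (\<lambda>s. real_of_int (z s)) {..<N}"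
          by (simp add: L2_set_def lin_def sc)
      qed (use T1 in auto)
      \<comment> \<open>The net argument for the lower bound on the transpose also needs an operator
        norm bound for the transpose.\<close>
      have upT: "L2_set (lin {..<m} (\<lambda>j i. \<omega> (i, j)) y) {..<N} \<le> T * L2_set y {..<m}" for y
        by (rule lin_transpose_upper_bound[OF _ up]) (use T in simp)
      have lowT: "t / 4 * L2_set y {..<m} \<le> L2_set (lin {..<m} (\<lambda>j i. \<omega> (i, j)) y) {..<N}" for y
      proof (rule lin_lower_bound_from_net[where T = T, OF _ _ _ upT])
        fix z assume "z \<in> lattice_net {..<m} (t / (4 * T))"
        from real_sqrt_le_mono[OF wB[OF this[folded \<delta>_def]]] t
        show "t * L2_set (\<lambda>s. real_of_int (z s)) {..<m} \<le> L2_set (lin {..<m} (\<lambda>j i. \<omega> (i, j)) (\<lambda>s. real_of_int (z s))) {..<N}"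
          by (simp add: L2_set_def lin_def sc)
      qed (use t T in auto)
      have lowS: "t / 4 * L2_set x S \<le> L2_set (lin S ?a x) {..<m}" if S: "S \<in> SS" for S x
      proof (rule lin_lower_bound_from_net[where T = T])
        fix z assume "z \<in> lattice_net S (t / (4 * T))"
        from real_sqrt_le_mono[OF wC[OF S this[folded \<delta>_def]]] t
        show "t * L2_set (\<lambda>s. real_of_int (z s)) S \<le> L2_set (lin S ?a (\<lambda>s. real_of_int (z s))) {..<m}"
          by (simp add: L2_set_def lin_def sc)
      next
        fix x :: "nat \<Rightarrow> real"
        let ?x = "\<lambda>s. if s \<in> S then x s else 0"
        have sub: "S \<subseteq> {..<N}" using S by (simp add: SS_def)
        have "lin S ?a x = lin {..<N} ?a ?x"
          unfolding lin_def by (rule ext, rule sum.mono_neutral_cong_left) (use sub in auto)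
        moreover have "L2_set x S = L2_set ?x {..<N}"
          unfolding L2_set_def
          by (rule arg_cong[where f = sqrt], rule sum.mono_neutral_cong_left) (use sub in auto)
        ultimately show "L2_set (lin S ?a x) {..<m} \<le> T * L2_set x S" using up by simp
      qed (use t T fS[OF S] in auto)
      show ?thesis
        unfolding well_conditioned_def dim_row_mat dim_col_mat
      proof (intro conjI ballI impI)
        show "0 < m" "real N = R * real m" by fact+
        show "l2_norm (?\<Phi> *\<^sub>v c) \<le> ?K * l2_norm c" if c: "c \<in> carrier_vec N" for c
        proof -
          have "l2_norm (?\<Phi> *\<^sub>v c) \<le> T * l2_norm c"
            using up[of "\<lambda>j. c $ j"] c l2_norm_mult_mat_vec[of c N "{..<N}" m \<omega>] l2_norm_support[of c N "{..<N}"]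
            by simp
          also have "\<dots> \<le> ?K * l2_norm c" by (intro mult_right_mono) auto
          finally show ?thesis .
        qed
        show "\<exists>c\<in>carrier_vec N. ?\<Phi> *\<^sub>v c = f \<and> l2_norm c \<le> ?K * l2_norm f" if f: "f \<in> carrier_vec m" for f
        proof -
          have tr: "transpose_mat ?\<Phi> = mat N m (\<lambda>(j, i). \<omega> (i, j))" by (rule eq_matI) auto
          have "\<exists>c\<in>carrier_vec N. ?\<Phi> *\<^sub>v c = f \<and> l2_norm c \<le> l2_norm f / (t / 4)"
          proof (rule bounded_preimage[OF _ _ _ f])
            show "t / 4 * l2_norm y \<le> l2_norm (transpose_mat ?\<Phi> *\<^sub>v y)" if y: "y \<in> carrier_vec m" for y
              using lowT[of "\<lambda>j. y $ j"] y l2_norm_support[of y m "{..<m}"]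
                l2_norm_mult_mat_vec[of y m "{..<m}" N "\<lambda>(j, i). \<omega> (i, j)"] by (simp add: tr)
          qed (use t in auto)
          then obtain c where c: "c \<in> carrier_vec N" "?\<Phi> *\<^sub>v c = f" "l2_norm c \<le> 4 / t * l2_norm f"
            by (auto simp: mult.commute)
          have "4 / t * l2_norm f \<le> ?K * l2_norm f" by (intro mult_right_mono) auto
          then show ?thesis using c by force
        qed
        show "l2_norm c \<le> ?K * l2_norm (?\<Phi> *\<^sub>v c)" if c: "c \<in> carrier_vec N" and k: "2 * l0_norm c \<le> m" for c
        proof -
          define S where "S = {j. j < N \<and> c $ j \<noteq> 0}"
          have S: "S \<in> SS" using k c by (auto simp: SS_def S_def l0_norm_def)
          have "t / 4 * l2_norm c \<le> l2_norm (?\<Phi> *\<^sub>v c)"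
            using lowS[OF S, of "\<lambda>j. c $ j"] c
            by (subst l2_norm_mult_mat_vec[where S = S], (auto simp: S_def)[3], subst l2_norm_support[where S = S], (auto simp: S_def)[3]) simp
          then have "l2_norm c \<le> 4 / t * l2_norm (?\<Phi> *\<^sub>v c)" using t by (simp add: field_simps)
          also have "\<dots> \<le> ?K * l2_norm (?\<Phi> *\<^sub>v c)" by (intro mult_right_mono) auto
          finally show ?thesis .
        qed
      qed
    qed
    show "\<exists>E\<in>sets (gaussian_entries m N). measure (gaussian_entries m N) E \<le> 3 * exp (- real m) \<and>
      (\<forall>\<omega>\<in>space (gaussian_entries m N) - E. well_conditioned (max T (4 / t)) R (mat m N \<omega>))"
      using E pE wc unfolding P by blast
  qed
qed

section \<open>Decreasing rearrangements and dyadic blocks\<close>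

lemma powr_add_le:
  fixes x y a :: real
  assumes "0 < a" "a \<le> 1" "0 \<le> x" "0 \<le> y"
  shows "(x + y) powr a \<le> x powr a + y powr a"
proof (cases "x + y = 0")
  case False
  define s where "s = x + y"
  have s: "0 < s" using False assms by (simp add: s_def)
  \<comment> \<open>On [0,1] the power with exponent a \<le> 1 dominates the identity; the fractions
    x/s and y/s lie there and add up to 1.\<close>
  have le: "u / s \<le> u powr a / s powr a" if "0 \<le> u" "u \<le> s" for u
    using powr_mono'[of a 1 "u / s"] that assms s by (simp add: powr_divide)
  have "1 = x / s + y / s" using s by (simp add: s_def add_divide_distrib[symmetric])
  also have "\<dots> \<le> x powr a / s powr a + y powr a / s powr a"
    using assms by (intro add_mono le) (auto simp: s_def)
  finally show ?thesis using s by (simp add: s_def[symmetric] add_divide_distrib[symmetric])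
qed (use assms in auto)

lemma powr_sum_le:
  fixes x :: "'a \<Rightarrow> real"
  assumes "0 < a" "a \<le> 1" "\<And>i. i \<in> I \<Longrightarrow> 0 \<le> x i"
  shows "(\<Sum>i\<in>I. x i) powr a \<le> (\<Sum>i\<in>I. x i powr a)"
  using assms(3)
proof (induction I rule: infinite_finite_induct)
  case (insert i I)
  then have "(x i + (\<Sum>i\<in>I. x i)) powr a \<le> x i powr a + (\<Sum>i\<in>I. x i) powr a"
    by (intro powr_add_le assms(1,2) sum_nonneg) auto
  with insert show ?case by force
qed auto

text \<open>Hoelder's inequality between the exponents \<tau> and 2. Each square is compared with
  the mean Q/k, where Q is the sum of squares, through Young's inequality v^(\<tau>/2) \<le>
  (\<tau>/2) v + 1 - \<tau>/2.\<close>

lemma sum_powr_le_card: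
  fixes x :: "'a \<Rightarrow> real"
  assumes S: "finite S" "real (card S) \<le> k" and t: "0 < \<tau>" "\<tau> \<le> 2"
  shows "(\<Sum>s\<in>S. \<bar>x s\<bar> powr \<tau>) \<le> k powr (1 - \<tau> / 2) * (\<Sum>s\<in>S. (x s)\<^sup>2) powr (\<tau> / 2)"
proof (cases "(\<Sum>s\<in>S. (x s)\<^sup>2) = 0")
  case True
  then have "x s = 0" if "s \<in> S" for s using that S by (simp add: sum_nonneg_eq_0_iff)
  then show ?thesis by simp
next
  case False
  define Q where "Q = (\<Sum>s\<in>S. (x s)\<^sup>2)"
  have Q: "0 < Q" using False sum_nonneg[of S "\<lambda>s. (x s)\<^sup>2"] by (simp add: Q_def)
  have "S \<noteq> {}" using False by auto
  then have "1 \<le> card S" using S by (simp add: Suc_leI card_gt_0_iff)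
  then have k: "1 \<le> k" using S by linarith
  let ?M = "Q / k"
  have term_le: "\<bar>x s\<bar> powr \<tau> \<le> ?M powr (\<tau> / 2) * (\<tau> / 2 * ((x s)\<^sup>2 / ?M) + (1 - \<tau> / 2))" for s
  proof (cases "x s = 0")
    case False
    have "\<bar>x s\<bar> powr \<tau> = ((x s)\<^sup>2) powr (\<tau> / 2)"
      using powr_powr[of "\<bar>x s\<bar>" 2 "\<tau> / 2"] False by simp
    also have "\<dots> = ?M powr (\<tau> / 2) * ((x s)\<^sup>2 / ?M) powr (\<tau> / 2)"
      using Q k by (simp add: powr_mult[symmetric])
    also have "((x s)\<^sup>2 / ?M) powr (\<tau> / 2) \<le> \<tau> / 2 * ((x s)\<^sup>2 / ?M) + (1 - \<tau> / 2)"
      using Youngs_inequality_0[of "\<tau> / 2" "1 - \<tau> / 2" "(x s)\<^sup>2 / ?M" 1] t Q k False by simp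
    finally show ?thesis by (simp add: mult_left_mono)
  qed (use t in simp)
  have "(\<Sum>s\<in>S. \<bar>x s\<bar> powr \<tau>) \<le> (\<Sum>s\<in>S. ?M powr (\<tau> / 2) * (\<tau> / 2 * ((x s)\<^sup>2 / ?M) + (1 - \<tau> / 2)))"
    by (intro sum_mono term_le)
  also have "\<dots> = ?M powr (\<tau> / 2) * (\<tau> / 2 * (Q / ?M) + (1 - \<tau> / 2) * card S)"
    by (simp add: sum_distrib_left[symmetric] sum.distrib sum_divide_distrib[symmetric] Q_def mult.commute)
  also have "\<dots> \<le> ?M powr (\<tau> / 2) * (\<tau> / 2 * k + (1 - \<tau> / 2) * k)"
    using Q k S t by (intro mult_left_mono add_mono) auto
  also have "\<dots> = (Q / k) powr (\<tau> / 2) * k" by (simp add: algebra_simps)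
  also have "\<dots> = k powr (1 - \<tau> / 2) * Q powr (\<tau> / 2)"
    using Q k by (simp add: powr_divide powr_diff)
  finally show ?thesis by (simp add: Q_def)
qed

lemma sum_geometric_le:
  fixes \<rho> :: real
  assumes "0 \<le> \<rho>" "\<rho> < 1" "finite I" "inj_on f I"
  shows "(\<Sum>i\<in>I. \<rho> ^ f i) \<le> 1 / (1 - \<rho>)"
proof -
  have "(\<Sum>i\<in>I. \<rho> ^ f i) = (\<Sum>n\<in>f ` I. \<rho> ^ n)" using assms by (simp add: sum.reindex)
  also have "\<dots> \<le> (\<Sum>n. \<rho> ^ n)" using assms by (intro sum_le_suminf) auto
  also have "\<dots> = 1 / (1 - \<rho>)" using assms by (intro suminf_geometric) simp
  finally show ?thesis .
qed

text \<open>Schur test: after exchanging the sums, the exponents met by a fixed \<open>l\<close> are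
  pairwise distinct, so its coefficient is at most the full geometric series.\<close>

lemma schur_geometric:
  fixes w :: "nat \<Rightarrow> real"
  assumes r: "0 \<le> \<rho>" "\<rho> < 1" and fin: "finite I" "finite J" "\<And>i. i \<in> I \<Longrightarrow> A i \<subseteq> J"
    and inj: "\<And>l. l \<in> J \<Longrightarrow> inj_on (\<lambda>i. f i l) {i \<in> I. l \<in> A i}" and w: "\<And>l. 0 \<le> w l"
  shows "(\<Sum>i\<in>I. \<Sum>l\<in>A i. \<rho> ^ f i l * w l) \<le> (\<Sum>l\<in>J. w l) / (1 - \<rho>)"
proof -
  have "(\<Sum>i\<in>I. \<Sum>l\<in>A i. \<rho> ^ f i l * w l) = (\<Sum>i\<in>I. \<Sum>l\<in>{l \<in> J. l \<in> A i}. \<rho> ^ f i l * w l)"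
    using fin by (intro sum.cong) auto
  also have "\<dots> = (\<Sum>l\<in>J. \<Sum>i\<in>{i \<in> I. l \<in> A i}. \<rho> ^ f i l * w l)"
    using fin by (intro sum.swap_restrict) auto
  also have "\<dots> = (\<Sum>l\<in>J. (\<Sum>i\<in>{i \<in> I. l \<in> A i}. \<rho> ^ f i l) * w l)"
    by (simp add: sum_distrib_right)
  also have "\<dots> \<le> (\<Sum>l\<in>J. 1 / (1 - \<rho>) * w l)"
    using r fin inj w by (intro sum_mono mult_right_mono sum_geometric_le) auto
  also have "\<dots> = (\<Sum>l\<in>J. w l) / (1 - \<rho>)" by (simp add: sum_divide_distrib)
  finally show ?thesis .
qed

text \<open>The sequence lives on all naturals and vanishes from \<open>N\<close> on, so that dyadic
  blocks may run past \<open>N\<close>.\<close>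

locale rearrangement =
  fixes a :: "nat \<Rightarrow> real" and N :: nat
  assumes antimono: "\<And>i j. i \<le> j \<Longrightarrow> a j \<le> a i" and nonneg: "\<And>j. 0 \<le> a j" and zero: "\<And>j. N \<le> j \<Longrightarrow> a j = 0"
begin

text \<open>
  The value \<open>2 ^ l div 2\<close> is the first index of the \<open>l\<close>-th dyadic block: the blocks are \<open>{0}\<close> for \<open>l = 0\<close> and
  \<open>{2 ^ (l - 1)..<2 ^ l}\<close> for \<open>l > 0\<close>.
\<close>

definition weight :: "real \<Rightarrow> nat \<Rightarrow> real" where
  "weight q l = 2 ^ l * a (2 ^ l div 2) powr q"

lemma weight_nonneg: "0 \<le> weight q l" by (simp add: weight_def)

lemma powr_antimono: "0 < q \<Longrightarrow> i \<le> j \<Longrightarrow> a j powr q \<le> a i powr q"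
  by (intro powr_mono2 antimono nonneg) auto

lemma sum_lessThan_le:
  assumes "0 < q" shows "(\<Sum>j<n. a j powr q) \<le> (\<Sum>j<N. a j powr q)"
proof -
  have "(\<Sum>j<n. a j powr q) \<le> (\<Sum>j<max n N. a j powr q)" by (intro sum_mono2) auto
  also have "\<dots> = (\<Sum>j<N. a j powr q)" using zero assms by (intro sum.mono_neutral_right) auto
  finally show ?thesis .
qed

lemma block_le:
  assumes "0 < q"
  shows "(\<Sum>j\<in>{2 ^ i..<2 ^ Suc i}. a j powr q) \<le> weight q (Suc i)"
proof -
  have "(\<Sum>j\<in>{2 ^ i..<2 ^ Suc i}. a j powr q) \<le> of_nat (card {2 ^ i..<2 ^ Suc i :: nat}) * a (2 ^ i) powr q"
    using assms by (intro sum_bounded_above powr_antimono) auto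
  also have "\<dots> \<le> weight q (Suc i)"
    unfolding weight_def by (simp add: mult_right_mono)
  finally show ?thesis .
qed

lemma head_le:
  assumes "0 < q" shows "(\<Sum>j<2 ^ i. a j powr q) \<le> (\<Sum>l\<le>i. weight q l)"
proof (induction i)
  case (Suc i)
  have "(\<Sum>j<2 ^ Suc i. a j powr q) = (\<Sum>j<2 ^ i. a j powr q) + (\<Sum>j\<in>{2 ^ i..<2 ^ Suc i}. a j powr q)"
    unfolding lessThan_atLeast0 by (rule sum.atLeastLessThan_concat[symmetric]) simp_all
  then show ?case using Suc block_le[OF assms, of i] by simp
qed (simp add: weight_def)

lemma tail_le:
  assumes "0 < q" shows "(\<Sum>j\<in>{2 ^ i..<2 ^ (i + n)}. a j powr q) \<le> (\<Sum>l\<in>{i<..i + n}. weight q l)"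
proof (induction n)
  case (Suc n)
  have "(\<Sum>j\<in>{2 ^ i..<2 ^ (i + Suc n)}. a j powr q)
      = (\<Sum>j\<in>{2 ^ i..<2 ^ (i + n)}. a j powr q) + (\<Sum>j\<in>{2 ^ (i + n)..<2 ^ Suc (i + n)}. a j powr q)"
    unfolding add_Suc_right
    by (rule sum.atLeastLessThan_concat[symmetric]) (intro power_increasing; simp)+
  moreover have "{i<..i + Suc n} = insert (Suc (i + n)) {i<..i + n}" by auto
  ultimately show ?case using Suc block_le[OF assms, of "i + n"] by simp
qed simp

text \<open>By monotonicity the first value of a block is at most every value of the preceding
  block. That block has a quarter as many entries as the factor 2^l in the weight, whence the 4; the
  entry \<open>a 0\<close> accounts for the fifth unit.\<close>

lemma sum_weight_le:
  assumes "0 < q" shows "(\<Sum>l\<le>Q. weight q l) \<le> 5 * (\<Sum>j<N. a j powr q)"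
proof -
  have "(\<Sum>l\<le>Suc Q. weight q l) \<le> a 0 powr q + 4 * (\<Sum>j<2 ^ Q. a j powr q)" for Q
  proof (induction Q)
    case 0
    then show ?case using powr_antimono[OF assms, of 0 1] powr_ge_zero[of "a 0" q] by (simp add: weight_def del: powr_ge_zero)
  next
    case (Suc Q)
    have *: "(\<Sum>j<2 ^ Suc Q. a j powr q) = (\<Sum>j<2 ^ Q. a j powr q) + (\<Sum>j\<in>{2 ^ Q..<2 ^ Suc Q}. a j powr q)"
      unfolding lessThan_atLeast0 by (rule sum.atLeastLessThan_concat[symmetric]) simp_all
    have "of_nat (card {2 ^ Q..<2 ^ Suc Q :: nat}) * a (2 ^ Suc Q) powr q \<le> (\<Sum>j\<in>{2 ^ Q..<2 ^ Suc Q}. a j powr q)"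
      using assms by (intro sum_bounded_below powr_antimono) auto
    then have "weight q (Suc (Suc Q)) \<le> 4 * (\<Sum>j\<in>{2 ^ Q..<2 ^ Suc Q}. a j powr q)"
      by (simp add: weight_def)
    then show ?case using Suc * by simp
  qed
  then have "(\<Sum>l\<le>Suc Q. weight q l) \<le> a 0 powr q + 4 * (\<Sum>j<2 ^ Q. a j powr q)" .
  also have "a 0 powr q \<le> (\<Sum>j<N. a j powr q)" using sum_lessThan_le[OF assms, of 1] by simp
  also have "(\<Sum>j<2 ^ Q. a j powr q) \<le> (\<Sum>j<N. a j powr q)" by (rule sum_lessThan_le[OF assms])
  finally have "(\<Sum>l\<le>Suc Q. weight q l) \<le> 5 * (\<Sum>j<N. a j powr q)" by simp
  then show ?thesis using weight_nonneg[of q "Suc Q"] by simp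
qed

text \<open>A Hardy inequality. The tail of squares is at most a sum of block weights, the power
  \<tau>/2 \<le> 1 is subadditive, and measuring block l at level i < l costs \<rho>^(l-i) with
  \<rho> = 2^(-(1-\<tau>/2)) < 1, so the Schur test applies.\<close>

lemma sum_tail_le:
  assumes t: "0 < \<tau>" "\<tau> \<le> 1"
  shows "(\<Sum>i<M. 2 powr (i * (1 - \<tau> / 2)) * (\<Sum>j\<in>{2 ^ i..<N}. (a j)\<^sup>2) powr (\<tau> / 2))
     \<le> 5 / (1 - 2 powr - (1 - \<tau> / 2)) * (\<Sum>j<N. a j powr \<tau>)"
proof -
  let ?\<alpha> = "1 - \<tau> / 2"
  let ?\<rho> = "2 powr - ?\<alpha>"
  have rho: "0 \<le> ?\<rho>" "?\<rho> < 1" using t powr_less_mono[of "- ?\<alpha>" 0 2] by auto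
  have "2 powr (i * ?\<alpha>) * (\<Sum>j\<in>{2 ^ i..<N}. (a j)\<^sup>2) powr (\<tau> / 2) \<le> (\<Sum>l\<in>{i<..i + N}. ?\<rho> ^ (l - i) * weight \<tau> l)" for i
  proof -
    have "(\<Sum>j\<in>{2 ^ i..<N}. (a j)\<^sup>2) \<le> (\<Sum>j\<in>{2 ^ i..<2 ^ (i + N)}. a j powr 2)"
    proof -
      have "N < 2 ^ N" by simp
      also have "(2::nat) ^ N \<le> 2 ^ (i + N)" by (intro power_increasing) auto
      finally have "{2 ^ i..<N} \<subseteq> {2 ^ i..<2 ^ (i + N)}" by auto
      then show ?thesis by (subst powr_numeral) (auto intro!: sum_mono2 simp: nonneg)
    qed
    also have "\<dots> \<le> (\<Sum>l\<in>{i<..i + N}. weight 2 l)" by (rule tail_le) simp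
    finally have "(\<Sum>j\<in>{2 ^ i..<N}. (a j)\<^sup>2) powr (\<tau> / 2) \<le> (\<Sum>l\<in>{i<..i + N}. weight 2 l) powr (\<tau> / 2)"
      using t by (intro powr_mono2 sum_nonneg) auto
    also have "\<dots> \<le> (\<Sum>l\<in>{i<..i + N}. weight 2 l powr (\<tau> / 2))"
      using t by (intro powr_sum_le weight_nonneg) auto
    finally have "2 powr (i * ?\<alpha>) * (\<Sum>j\<in>{2 ^ i..<N}. (a j)\<^sup>2) powr (\<tau> / 2)
      \<le> (\<Sum>l\<in>{i<..i + N}. 2 powr (i * ?\<alpha>) * weight 2 l powr (\<tau> / 2))"
      by (simp add: sum_distrib_left[symmetric])
    also have "\<dots> = (\<Sum>l\<in>{i<..i + N}. ?\<rho> ^ (l - i) * weight \<tau> l)"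
    proof (rule sum.cong)
      fix l assume l: "l \<in> {i<..i + N}"
      have "?\<rho> ^ (l - i) * weight \<tau> l = 2 powr ((l - i) * - ?\<alpha>) * (2 powr l * a (2 ^ l div 2) powr \<tau>)"
        by (simp add: weight_def powr_realpow powr_power mult.commute)
      also have "\<dots> = 2 powr ((l - i) * - ?\<alpha> + l) * a (2 ^ l div 2) powr \<tau>"
        by (simp add: powr_add)
      also have "(l - i) * - ?\<alpha> + l = i * ?\<alpha> + l * (\<tau> / 2)"
        using l by (simp add: of_nat_diff algebra_simps diff_divide_distrib)
      also have "2 powr (i * ?\<alpha> + l * (\<tau> / 2)) * a (2 ^ l div 2) powr \<tau> = 2 powr (i * ?\<alpha>) * weight 2 l powr (\<tau> / 2)"
      proof -
        have "weight 2 l = 2 powr l * a (2 ^ l div 2) powr 2" by (simp add: weight_def powr_realpow)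
        then show ?thesis by (simp only: powr_mult powr_powr powr_add) simp
      qed
      finally show "2 powr (i * ?\<alpha>) * weight 2 l powr (\<tau> / 2) = ?\<rho> ^ (l - i) * weight \<tau> l" by simp
    qed simp
    finally show ?thesis .
  qed
  then have "(\<Sum>i<M. 2 powr (i * ?\<alpha>) * (\<Sum>j\<in>{2 ^ i..<N}. (a j)\<^sup>2) powr (\<tau> / 2))
      \<le> (\<Sum>i<M. \<Sum>l\<in>{i<..i + N}. ?\<rho> ^ (l - i) * weight \<tau> l)" by (intro sum_mono)
  also have "\<dots> \<le> (\<Sum>l\<le>M + N. weight \<tau> l) / (1 - ?\<rho>)"
    using rho by (intro schur_geometric) (auto simp: weight_nonneg inj_on_def)
  also have "\<dots> \<le> (5 * (\<Sum>j<N. a j powr \<tau>)) / (1 - ?\<rho>)"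
    using rho t by (intro divide_right_mono sum_weight_le) auto
  finally show ?thesis by simp
qed

text \<open>
  Hardy's inequality with exponent \<open>\<tau> / p > 1\<close>; half of the geometric decay is spent on replacing the
  inner sum by its largest term, which is at most \<open>V powr (p / \<tau>)\<close> in the proof.
\<close>

lemma sum_head_le:
  assumes p: "0 < p" "p < \<tau>" and t: "\<tau> \<le> 1"
  defines "u \<equiv> 2 powr - ((1 - p / \<tau>) / 2)"
  shows "(\<Sum>i<M. 2 powr (i * (1 - \<tau> / p)) * (\<Sum>j<2 ^ i. a j powr p) powr (\<tau> / p))
     \<le> (1 / (1 - u)) powr (\<tau> / p) * (5 / (1 - u powr (\<tau> / p))) * (\<Sum>j<N. a j powr \<tau>)"
proof -
  define q where "q = \<tau> / p"
  define \<kappa> where "\<kappa> = 1 - p / \<tau>"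
  have q: "1 < q" using p by (simp add: q_def)
  have k: "0 < \<kappa>" using p by (simp add: \<kappa>_def)
  \<comment> \<open>Used to move the prefactor inside the power: 2^(i (1 - q)) = (2^(-i
    \<kappa>))^q.\<close>
  have kq: "q * \<kappa> = q - 1" using p by (simp add: q_def \<kappa>_def field_simps)
  have u: "0 < u" "u < 1" using k powr_less_mono[of "- (\<kappa> / 2)" 0 2] by (auto simp: u_def \<kappa>_def)
  let ?\<rho> = "u powr q"
  have rho: "0 \<le> ?\<rho>" "?\<rho> < 1" using u q powr_less_mono2[of q u 1] by auto
  have "2 powr (i * (1 - q)) * (\<Sum>j<2 ^ i. a j powr p) powr q
      \<le> (1 / (1 - u)) powr q * (\<Sum>l\<le>i. ?\<rho> ^ (i - l) * weight \<tau> l)" for i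
  proof -
    define V where "V = (\<Sum>l\<le>i. ?\<rho> ^ (i - l) * weight \<tau> l)"
    have V: "0 \<le> V" unfolding V_def by (intro sum_nonneg) (simp add: weight_nonneg)
    have le: "2 powr (- (i * \<kappa>)) * weight p l \<le> u ^ (i - l) * V powr (1 / q)" if l: "l \<le> i" for l
    proof -
      have pow: "u ^ n = 2 powr (- (n * \<kappa> / 2))" for n
        by (simp add: u_def \<kappa>_def[symmetric] powr_power mult.commute)
      have "?\<rho> ^ (i - l) * weight \<tau> l \<le> V"
        unfolding V_def using l by (intro member_le_sum[of l "{..i}" "\<lambda>l. ?\<rho> ^ (i - l) * weight \<tau> l"]) (auto simp: weight_nonneg)
      then have "(?\<rho> ^ (i - l) * weight \<tau> l) powr (1 / q) \<le> V powr (1 / q)"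
        using q by (intro powr_mono2) (auto simp: weight_nonneg)
      moreover have "(?\<rho> ^ (i - l)) powr (1 / q) = u ^ (i - l)"
        using u q by (simp add: powr_power powr_powr powr_realpow[symmetric])
      moreover have "weight \<tau> l powr (1 / q) = 2 powr (l / q) * a (2 ^ l div 2) powr p"
        using p by (simp add: weight_def powr_mult powr_powr q_def powr_realpow[symmetric])
      ultimately have "u ^ (i - l) * (2 powr (l / q) * a (2 ^ l div 2) powr p) \<le> V powr (1 / q)"
        by (simp add: powr_mult)
      then have "u ^ (i - l) * (u ^ (i - l) * (2 powr (l / q) * a (2 ^ l div 2) powr p)) \<le> u ^ (i - l) * V powr (1 / q)"
        using u by (intro mult_left_mono) auto
      \<comment> \<open>Here u^2 = 2^(-\<kappa>) and 1/q = 1 - \<kappa>. One factor u^(i-l) comes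
        from the term of \<open>V\<close>; the other stays on the right-hand side and makes the sum
        over \<open>l\<close> converge.\<close>
      moreover have "u ^ (i - l) * u ^ (i - l) * 2 powr (l / q) = 2 powr (- (i * \<kappa>)) * 2 powr l"
      proof -
        have "1 / q = 1 - \<kappa>" using p by (simp add: q_def \<kappa>_def)
        then have "l * (1 / q) = l - l * \<kappa>" by (simp only:) (simp add: algebra_simps)
        then have "l / q = l - l * \<kappa>" by simp
        then show ?thesis using l by (simp add: pow powr_add[symmetric] of_nat_diff algebra_simps)
      qed
      ultimately show ?thesis by (simp add: weight_def powr_realpow[symmetric] mult.assoc[symmetric])
    qed
    have "2 powr (i * (1 - q)) * (\<Sum>j<2 ^ i. a j powr p) powr q
      = (2 powr (- (i * \<kappa>)) * (\<Sum>j<2 ^ i. a j powr p)) powr q"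
    proof -
      have "i * (1 - q) = i * - (q * \<kappa>)" by (simp only: kq) simp
      then have "i * (1 - q) = - (i * \<kappa>) * q" by simp
      then show ?thesis by (simp add: powr_mult powr_powr sum_nonneg)
    qed
    also have "\<dots> \<le> ((\<Sum>l\<le>i. u ^ (i - l)) * V powr (1 / q)) powr q"
    proof (rule powr_mono2)
      have "2 powr (- (i * \<kappa>)) * (\<Sum>j<2 ^ i. a j powr p) \<le> 2 powr (- (i * \<kappa>)) * (\<Sum>l\<le>i. weight p l)"
        by (intro mult_left_mono head_le p) simp
      also have "\<dots> \<le> (\<Sum>l\<le>i. u ^ (i - l) * V powr (1 / q))"
        unfolding sum_distrib_left by (intro sum_mono le) simp
      finally show "2 powr (- (i * \<kappa>)) * (\<Sum>j<2 ^ i. a j powr p) \<le> (\<Sum>l\<le>i. u ^ (i - l)) * V powr (1 / q)"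
        by (simp add: sum_distrib_right)
    qed (use q in \<open>auto intro!: mult_nonneg_nonneg sum_nonneg\<close>)
    also have "\<dots> \<le> (1 / (1 - u) * V powr (1 / q)) powr q"
    proof -
      have "(\<Sum>l\<le>i. u ^ (i - l)) \<le> 1 / (1 - u)"
        using u by (intro sum_geometric_le) (auto simp: inj_on_def)
      then show ?thesis using q u by (intro powr_mono2 mult_right_mono mult_nonneg_nonneg sum_nonneg) auto
    qed
    also have "\<dots> = (1 / (1 - u)) powr q * V" using V q by (simp only: powr_mult powr_powr) simp
    finally show ?thesis by (simp add: V_def)
  qed
  then have "(\<Sum>i<M. 2 powr (i * (1 - q)) * (\<Sum>j<2 ^ i. a j powr p) powr q)
      \<le> (1 / (1 - u)) powr q * (\<Sum>i<M. \<Sum>l\<le>i. ?\<rho> ^ (i - l) * weight \<tau> l)"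
    unfolding sum_distrib_left[of "(1 / (1 - u)) powr q"] by (intro sum_mono)
  also have "(\<Sum>i<M. \<Sum>l\<le>i. ?\<rho> ^ (i - l) * weight \<tau> l) \<le> (\<Sum>l\<le>M. weight \<tau> l) / (1 - ?\<rho>)"
    using rho by (intro schur_geometric) (auto simp: weight_nonneg inj_on_def)
  also have "\<dots> \<le> (5 * (\<Sum>j<N. a j powr \<tau>)) / (1 - ?\<rho>)"
    using rho p by (intro divide_right_mono sum_weight_le) auto
  finally show ?thesis using u by (simp add: q_def mult_left_mono)
qed

end

section \<open>Bernstein and Jackson inequalities\<close>

text \<open>The \<tau>-th power of the quasi-norm. It is subadditive for \<tau> \<le> 1, which
  \<open>lp_norm\<close> is not when \<tau> < 1, so the pieces of a telescoped vector are added in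
  this form.\<close>

definition power_sum :: "real \<Rightarrow> real vec \<Rightarrow> real" where
  "power_sum \<tau> c = (\<Sum>j<dim_vec c. \<bar>c $ j\<bar> powr \<tau>)"

lemma power_sum_nonneg [simp]: "0 \<le> power_sum \<tau> c"
  by (simp add: power_sum_def sum_nonneg)

lemma lp_norm_power_sum: "lp_norm \<tau> c = power_sum \<tau> c powr (1 / \<tau>)"
  by (simp add: lp_norm_def power_sum_def)

lemma power_sum_add_le:
  assumes "0 < \<tau>" "\<tau> \<le> 1" "dim_vec c = dim_vec d"
  shows "power_sum \<tau> (c + d) \<le> power_sum \<tau> c + power_sum \<tau> d"
proof -
  have "\<bar>x + y\<bar> powr \<tau> \<le> \<bar>x\<bar> powr \<tau> + \<bar>y\<bar> powr \<tau>" for x y :: real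
  proof -
    have "\<bar>x + y\<bar> powr \<tau> \<le> (\<bar>x\<bar> + \<bar>y\<bar>) powr \<tau>" using assms by (intro powr_mono2) auto
    also have "\<dots> \<le> \<bar>x\<bar> powr \<tau> + \<bar>y\<bar> powr \<tau>" using assms by (intro powr_add_le) auto
    finally show ?thesis .
  qed
  then show ?thesis using assms by (simp add: power_sum_def sum.distrib[symmetric] sum_mono)
qed

lemma power_sum_le_l0:
  assumes "0 < \<tau>" "\<tau> \<le> 2" "real (l0_norm c) \<le> k"
  shows "power_sum \<tau> c \<le> k powr (1 - \<tau> / 2) * l2_norm c powr \<tau>"
proof -
  let ?S = "{j. j < dim_vec c \<and> c $ j \<noteq> 0}"
  have "power_sum \<tau> c = (\<Sum>j\<in>?S. \<bar>c $ j\<bar> powr \<tau>)"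
    unfolding power_sum_def by (rule sum.mono_neutral_right) auto
  also have "\<dots> \<le> k powr (1 - \<tau> / 2) * (\<Sum>j\<in>?S. (c $ j)\<^sup>2) powr (\<tau> / 2)"
    using assms by (intro sum_powr_le_card) (auto simp: l0_norm_def)
  also have "(\<Sum>j\<in>?S. (c $ j)\<^sup>2) = (l2_norm c)\<^sup>2"
    unfolding l2_norm_def L2_set_def by (subst real_sqrt_pow2) (auto intro: sum_nonneg sum.mono_neutral_left)
  also have "((l2_norm c)\<^sup>2) powr (\<tau> / 2) = l2_norm c powr \<tau>"
    using powr_powr[of "l2_norm c" 2 "\<tau> / 2"] by simp
  finally show ?thesis .
qed

lemma l2_norm_triangle:
  assumes "f \<in> carrier_vec n" "g \<in> carrier_vec n" shows "l2_norm (f + g) \<le> l2_norm f + l2_norm g"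
proof -
  have "l2_norm (f + g) = L2_set (\<lambda>i. f $ i + g $ i) {..<n}"
    unfolding l2_norm_def using assms by (intro L2_set_cong) auto
  then show ?thesis using L2_set_triangle_ineq[of "($) f" "($) g" "{..<n}"] assms by (simp add: l2_norm_def)
qed

lemma l2_norm_minus_commute:
  assumes "f \<in> carrier_vec n" "g \<in> carrier_vec n" shows "l2_norm (f - g) = l2_norm (g - f)"
  unfolding l2_norm_def L2_set_def using assms
  by (auto intro!: arg_cong[where f = sqrt] sum.cong simp: power2_commute)

lemma l2_norm_triangle_sub:
  assumes "f \<in> carrier_vec n" "g \<in> carrier_vec n" "h \<in> carrier_vec n"
  shows "l2_norm (f - h) \<le> l2_norm (f - g) + l2_norm (g - h)"
proof -
  have "f - h = (f - g) + (g - h)" using assms by (intro eq_vecI) auto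
  then show ?thesis using l2_norm_triangle[of "f - g" n "g - h"] assms by simp
qed

lemma l0_norm_zero [simp]: "l0_norm (0\<^sub>v n) = 0"
  by (simp add: l0_norm_def)

lemma l0_norm_le_dim: "l0_norm c \<le> dim_vec c"
  unfolding l0_norm_def using card_mono[of "{..<dim_vec c}" "{j. j < dim_vec c \<and> c $ j \<noteq> 0}"] by auto

lemma l0_norm_minus_le:
  assumes "c \<in> carrier_vec n" "d \<in> carrier_vec n" shows "l0_norm (c - d) \<le> l0_norm c + l0_norm d"
proof -
  have "{j. j < n \<and> (c - d) $ j \<noteq> 0} \<subseteq> {j. j < n \<and> c $ j \<noteq> 0} \<union> {j. j < n \<and> d $ j \<noteq> 0}"
    using assms by auto
  then have "card {j. j < n \<and> (c - d) $ j \<noteq> 0} \<le> card ({j. j < n \<and> c $ j \<noteq> 0} \<union> {j. j < n \<and> d $ j \<noteq> 0})"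
    by (intro card_mono) auto
  also have "\<dots> \<le> card {j. j < n \<and> c $ j \<noteq> 0} + card {j. j < n \<and> d $ j \<noteq> 0}" by (rule card_Un_le)
  finally show ?thesis using assms by (simp add: l0_norm_def)
qed

lemma sparse_combs_carrier: "y \<in> sparse_combs \<Phi> k \<Longrightarrow> y \<in> carrier_vec (dim_row \<Phi>)"
  by (auto simp: sparse_combs_def intro!: carrier_vecI)

lemma sparse_combs_mono: "k \<le> l \<Longrightarrow> sparse_combs \<Phi> k \<subseteq> sparse_combs \<Phi> l"
  unfolding sparse_combs_def by force

lemma zero_in_sparse_combs: "0\<^sub>v (dim_row \<Phi>) \<in> sparse_combs \<Phi> k"
  unfolding sparse_combs_def
  by (rule CollectI, rule exI[of _ "0\<^sub>v (dim_col \<Phi>)"]) (auto simp: scalar_prod_def intro!: eq_vecI)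

lemma sparse_combs_minus:
  assumes "x \<in> sparse_combs \<Phi> k" "y \<in> sparse_combs \<Phi> l" shows "x - y \<in> sparse_combs \<Phi> (k + l)"
proof -
  obtain c d where cd: "x = \<Phi> *\<^sub>v c" "c \<in> carrier_vec (dim_col \<Phi>)" "l0_norm c \<le> k"
      "y = \<Phi> *\<^sub>v d" "d \<in> carrier_vec (dim_col \<Phi>)" "l0_norm d \<le> l"
    using assms by (auto simp: sparse_combs_def)
  then have "x - y = \<Phi> *\<^sub>v (c - d)" by (simp add: mult_minus_distrib_mat_vec[of \<Phi> "dim_row \<Phi>" "dim_col \<Phi>"])
  moreover have "l0_norm (c - d) \<le> k + l" using l0_norm_minus_le[OF cd(2,5)] cd by simp
  ultimately show ?thesis using cd by (auto simp: sparse_combs_def)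
qed

lemma bdd_below_l2_norm: "bdd_below ((\<lambda>y. l2_norm (f - y)) ` A)"
  by (rule bdd_belowI[of _ 0]) auto

lemma best_approx_error_le: "y \<in> sparse_combs \<Phi> k \<Longrightarrow> best_approx_error \<Phi> k f \<le> l2_norm (f - y)"
  unfolding best_approx_error_def by (rule cINF_lower[OF bdd_below_l2_norm])

lemma best_approx_error_greatest:
  "(\<And>y. y \<in> sparse_combs \<Phi> k \<Longrightarrow> u \<le> l2_norm (f - y)) \<Longrightarrow> u \<le> best_approx_error \<Phi> k f"
  unfolding best_approx_error_def using zero_in_sparse_combs by (intro cINF_greatest) auto

lemma best_approx_error_nonneg [simp]: "0 \<le> best_approx_error \<Phi> k f"
  by (rule best_approx_error_greatest) simp

lemma best_approx_error_antimono: "k \<le> l \<Longrightarrow> best_approx_error \<Phi> l f \<le> best_approx_error \<Phi> k f"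
  by (rule best_approx_error_greatest) (use sparse_combs_mono best_approx_error_le in blast)

lemma best_approx_error_le_l2_norm:
  assumes "f \<in> carrier_vec (dim_row \<Phi>)" shows "best_approx_error \<Phi> k f \<le> l2_norm f"
  using best_approx_error_le[OF zero_in_sparse_combs, of \<Phi> k f] assms by simp

text \<open>Near-best approximants suffice: the slack \<eta> is absorbed into the norm of
  \<open>f\<close> in \<open>telescoping\<close>.\<close>

lemma best_approx_error_attained:
  assumes "0 < \<eta>"
  shows "\<exists>y\<in>sparse_combs \<Phi> k. l2_norm (f - y) < best_approx_error \<Phi> k f + \<eta>"
proof (rule ccontr)
  assume "\<not> ?thesis"
  then have "best_approx_error \<Phi> k f + \<eta> \<le> best_approx_error \<Phi> k f"
    by (intro best_approx_error_greatest) (auto simp: not_less)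
  then show False using assms by simp
qed

lemma powr_le_self_of_ge_1: "1 \<le> x \<Longrightarrow> a \<le> 1 \<Longrightarrow> x powr a \<le> (x::real)"
  using powr_mono[of a 1 x] by simp

locale dictionary =
  fixes \<Phi> :: "real mat" and K R :: real
  assumes wc: "well_conditioned K R \<Phi>" and K: "1 \<le> K" and R: "1 < R"
begin

abbreviation "m \<equiv> dim_row \<Phi>"
abbreviation "N \<equiv> dim_col \<Phi>"

lemma bounded: "c \<in> carrier_vec N \<Longrightarrow> l2_norm (\<Phi> *\<^sub>v c) \<le> K * l2_norm c"
  and onto: "f \<in> carrier_vec m \<Longrightarrow> \<exists>c\<in>carrier_vec N. \<Phi> *\<^sub>v c = f \<and> l2_norm c \<le> K * l2_norm f"
  and injective: "c \<in> carrier_vec N \<Longrightarrow> 2 * l0_norm c \<le> m \<Longrightarrow> l2_norm c \<le> K * l2_norm (\<Phi> *\<^sub>v c)"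
  and N: "real N = R * real m" and m: "0 < m"
  using wc by (auto simp: well_conditioned_def)

lemma mult_diff: "c \<in> carrier_vec N \<Longrightarrow> d \<in> carrier_vec N \<Longrightarrow> \<Phi> *\<^sub>v (c - d) = \<Phi> *\<^sub>v c - \<Phi> *\<^sub>v d"
  by (rule mult_minus_distrib_mat_vec) auto

lemma mult_add: "c \<in> carrier_vec N \<Longrightarrow> d \<in> carrier_vec N \<Longrightarrow> \<Phi> *\<^sub>v (c + d) = \<Phi> *\<^sub>v c + \<Phi> *\<^sub>v d"
  by (rule mult_add_distrib_mat_vec) auto

text \<open>
  For \<open>k > m / 2\<close> the sparse representation is useless, but then \<open>N \<le> 2 R k\<close> and any preimage of
  bounded Euclidean norm will do.
\<close>

lemma Bernstein:
  assumes g: "g \<in> sparse_combs \<Phi> k" and k: "1 \<le> k" and t: "0 < \<tau>" "\<tau> \<le> 1"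
  shows "\<exists>c\<in>carrier_vec N. \<Phi> *\<^sub>v c = g \<and>
    power_sum \<tau> c \<le> 2 * K * R * (k powr (1 - \<tau> / 2) * l2_norm g powr \<tau>)"
proof -
  let ?\<alpha> = "1 - \<tau> / 2"
  \<comment> \<open>K \<ge> 1 and \<tau> \<le> 1 give K^\<tau> \<le> K, which keeps the constant
    free of \<tau>.\<close>
  have powK: "(K * l2_norm g) powr \<tau> \<le> K * l2_norm g powr \<tau>"
    using powr_le_self_of_ge_1[OF K t(2)] K by (simp add: powr_mult mult_right_mono)
  show ?thesis
  proof (cases "2 * k \<le> m")
    case True
    obtain c where c: "g = \<Phi> *\<^sub>v c" "c \<in> carrier_vec N" "l0_norm c \<le> k" using g by (auto simp: sparse_combs_def)
    have "power_sum \<tau> c \<le> k powr ?\<alpha> * l2_norm c powr \<tau>" using c t by (intro power_sum_le_l0) auto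
    also have "l2_norm c powr \<tau> \<le> (K * l2_norm g) powr \<tau>"
      using injective[OF c(2)] c True t by (intro powr_mono2) auto
    also note powK
    also have "k powr ?\<alpha> * (K * l2_norm g powr \<tau>) = K * (k powr ?\<alpha> * l2_norm g powr \<tau>)" by simp
    also have "\<dots> \<le> 2 * K * R * (k powr ?\<alpha> * l2_norm g powr \<tau>)"
    proof (intro mult_right_mono)
      have "K * 1 \<le> K * (2 * R)" using K R by (intro mult_left_mono) auto
      then show "K \<le> 2 * K * R" by simp
    qed auto
    finally show ?thesis using c by (auto simp: mult_left_mono)
  next
    case False
    obtain c where c: "c \<in> carrier_vec N" "\<Phi> *\<^sub>v c = g" "l2_norm c \<le> K * l2_norm g"
      using onto[OF sparse_combs_carrier[OF g]] by blast
    have "real N \<le> 2 * R * k"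
    proof -
      have "real m \<le> 2 * k" using False by linarith
      then have "R * m \<le> R * (2 * k)" using R by (intro mult_left_mono) auto
      then show ?thesis by (simp add: N mult_ac)
    qed
    then have l0: "real (l0_norm c) \<le> 2 * R * k" using l0_norm_le_dim[of c] c(1) by (simp add: order_trans[OF of_nat_mono])
    have "power_sum \<tau> c \<le> (2 * R * k) powr ?\<alpha> * l2_norm c powr \<tau>"
      using t by (intro power_sum_le_l0 l0) auto
    also have "\<dots> \<le> (2 * R * k powr ?\<alpha>) * (K * l2_norm g powr \<tau>)"
    proof (intro mult_mono)
      have "(2 * R) powr ?\<alpha> \<le> 2 * R" using R t by (intro powr_le_self_of_ge_1) auto
      then show "(2 * R * k) powr ?\<alpha> \<le> 2 * R * k powr ?\<alpha>"
        using R by (simp add: powr_mult[of "2 * R"] mult_right_mono)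
      have "l2_norm c powr \<tau> \<le> (K * l2_norm g) powr \<tau>" using c t by (intro powr_mono2) auto
      then show "l2_norm c powr \<tau> \<le> K * l2_norm g powr \<tau>" using powK by simp
    qed (use R in auto)
    finally show ?thesis using c by (auto simp: mult_ac)
  qed
qed

text \<open>Write f = y_0 + sum of (y_(i+1) - y_i) with near-best approximants y_i from 2^i terms.
  Each difference combines at most 3 * 2^i columns and is at most about 2 \<sigma>_(2^i) in norm, so
  Bernstein supplies coefficients for it; these are added up.\<close>

lemma telescoping:
  assumes f: "f \<in> carrier_vec m" and t: "0 < \<tau>" "\<tau> \<le> 1"
  shows "\<exists>L. \<exists>c\<in>carrier_vec N. \<Phi> *\<^sub>v c = f \<and> power_sum \<tau> c \<le> 22 * K * R *
    (l2_norm f powr \<tau> + (\<Sum>i<L. 2 powr (i * (1 - \<tau> / 2)) * best_approx_error \<Phi> (2 ^ i) f powr \<tau>))"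
\<comment> \<open>The slack chosen below is proportional to the norm of \<open>f\<close> and has to
  be positive, so \<open>f = 0\<close> is treated apart.\<close>
proof (cases "f = 0\<^sub>v m")
  case True
  have "\<Phi> *\<^sub>v 0\<^sub>v N = f" unfolding True by (intro eq_vecI) (auto simp: scalar_prod_def)
  moreover have "power_sum \<tau> (0\<^sub>v N) = 0" using t by (simp add: power_sum_def)
  moreover have "0 \<le> 22 * K * R *
    (l2_norm f powr \<tau> + (\<Sum>i<0. 2 powr (i * (1 - \<tau> / 2)) * best_approx_error \<Phi> (2 ^ i) f powr \<tau>))"
    using K R by (intro mult_nonneg_nonneg) auto
  ultimately show ?thesis by (intro exI[of _ 0] bexI[of _ "0\<^sub>v N"]) auto
next
  case False
  define \<sigma> where "\<sigma> i = best_approx_error \<Phi> (2 ^ i) f" for i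
  define F where "F = l2_norm f"
  have F: "0 < F" using l2_norm_eq_0[OF f] False l2_norm_nonneg[of f] unfolding F_def by linarith
  let ?\<alpha> = "1 - \<tau> / 2"
  \<comment> \<open>\<open>Z\<close> collects the dyadic weights, so that the slack \<eta> = F
    Z^(-1/\<tau>) contributes at most F^\<tau> in total; the summand 1 gives Z \<ge> 1 and thereby
    \<eta> \<le> F.\<close>
  define Z where "Z = 1 + (\<Sum>i<N. 2 powr (i * ?\<alpha>))"
  have Z: "1 \<le> Z" unfolding Z_def by (simp add: sum_nonneg)
  define \<eta> where "\<eta> = F * Z powr (- 1 / \<tau>)"
  have eta: "0 < \<eta>" using F Z by (simp add: \<eta>_def)
  have "Z powr (- 1 / \<tau>) \<le> Z powr 0" using Z t by (intro powr_mono) auto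
  then have etaF: "\<eta> \<le> F" using F Z by (simp add: \<eta>_def)
  have etaZ: "\<eta> powr \<tau> * (\<Sum>i<N. 2 powr (i * ?\<alpha>)) \<le> F powr \<tau>"
  proof -
    have "\<eta> powr \<tau> = F powr \<tau> * Z powr (- 1)"
      unfolding \<eta>_def powr_mult powr_powr using t by simp
    then have "\<eta> powr \<tau> * Z = F powr \<tau>" using Z by (simp add: powr_minus)
    moreover have "\<eta> powr \<tau> * (\<Sum>i<N. 2 powr (i * ?\<alpha>)) \<le> \<eta> powr \<tau> * Z"
      by (intro mult_left_mono) (auto simp: Z_def)
    ultimately show ?thesis by simp
  qed
  have fN: "f \<in> sparse_combs \<Phi> (2 ^ N)"
  proof -
    obtain c where c: "c \<in> carrier_vec N" "\<Phi> *\<^sub>v c = f" using onto[OF f] by blast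
    have "l0_norm c \<le> N" using l0_norm_le_dim[of c] c by simp
    also have "N \<le> 2 ^ N" by (rule less_imp_le[OF less_exp])
    finally show ?thesis using c by (auto simp: sparse_combs_def)
  qed
  \<comment> \<open>Since N \<le> 2^N, the approximant at level \<open>N\<close> can be
    \<open>f\<close> itself, and the chain ends exactly there.\<close>
  have "\<exists>y\<in>sparse_combs \<Phi> (2 ^ i). l2_norm (f - y) \<le> \<sigma> i + \<eta> \<and> (i = N \<longrightarrow> y = f)" for i
  proof (cases "i = N")
    case True
    have "l2_norm (f - f) = 0" using f by (subst l2_norm_eq_0) auto
    then show ?thesis using True fN eta by (intro bexI[of _ f]) (auto simp: \<sigma>_def)
  next
    case False
    then show ?thesis using best_approx_error_attained[OF eta, of \<Phi> "2 ^ i" f] by (auto simp: \<sigma>_def intro: less_imp_le)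
  qed
  then obtain y where y: "\<And>i. y i \<in> sparse_combs \<Phi> (2 ^ i)" "\<And>i. l2_norm (f - y i) \<le> \<sigma> i + \<eta>" "y N = f"
    by metis
  have yc: "y i \<in> carrier_vec m" for i using sparse_combs_carrier[OF y(1)] .
  have claim: "\<exists>c\<in>carrier_vec N. \<Phi> *\<^sub>v c = y n \<and> power_sum \<tau> c \<le> 2 * K * R *
     ((3 * F) powr \<tau> + (\<Sum>i<n. 4 * 2 powr (i * ?\<alpha>) * (2 * \<sigma> i + 2 * \<eta>) powr \<tau>))" for n
  proof (induction n)
    case 0
    obtain c where c: "c \<in> carrier_vec N" "\<Phi> *\<^sub>v c = y 0" "power_sum \<tau> c \<le> 2 * K * R * (1 powr ?\<alpha> * l2_norm (y 0) powr \<tau>)"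
      using Bernstein[OF y(1)[of 0] _ t] by auto
    have "l2_norm (y 0) \<le> l2_norm (y 0 - f) + l2_norm f"
      
    proof -
      have "y 0 = (y 0 - f) + f" using yc[of 0] f by (intro eq_vecI) auto
      then show ?thesis using l2_norm_triangle[of "y 0 - f" m f] yc[of 0] f by simp
    qed
    also have "\<dots> \<le> (\<sigma> 0 + \<eta>) + F" using y(2)[of 0] l2_norm_minus_commute[OF yc[of 0] f] by (simp add: F_def)
    also have "\<dots> \<le> 3 * F" using best_approx_error_le_l2_norm[OF f, of 1] etaF by (simp add: \<sigma>_def F_def)
    finally have "l2_norm (y 0) powr \<tau> \<le> (3 * F) powr \<tau>" using t by (intro powr_mono2) auto
    then have "2 * K * R * (1 powr ?\<alpha> * l2_norm (y 0) powr \<tau>) \<le> 2 * K * R * ((3 * F) powr \<tau>)"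
      using K R by (intro mult_left_mono) auto
    then show ?case using c by force
  next
    case (Suc n)
    then obtain c where c: "c \<in> carrier_vec N" "\<Phi> *\<^sub>v c = y n" "power_sum \<tau> c \<le> 2 * K * R *
     ((3 * F) powr \<tau> + (\<Sum>i<n. 4 * 2 powr (i * ?\<alpha>) * (2 * \<sigma> i + 2 * \<eta>) powr \<tau>))" by blast
    have "y (Suc n) - y n \<in> sparse_combs \<Phi> (4 * 2 ^ n)"
      using sparse_combs_minus[OF y(1)[of "Suc n"] y(1)[of n]] sparse_combs_mono[of "2 ^ Suc n + 2 ^ n" "4 * 2 ^ n" \<Phi>] by auto
    from Bernstein[OF this _ t] obtain d where d: "d \<in> carrier_vec N" "\<Phi> *\<^sub>v d = y (Suc n) - y n"
        "power_sum \<tau> d \<le> 2 * K * R * ((4 * 2 ^ n) powr ?\<alpha> * l2_norm (y (Suc n) - y n) powr \<tau>)"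
      by auto
    have "l2_norm (y (Suc n) - y n) \<le> l2_norm (y (Suc n) - f) + l2_norm (f - y n)"
      by (rule l2_norm_triangle_sub) (use yc f in auto)
    also have "\<dots> \<le> (\<sigma> (Suc n) + \<eta>) + (\<sigma> n + \<eta>)"
      using y(2)[of n] y(2)[of "Suc n"] l2_norm_minus_commute[OF yc f] by (simp add: add_mono)
    also have "\<dots> \<le> 2 * \<sigma> n + 2 * \<eta>"
      using best_approx_error_antimono[of "2 ^ n" "2 ^ Suc n" \<Phi> f] by (simp add: \<sigma>_def)
    finally have l2: "l2_norm (y (Suc n) - y n) powr \<tau> \<le> (2 * \<sigma> n + 2 * \<eta>) powr \<tau>"
      using t by (intro powr_mono2) auto
    have "(4 * 2 ^ n) powr ?\<alpha> = 4 powr ?\<alpha> * 2 powr (n * ?\<alpha>)"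
      by (simp add: powr_mult powr_powr powr_realpow[symmetric])
    also have "\<dots> \<le> 4 * 2 powr (n * ?\<alpha>)" using t by (intro mult_right_mono powr_le_self_of_ge_1) auto
    finally have "(4 * 2 ^ n) powr ?\<alpha> * l2_norm (y (Suc n) - y n) powr \<tau> \<le> 4 * 2 powr (n * ?\<alpha>) * (2 * \<sigma> n + 2 * \<eta>) powr \<tau>"
      using l2 by (intro mult_mono) auto
    then have "power_sum \<tau> d \<le> 2 * K * R * (4 * 2 powr (n * ?\<alpha>) * (2 * \<sigma> n + 2 * \<eta>) powr \<tau>)"
      using d(3) K R by (smt (verit) mult_left_mono mult_nonneg_nonneg)
    moreover have "power_sum \<tau> (c + d) \<le> power_sum \<tau> c + power_sum \<tau> d"
      using c d t by (intro power_sum_add_le) auto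
    moreover have "\<Phi> *\<^sub>v (c + d) = y (Suc n)"
      using mult_add[OF c(1) d(1)] c d yc[of n] yc[of "Suc n"] by (auto intro!: eq_vecI)
    ultimately show ?case using c d by (intro bexI[of _ "c + d"]) (auto simp: distrib_left)
  qed
  obtain c where c: "c \<in> carrier_vec N" "\<Phi> *\<^sub>v c = f" "power_sum \<tau> c \<le> 2 * K * R *
     ((3 * F) powr \<tau> + (\<Sum>i<N. 4 * 2 powr (i * ?\<alpha>) * (2 * \<sigma> i + 2 * \<eta>) powr \<tau>))" using claim[of N] y(3) by auto
  let ?S = "\<Sum>i<N. 2 powr (i * ?\<alpha>) * \<sigma> i powr \<tau>"
  have c2: "(x + x) powr \<tau> \<le> 2 * x powr \<tau>" if "0 \<le> x" for x :: real
    using powr_add_le[of \<tau> x x] t that by simp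
  have "(\<Sum>i<N. 4 * 2 powr (i * ?\<alpha>) * (2 * \<sigma> i + 2 * \<eta>) powr \<tau>)
      \<le> (\<Sum>i<N. 4 * 2 powr (i * ?\<alpha>) * (2 * \<sigma> i powr \<tau> + 2 * \<eta> powr \<tau>))"
  proof (intro sum_mono mult_left_mono)
    fix i
    have s: "0 \<le> \<sigma> i" by (simp add: \<sigma>_def)
    have "(2 * \<sigma> i + 2 * \<eta>) powr \<tau> \<le> (2 * \<sigma> i) powr \<tau> + (2 * \<eta>) powr \<tau>"
      using s eta t by (intro powr_add_le) auto
    then show "(2 * \<sigma> i + 2 * \<eta>) powr \<tau> \<le> 2 * \<sigma> i powr \<tau> + 2 * \<eta> powr \<tau>"
      using c2[OF s] c2[of \<eta>] eta by simp
  qed auto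
  also have "\<dots> = 8 * ?S + 8 * (\<eta> powr \<tau> * (\<Sum>i<N. 2 powr (i * ?\<alpha>)))"
    by (simp add: sum_distrib_left sum.distrib[symmetric] algebra_simps)
  also have "\<dots> \<le> 8 * ?S + 8 * F powr \<tau>" using etaZ by simp
  finally have "(\<Sum>i<N. 4 * 2 powr (i * ?\<alpha>) * (2 * \<sigma> i + 2 * \<eta>) powr \<tau>) \<le> 8 * ?S + 8 * F powr \<tau>" .
  moreover have "(3 * F) powr \<tau> \<le> 3 * F powr \<tau>"
    using powr_le_self_of_ge_1[of 3 \<tau>] t F by (simp add: powr_mult)
  moreover have "0 \<le> ?S" by (intro sum_nonneg) auto
  \<comment> \<open>Here 11 = 3 + 8: the 3 comes from the first approximant, the 8 from the slack.
    The factor 2 of Bernstein turns it into 22.\<close>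
  ultimately have "(3 * F) powr \<tau> + (\<Sum>i<N. 4 * 2 powr (i * ?\<alpha>) * (2 * \<sigma> i + 2 * \<eta>) powr \<tau>) \<le> 11 * (F powr \<tau> + ?S)"
    by (simp add: distrib_left)
  then have *: "2 * K * R * ((3 * F) powr \<tau> + (\<Sum>i<N. 4 * 2 powr (i * ?\<alpha>) * (2 * \<sigma> i + 2 * \<eta>) powr \<tau>))
     \<le> 2 * K * R * (11 * (F powr \<tau> + ?S))"
    using K R by (intro mult_left_mono) auto
  have eq: "2 * K * R * (11 * x) = 22 * K * R * x" for x by simp
  have "power_sum \<tau> c \<le> 22 * K * R * (F powr \<tau> + ?S)"
    using order_trans[OF c(3) *] unfolding eq .
  then show ?thesis using c(1,2) unfolding F_def \<sigma>_def by blast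
qed

end

section \<open>Best k-term truncation of coefficient vectors\<close>

lemma decreasing_enumeration:
  fixes x :: "nat \<Rightarrow> real"
  obtains \<pi> where "bij_betw \<pi> {..<N} {..<N}" "\<And>i j. i \<le> j \<Longrightarrow> j < N \<Longrightarrow> \<bar>x (\<pi> j)\<bar> \<le> \<bar>x (\<pi> i)\<bar>"
proof
  define xs where "xs = sort_key (\<lambda>j. - \<bar>x j\<bar>) [0..<N]"
  have xs: "length xs = N" "distinct xs" "set xs = {..<N}" by (auto simp: xs_def)
  show "bij_betw (nth xs) {..<N} {..<N}" using bij_betw_nth[OF xs(2)] xs by simp
  fix i j assume ij: "i \<le> j" "j < N"
  have "sorted (map (\<lambda>j. - \<bar>x j\<bar>) xs)" unfolding xs_def by (rule sorted_sort_key)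
  from sorted_nth_mono[OF this ij(1)] ij xs show "\<bar>x (xs ! j)\<bar> \<le> \<bar>x (xs ! i)\<bar>" by simp
qed

text \<open>\<open>h k\<close> keeps the \<open>k\<close> entries of largest absolute value and
  \<open>a\<close> lists all absolute values in decreasing order, so head and tail of
  \<open>a\<close> measure \<open>h k\<close> and \<open>c - h k\<close>.\<close>

lemma decreasing_rearrangement:
  assumes c: "c \<in> carrier_vec N"
  obtains a h where "rearrangement a N" "\<And>k. h k \<in> carrier_vec N" "\<And>k. l0_norm (h k) \<le> k"
    "\<And>q k. 0 < q \<Longrightarrow> power_sum q (h k) = (\<Sum>j<k. a j powr q)"
    "\<And>q. power_sum q c = (\<Sum>j<N. a j powr q)"
    "\<And>k. l2_norm (c - h k) = sqrt (\<Sum>j\<in>{k..<N}. (a j)\<^sup>2)"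
proof -
  obtain \<pi> where bij: "bij_betw \<pi> {..<N} {..<N}"
    and dec: "\<And>i j. i \<le> j \<Longrightarrow> j < N \<Longrightarrow> \<bar>c $ \<pi> j\<bar> \<le> \<bar>c $ \<pi> i\<bar>"
    using decreasing_enumeration[of N "\<lambda>j. c $ j"] by blast
  define a where "a j = (if j < N then \<bar>c $ \<pi> j\<bar> else 0)" for j
  define h where "h k = vec N (\<lambda>j. if j \<in> \<pi> ` {i. i < k \<and> i < N} then c $ j else 0)" for k
  have pi: "\<pi> i < N" if "i < N" for i using bij that by (auto simp: bij_betw_def)
  have mem: "\<pi> i \<in> \<pi> ` {i. i < k \<and> i < N} \<longleftrightarrow> i < k" if "i < N" for i k
    using bij that by (auto simp: bij_betw_def inj_on_def)
  have reindex: "(\<Sum>j<N. g j) = (\<Sum>i<N. g (\<pi> i))" for g :: "nat \<Rightarrow> real"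
    using sum.reindex_bij_betw[OF bij, of g] by simp
  show thesis
  proof
    show "rearrangement a N" by unfold_locales (use dec in \<open>auto simp: a_def\<close>)
    show h: "h k \<in> carrier_vec N" for k by (simp add: h_def)
    show "l0_norm (h k) \<le> k" for k
    proof -
      have "{j. j < dim_vec (h k) \<and> h k $ j \<noteq> 0} \<subseteq> \<pi> ` {..<k}" by (auto simp: h_def split: if_splits)
      then have "l0_norm (h k) \<le> card (\<pi> ` {..<k})" unfolding l0_norm_def by (intro card_mono) auto
      also have "\<dots> \<le> k" using card_image_le[of "{..<k}" \<pi>] by simp
      finally show ?thesis .
    qed
    show "power_sum q (h k) = (\<Sum>j<k. a j powr q)" if q: "0 < q" for q k
    proof -
      have "power_sum q (h k) = (\<Sum>i<N. \<bar>h k $ \<pi> i\<bar> powr q)"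
        using reindex[of "\<lambda>j. \<bar>h k $ j\<bar> powr q"] by (simp add: power_sum_def h_def)
      also have "\<dots> = (\<Sum>i<N. if i < k then a i powr q else 0)"
        using q by (intro sum.cong refl) (simp add: h_def pi mem a_def)
      also have "\<dots> = (\<Sum>i\<in>{..<N} \<inter> {..<k}. a i powr q)"
        by (simp add: sum.If_cases) (rule sum.cong, auto)
      also have "\<dots> = (\<Sum>j<k. a j powr q)"
        by (rule sum.mono_neutral_left) (auto simp: a_def)
      finally show ?thesis .
    qed
    show "power_sum q c = (\<Sum>j<N. a j powr q)" for q
      using reindex[of "\<lambda>j. \<bar>c $ j\<bar> powr q"] c by (simp add: power_sum_def a_def)
    show "l2_norm (c - h k) = sqrt (\<Sum>j\<in>{k..<N}. (a j)\<^sup>2)" for k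
    proof -
      have "(\<Sum>j<N. ((c - h k) $ j)\<^sup>2) = (\<Sum>i<N. if k \<le> i then (a i)\<^sup>2 else 0)"
        unfolding reindex[of "\<lambda>j. ((c - h k) $ j)\<^sup>2"]
        using c by (intro sum.cong refl) (simp add: h_def pi mem a_def)
      also have "\<dots> = (\<Sum>j\<in>{k..<N}. (a j)\<^sup>2)"
        by (simp add: sum.If_cases) (rule sum.cong, auto)
      finally show ?thesis using c h by (simp add: l2_norm_def L2_set_def h_def)
    qed
  qed
qed

lemma lp_norm_zero [simp]: "0 < \<tau> \<Longrightarrow> lp_norm \<tau> (0\<^sub>v n) = 0"
  by (simp add: lp_norm_def)

lemma lp_norm_nonneg [simp]: "0 \<le> lp_norm \<tau> c"
  by (simp add: lp_norm_def)

lemma l2_norm_le_lp_norm: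
  assumes "0 < p" "p \<le> 2" shows "l2_norm c \<le> lp_norm p c"
proof -
  have *: "(x\<^sup>2) powr (p / 2) = \<bar>x\<bar> powr p" for x :: real
    using powr_powr[of "\<bar>x\<bar>" 2 "p / 2"] by simp
  have "((l2_norm c)\<^sup>2) powr (p / 2) = (\<Sum>i<dim_vec c. (c $ i)\<^sup>2) powr (p / 2)"
    by (simp add: l2_norm_def L2_set_def sum_nonneg)
  also have "\<dots> \<le> (\<Sum>i<dim_vec c. ((c $ i)\<^sup>2) powr (p / 2))"
    using assms by (intro powr_sum_le) auto
  also have "\<dots> = power_sum p c" by (simp add: power_sum_def *)
  finally have "l2_norm c powr p \<le> power_sum p c" by (simp add: *)
  then have "(l2_norm c powr p) powr (1 / p) \<le> power_sum p c powr (1 / p)"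
    using assms by (intro powr_mono2) auto
  then show ?thesis using assms by (simp add: powr_powr lp_norm_power_sum)
qed

lemma sparsity_norm_le:
  "c \<in> carrier_vec (dim_col \<Phi>) \<Longrightarrow> \<Phi> *\<^sub>v c = f \<Longrightarrow> sparsity_norm \<Phi> \<tau> f \<le> ennreal (lp_norm \<tau> c)"
  unfolding sparsity_norm_def by (rule INF_lower) simp

lemma sparsity_norm_greatest:
  assumes u: "0 \<le> u" and C: "0 < C"
    and le: "\<And>c. c \<in> carrier_vec (dim_col \<Phi>) \<Longrightarrow> \<Phi> *\<^sub>v c = f \<Longrightarrow> u \<le> C * lp_norm \<tau> c"
  shows "ennreal u \<le> ennreal C * sparsity_norm \<Phi> \<tau> f"
proof -
  have "ennreal (u / C) \<le> sparsity_norm \<Phi> \<tau> f"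
    unfolding sparsity_norm_def using le C by (intro INF_greatest ennreal_leI) (auto simp: field_simps)
  then have "ennreal C * ennreal (u / C) \<le> ennreal C * sparsity_norm \<Phi> \<tau> f"
    by (rule mult_left_mono) simp
  then show ?thesis using C u by (simp add: ennreal_mult'[symmetric])
qed

context dictionary
begin

lemma mult_carrier: "\<Phi> *\<^sub>v c \<in> carrier_vec m"
  by (rule carrier_vecI) simp

lemma l2_norm_le_lp_norm_preimage:
  assumes "0 < p" "p \<le> 2" "c \<in> carrier_vec N" "\<Phi> *\<^sub>v c = f"
  shows "l2_norm f \<le> K * lp_norm p c"
proof -
  have "l2_norm f \<le> K * l2_norm c" using bounded assms by auto
  also have "\<dots> \<le> K * lp_norm p c" using l2_norm_le_lp_norm assms K by (intro mult_left_mono) auto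
  finally show ?thesis .
qed

lemma best_approx_error_le_tail:
  assumes c: "c \<in> carrier_vec N" and h: "h \<in> carrier_vec N" "l0_norm h \<le> k"
  shows "best_approx_error \<Phi> k (\<Phi> *\<^sub>v c) \<le> K * l2_norm (c - h)"
proof -
  have "best_approx_error \<Phi> k (\<Phi> *\<^sub>v c) \<le> l2_norm (\<Phi> *\<^sub>v c - \<Phi> *\<^sub>v h)"
    using h by (intro best_approx_error_le) (auto simp: sparse_combs_def)
  also have "\<dots> \<le> K * l2_norm (c - h)" using bounded[of "c - h"] c h by (simp add: mult_diff)
  finally show ?thesis .
qed

text \<open>Stechkin's estimate. The \<open>k\<close> entries before \<open>a k\<close> are at least
  as large, so a_k^p \<le> P/k with P the sum of p-th powers, and the tail of squares is at most
  a_k^(2-p) P. The factor \<open>K\<close> carries the bound from coefficients to the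
  dictionary.\<close>

lemma Jackson:
  assumes d: "d \<in> carrier_vec N" and k: "1 \<le> k" and p: "0 < p" "p \<le> 1"
  shows "best_approx_error \<Phi> k (\<Phi> *\<^sub>v d) \<le> K * (k powr - (1 / p - 1 / 2) * lp_norm p d)"
proof -
  obtain a h where ah: "rearrangement a N" "\<And>k. h k \<in> carrier_vec N" "\<And>k. l0_norm (h k) \<le> k"
    "\<And>q k. 0 < q \<Longrightarrow> power_sum q (h k) = (\<Sum>j<k. a j powr q)"
    "\<And>q. power_sum q d = (\<Sum>j<N. a j powr q)"
    "\<And>k. l2_norm (d - h k) = sqrt (\<Sum>j\<in>{k..<N}. (a j)\<^sup>2)"
    using decreasing_rearrangement[OF d] by metis
  interpret rearrangement a N by (rule ah(1))
  let ?P = "power_sum p d"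
  have "of_nat (card {..<k}) * a k powr p \<le> (\<Sum>j<k. a j powr p)"
    using p by (intro sum_bounded_below powr_antimono) auto
  also have "\<dots> \<le> ?P" unfolding ah(5) by (rule sum_lessThan_le[OF p(1)])
  finally have "a k powr p \<le> ?P / k" using k by (simp add: field_simps)
  then have "(a k powr p) powr ((2 - p) / p) \<le> (?P / k) powr ((2 - p) / p)"
    using p by (intro powr_mono2) auto
  then have ak: "a k powr (2 - p) \<le> (?P / k) powr ((2 - p) / p)" using p by (simp add: powr_powr)
  have "(\<Sum>j\<in>{k..<N}. (a j)\<^sup>2) \<le> (\<Sum>j\<in>{k..<N}. a k powr (2 - p) * a j powr p)"
  proof (rule sum_mono)
    fix j assume j: "j \<in> {k..<N}"
    have "(a j)\<^sup>2 = a j powr (2 - p) * a j powr p"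
      using nonneg[of j] by (simp add: powr_add[symmetric])
    also have "\<dots> \<le> a k powr (2 - p) * a j powr p"
      using j p by (intro mult_right_mono powr_antimono) auto
    finally show "(a j)\<^sup>2 \<le> a k powr (2 - p) * a j powr p" .
  qed
  also have "\<dots> = a k powr (2 - p) * (\<Sum>j\<in>{k..<N}. a j powr p)" by (simp add: sum_distrib_left)
  also have "\<dots> \<le> (?P / k) powr ((2 - p) / p) * ?P"
    unfolding ah(5) by (intro mult_mono ak[unfolded ah(5)] sum_mono2 sum_nonneg) auto
  also have "\<dots> = (k powr - (1 / p - 1 / 2) * lp_norm p d)\<^sup>2"
  proof (cases "?P = 0")
    case False
    then have P: "0 < ?P" using power_sum_nonneg[of p d] by linarith
    have e: "(2 - p) / p = 2 / p - 1" using p by (simp add: field_simps)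
    have "(?P / k) powr ((2 - p) / p) * ?P = k powr (- (2 / p - 1)) * ?P powr (2 / p)"
      using P k by (simp add: e powr_divide powr_diff powr_minus field_simps)
    also have "\<dots> = (k powr - (1 / p - 1 / 2) * lp_norm p d) powr 2"
      unfolding lp_norm_power_sum powr_mult powr_powr by (simp add: algebra_simps)
    finally show ?thesis by simp
  qed (use p in \<open>simp add: lp_norm_power_sum\<close>)
  finally have "sqrt (\<Sum>j\<in>{k..<N}. (a j)\<^sup>2) \<le> k powr - (1 / p - 1 / 2) * lp_norm p d"
    by (intro real_le_lsqrt) auto
  then have "K * l2_norm (d - h k) \<le> K * (k powr - (1 / p - 1 / 2) * lp_norm p d)"
    using K by (simp add: ah(6))
  then show ?thesis using best_approx_error_le_tail[OF d ah(2,3), of k] by linarith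
qed

section \<open>Bounds for the K-functional\<close>

lemma K_functional_le_split:
  assumes c: "c \<in> carrier_vec N" and h: "h \<in> carrier_vec N" and t: "0 \<le> t"
  shows "K_functional \<Phi> p (\<Phi> *\<^sub>v c) t \<le> ennreal (K * l2_norm (c - h) + t * lp_norm p h)"
proof -
  have sn: "sparsity_norm \<Phi> p (\<Phi> *\<^sub>v h) \<le> ennreal (lp_norm p h)" using h by (rule sparsity_norm_le) simp
  then have "\<Phi> *\<^sub>v h \<in> sparsity_space \<Phi> p"
    by (auto simp: sparsity_space_def intro!: carrier_vecI le_less_trans[OF sn])
  then have "K_functional \<Phi> p (\<Phi> *\<^sub>v c) t
      \<le> ennreal (l2_norm (\<Phi> *\<^sub>v c - \<Phi> *\<^sub>v h)) + ennreal t * sparsity_norm \<Phi> p (\<Phi> *\<^sub>v h)"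
    unfolding K_functional_def by (rule INF_lower)
  also have "\<dots> \<le> ennreal (K * l2_norm (c - h)) + ennreal t * ennreal (lp_norm p h)"
    using bounded[of "c - h"] c h by (intro add_mono mult_left_mono sn ennreal_leI) (auto simp: mult_diff)
  also have "\<dots> = ennreal (K * l2_norm (c - h) + t * lp_norm p h)"
    using t K by (simp add: ennreal_mult'[symmetric] ennreal_plus[symmetric] del: ennreal_plus)
  finally show ?thesis .
qed

lemma K_functional_le_l2_norm:
  assumes f: "f \<in> carrier_vec m" and p: "0 < p"
  shows "K_functional \<Phi> p f t \<le> ennreal (l2_norm f)"
proof -
  have z: "\<Phi> *\<^sub>v 0\<^sub>v N = 0\<^sub>v m" by (intro eq_vecI) (auto simp: scalar_prod_def)
  have sn: "sparsity_norm \<Phi> p (0\<^sub>v m) = 0"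
    using sparsity_norm_le[of "0\<^sub>v N" \<Phi> "0\<^sub>v m" p] z p by simp
  then have "0\<^sub>v m \<in> sparsity_space \<Phi> p" by (simp add: sparsity_space_def)
  then have "K_functional \<Phi> p f t \<le> ennreal (l2_norm (f - 0\<^sub>v m)) + ennreal t * sparsity_norm \<Phi> p (0\<^sub>v m)"
    unfolding K_functional_def by (rule INF_lower)
  then show ?thesis using f sn by simp
qed

lemma K_functional_mono:
  "t \<le> t' \<Longrightarrow> K_functional \<Phi> p f t \<le> K_functional \<Phi> p f t'"
  unfolding K_functional_def
  by (intro INF_mono') (auto intro!: add_left_mono mult_right_mono ennreal_leI)

lemma le_K_functional:
  assumes f: "f \<in> carrier_vec m" and t: "0 < t" and u: "0 \<le> u"
    and le: "\<And>d. d \<in> carrier_vec N \<Longrightarrow> u \<le> l2_norm (f - \<Phi> *\<^sub>v d) + K * (t * lp_norm p d)"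
  shows "ennreal u \<le> ennreal K * K_functional \<Phi> p f t"
proof -
  have "ennreal (u / K) \<le> K_functional \<Phi> p f t"
    unfolding K_functional_def
  proof (rule INF_greatest)
    fix g assume "g \<in> sparsity_space \<Phi> p"
    then have g: "g \<in> carrier_vec m" by (simp add: sparsity_space_def)
    let ?e = "l2_norm (f - g)"
    \<comment> \<open>The difference u - e may be negative, so it is cut off at 0 before passing to
      extended nonnegative reals; K \<ge> 1 later absorbs the term e/K into e.\<close>
    have "ennreal (max 0 (u - ?e) / K) \<le> ennreal t * sparsity_norm \<Phi> p g"
    proof (rule sparsity_norm_greatest)
      fix d assume d: "d \<in> carrier_vec N" "\<Phi> *\<^sub>v d = g"
      have "max 0 (u - ?e) \<le> K * (t * lp_norm p d)" using le[OF d(1)] d(2) K t by auto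
      then show "max 0 (u - ?e) / K \<le> t * lp_norm p d" using K by (simp add: field_simps)
    qed (use K t in auto)
    moreover have "ennreal (u / K) \<le> ennreal (?e + max 0 (u - ?e) / K)"
    proof (rule ennreal_leI)
      have "u / K \<le> (?e + max 0 (u - ?e)) / K" using K by (intro divide_right_mono) auto
      also have "\<dots> \<le> ?e + max 0 (u - ?e) / K"
        using K mult_left_mono[of 1 K ?e] by (simp add: add_divide_distrib divide_le_eq)
      finally show "u / K \<le> ?e + max 0 (u - ?e) / K" .
    qed
    moreover have "ennreal (?e + max 0 (u - ?e) / K) = ennreal ?e + ennreal (max 0 (u - ?e) / K)"
      using K by (intro ennreal_plus) auto
    ultimately show "ennreal (u / K) \<le> ennreal ?e + ennreal t * sparsity_norm \<Phi> p g"
      by (metis add_left_mono order_trans)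
  qed
  then have "ennreal K * ennreal (u / K) \<le> ennreal K * K_functional \<Phi> p f t" by (rule mult_left_mono) simp
  then show ?thesis using K u by (simp add: ennreal_mult'[symmetric])
qed

text \<open>For g = \<Phi>d one has \<sigma>_k(f) \<le> |f - g| + \<sigma>_k(g), and Jackson bounds
  the last term. The argument of the K-functional is exactly the Jackson rate.\<close>

lemma best_approx_error_le_K_functional:
  assumes f: "f \<in> carrier_vec m" and k: "1 \<le> k" and p: "0 < p" "p \<le> 1"
  shows "ennreal (best_approx_error \<Phi> k f) \<le> ennreal K * K_functional \<Phi> p f (k powr - (1 / p - 1 / 2))"
proof (rule le_K_functional[OF f])
  fix d :: "real vec" assume d: "d \<in> carrier_vec N"
  have "best_approx_error \<Phi> k f - l2_norm (f - \<Phi> *\<^sub>v d) \<le> best_approx_error \<Phi> k (\<Phi> *\<^sub>v d)"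
  proof (rule best_approx_error_greatest)
    fix y assume y: "y \<in> sparse_combs \<Phi> k"
    have "l2_norm (f - y) \<le> l2_norm (f - \<Phi> *\<^sub>v d) + l2_norm (\<Phi> *\<^sub>v d - y)"
      by (rule l2_norm_triangle_sub[OF f mult_carrier sparse_combs_carrier[OF y]])
    then show "best_approx_error \<Phi> k f - l2_norm (f - \<Phi> *\<^sub>v d) \<le> l2_norm (\<Phi> *\<^sub>v d - y)"
      using best_approx_error_le[OF y, of f] by linarith
  qed
  then show "best_approx_error \<Phi> k f \<le> l2_norm (f - \<Phi> *\<^sub>v d) + K * (k powr - (1 / p - 1 / 2) * lp_norm p d)"
    using Jackson[OF d k p] by linarith
qed (use k in auto)

lemma l2_norm_le_K_functional:
  assumes f: "f \<in> carrier_vec m" and p: "0 < p" "p \<le> 1"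
  shows "ennreal (l2_norm f) \<le> ennreal K * K_functional \<Phi> p f 1"
proof (rule le_K_functional[OF f])
  fix d :: "real vec" assume d: "d \<in> carrier_vec N"
  have "l2_norm f \<le> l2_norm (f - \<Phi> *\<^sub>v d) + l2_norm (\<Phi> *\<^sub>v d)"
  proof -
    have "f = (f - \<Phi> *\<^sub>v d) + \<Phi> *\<^sub>v d" using f by (intro eq_vecI) auto
    then show ?thesis
      using l2_norm_triangle[OF minus_carrier_vec[OF f mult_carrier] mult_carrier, of d d] by simp
  qed
  then show "l2_norm f \<le> l2_norm (f - \<Phi> *\<^sub>v d) + K * (1 * lp_norm p d)"
    using l2_norm_le_lp_norm_preimage[of p d "\<Phi> *\<^sub>v d"] d p by simp
qed auto

end

section \<open>Equivalence of the norms\<close>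

lemma epowr_ennreal: "0 \<le> x \<Longrightarrow> epowr (ennreal x) a = ennreal (x powr a)"
  by (simp add: epowr_def)

lemma epowr_mono:
  assumes "0 < a" "x \<le> y" shows "epowr x a \<le> epowr y a"
proof (cases "y = \<top>")
  case False
  then have "x \<noteq> \<top>" using assms by (auto simp: top_unique)
  moreover have "enn2real x \<le> enn2real y" using assms False by (intro enn2real_mono) (auto simp: top.not_eq_extremum)
  ultimately show ?thesis using assms False by (auto simp: epowr_def intro!: ennreal_leI powr_mono2)
qed (simp add: epowr_def)

lemma epowr_cmult:
  assumes "0 < C" "0 < a" shows "epowr (ennreal C * x) a = ennreal (C powr a) * epowr x a"
proof (cases x)
  case (real r)
  then show ?thesis using assms by (simp add: ennreal_mult'[symmetric] epowr_ennreal powr_mult)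
next
  case top
  then show ?thesis using assms by (simp add: epowr_def ennreal_mult_top)
qed

text \<open>From x + y \<le> 2 max(x, y). It is applied with exponent 1/\<tau> \<ge> 1, where powers
  are no longer subadditive.\<close>

lemma epowr_add_le:
  assumes a: "0 < a" shows "epowr (x + y) a \<le> ennreal (2 powr a) * (epowr x a + epowr y a)"
proof -
  have two: "epowr (ennreal 2 * z) a = ennreal (2 powr a) * epowr z a" for z
    using a by (intro epowr_cmult) auto
  have "epowr (x + y) a \<le> epowr (ennreal 2 * max x y) a"
    using a by (intro epowr_mono) (auto simp: mult_2 add_mono)
  also have "\<dots> \<le> ennreal (2 powr a) * (epowr x a + epowr y a)"
    unfolding two by (intro mult_left_mono) (auto simp: max_def add_increasing add_increasing2)
  finally show ?thesis .
qed

lemma equal_with_equiv_normsI: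
  assumes "0 < C" "V = {f \<in> H. nV f < \<top>}" "W = {f \<in> H. nW f < \<top>}"
    and le: "\<And>f. f \<in> H \<Longrightarrow> nV f \<le> ennreal C * nW f" "\<And>f. f \<in> H \<Longrightarrow> nW f \<le> ennreal C * nV f"
  shows "equal_with_equiv_norms C V nV W nW"
proof -
  have "nV f < \<top> \<longleftrightarrow> nW f < \<top>" if "f \<in> H" for f
    using le[OF that] by (metis ennreal_mult_less_top ennreal_less_top le_less_trans)
  then show ?thesis using assms by (auto simp: equal_with_equiv_norms_def)
qed

text \<open>The shift by one accounts for the series term \<open>n\<close> belonging to \<open>k = Suc n\<close>.\<close>

lemma sum_dyadic_shift:
  fixes g :: "nat \<Rightarrow> real"
  shows "(\<Sum>n<2 ^ Suc L - 1. g n) = (\<Sum>n<2 ^ L - 1. g n) + (\<Sum>n\<in>{2 ^ L - 1..<2 ^ Suc L - 1}. g n)"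
  unfolding lessThan_atLeast0 by (rule sum.atLeastLessThan_concat[symmetric]) (auto intro: diff_le_mono)

lemma sum_dyadic:
  fixes g :: "nat \<Rightarrow> real"
  shows "(\<Sum>n<2 ^ Suc L. g n) = (\<Sum>n<2 ^ L. g n) + (\<Sum>n\<in>{2 ^ L..<2 ^ Suc L}. g n)"
  unfolding lessThan_atLeast0 by (rule sum.atLeastLessThan_concat[symmetric]) simp_all

section \<open>The approximation norm as a dyadic sum\<close>

context dictionary
begin

abbreviation (input) dyadic_error :: "real \<Rightarrow> real vec \<Rightarrow> nat \<Rightarrow> real" where
  "dyadic_error \<tau> f i \<equiv> 2 powr (i * (1 - \<tau> / 2)) * best_approx_error \<Phi> (2 ^ i) f powr \<tau>"

abbreviation (input) series_term :: "real \<Rightarrow> real vec \<Rightarrow> nat \<Rightarrow> real" where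
  "series_term \<tau> f n \<equiv> (real (Suc n) powr (1 / \<tau> - 1 / 2) * best_approx_error \<Phi> (Suc n) f) powr \<tau> / real (Suc n)"

lemma series_term_eq:
  assumes "0 < \<tau>"
  shows "series_term \<tau> f n = real (Suc n) powr - (\<tau> / 2) * best_approx_error \<Phi> (Suc n) f powr \<tau>"
proof -
  have "(1 / \<tau> - 1 / 2) * \<tau> = 1 + - (\<tau> / 2)" using assms by (simp add: field_simps)
  then have "series_term \<tau> f n = real (Suc n) powr (1 + - (\<tau> / 2)) * best_approx_error \<Phi> (Suc n) f powr \<tau> / real (Suc n)"
    by (simp only: powr_mult powr_powr)
  also have "real (Suc n) powr (1 + - (\<tau> / 2)) = real (Suc n) * real (Suc n) powr - (\<tau> / 2)"
    by (subst powr_add) simp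
  finally show ?thesis by simp
qed

text \<open>The 2^L series terms with 2^L \<le> n < 2^(L+1) satisfy Suc n \<le> 2^(L+1), so by
  monotonicity they add up to at least half of the dyadic term at level L + 1. The level 0 term is
  absorbed by the norm of \<open>f\<close>.\<close>

lemma sum_dyadic_error_le:
  assumes f: "f \<in> carrier_vec m" and t: "0 < \<tau>" "\<tau> \<le> 1"
  shows "(\<Sum>i<Suc L. dyadic_error \<tau> f i) \<le> l2_norm f powr \<tau> + 2 * (\<Sum>n<2 ^ L. series_term \<tau> f n)"
proof (induction L)
  case 0
  have "best_approx_error \<Phi> 1 f powr \<tau> \<le> l2_norm f powr \<tau>"
    using t best_approx_error_le_l2_norm[OF f] by (intro powr_mono2) auto
  then show ?case by (simp add: add_increasing2)
next
  case (Suc L)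
  let ?e = "2 powr (- (Suc L * \<tau> / 2)) * best_approx_error \<Phi> (2 ^ Suc L) f powr \<tau>"
  have "of_nat (card {2 ^ L..<2 ^ Suc L :: nat}) * ?e \<le> (\<Sum>n\<in>{2 ^ L..<2 ^ Suc L}. series_term \<tau> f n)"
  proof (rule sum_bounded_below)
    fix n :: nat assume n: "n \<in> {2 ^ L..<2 ^ Suc L}"
    have n2: "real (Suc n) \<le> 2 ^ Suc L" using n by (metis Suc_leI atLeastLessThan_iff of_nat_le_iff of_nat_numeral of_nat_power)
    have "2 powr (- (Suc L * \<tau> / 2)) = (2 powr real (Suc L)) powr - (\<tau> / 2)" by (simp add: powr_powr)
    also have "\<dots> = (2 ^ Suc L) powr - (\<tau> / 2)" by (subst powr_realpow) auto
    also have "\<dots> \<le> real (Suc n) powr - (\<tau> / 2)" using n2 t by (intro powr_mono2') auto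
    finally show "?e \<le> series_term \<tau> f n"
      unfolding series_term_eq[OF t(1)]
      using n t by (intro mult_mono powr_mono2 best_approx_error_antimono) auto
  qed
  moreover have "of_nat (card {2 ^ L..<2 ^ Suc L :: nat}) * ?e = dyadic_error \<tau> f (Suc L) / 2"
  proof -
    have "2 powr (Suc L * (1 - \<tau> / 2)) = 2 powr real (Suc L) * 2 powr (- (Suc L * \<tau> / 2))"
      by (simp add: powr_add[symmetric] algebra_simps)
    also have "2 powr real (Suc L) = 2 * 2 ^ L" by (subst powr_realpow) auto
    finally show ?thesis by simp
  qed
  ultimately have "dyadic_error \<tau> f (Suc L) \<le> 2 * (\<Sum>n\<in>{2 ^ L..<2 ^ Suc L}. series_term \<tau> f n)" by linarith
  then show ?case using Suc unfolding sum_dyadic[of "series_term \<tau> f"] sum.lessThan_Suc[of _ "Suc L"] by argo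
qed

text \<open>The 2^L terms with 2^L \<le> Suc n < 2^(L+1) are each at most the value at the left end
  of the block, and 2^L copies of that value form the dyadic term at level L.\<close>

lemma sum_series_term_le:
  assumes t: "0 < \<tau>" "\<tau> \<le> 1"
  shows "(\<Sum>n<2 ^ L - 1. series_term \<tau> f n) \<le> (\<Sum>i<L. dyadic_error \<tau> f i)"
proof (induction L)
  case (Suc L)
  let ?e = "2 powr (- (L * \<tau> / 2)) * best_approx_error \<Phi> (2 ^ L) f powr \<tau>"
  have "(\<Sum>n\<in>{2 ^ L - 1..<2 ^ Suc L - 1}. series_term \<tau> f n) \<le> of_nat (card {2 ^ L - 1..<2 ^ Suc L - 1 :: nat}) * ?e"
  proof (rule sum_bounded_above)
    fix n :: nat assume "n \<in> {2 ^ L - 1..<2 ^ Suc L - 1}"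
    then have n: "2 ^ L \<le> Suc n" by auto
    then have n2: "2 ^ L \<le> real (Suc n)" by (metis of_nat_le_iff of_nat_numeral of_nat_power)
    have "real (Suc n) powr - (\<tau> / 2) \<le> (2 ^ L) powr - (\<tau> / 2)" using n2 t by (intro powr_mono2') auto
    also have "\<dots> = (2 powr real L) powr - (\<tau> / 2)" by (subst powr_realpow) auto
    also have "\<dots> = 2 powr (- (L * \<tau> / 2))" by (simp add: powr_powr)
    finally show "series_term \<tau> f n \<le> ?e"
      unfolding series_term_eq[OF t(1)]
      using n t by (intro mult_mono powr_mono2 best_approx_error_antimono) auto
  qed
  also have "card {2 ^ L - 1..<2 ^ Suc L - 1 :: nat} = 2 ^ L" by simp
  also have "of_nat (2 ^ L) * ?e = dyadic_error \<tau> f L"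
  proof -
    have "2 powr (L * (1 - \<tau> / 2)) = 2 powr real L * 2 powr (- (L * \<tau> / 2))"
      by (simp add: powr_add[symmetric] algebra_simps)
    also have "2 powr real L = 2 ^ L" by (subst powr_realpow) auto
    finally show ?thesis by simp
  qed
  finally show ?case using Suc unfolding sum_dyadic_shift[of "series_term \<tau> f"] by simp
qed simp

lemma sparsity_norm_le_of_power_sum:
  assumes t: "0 < \<tau>" and B: "0 < B" and c: "c \<in> carrier_vec N" "\<Phi> *\<^sub>v c = f"
    and le: "ennreal (power_sum \<tau> c) \<le> ennreal B * X"
  shows "sparsity_norm \<Phi> \<tau> f \<le> ennreal (B powr (1 / \<tau>)) * epowr X (1 / \<tau>)"
proof -
  have "sparsity_norm \<Phi> \<tau> f \<le> epowr (ennreal (power_sum \<tau> c)) (1 / \<tau>)"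
    unfolding epowr_ennreal[OF power_sum_nonneg] lp_norm_power_sum[symmetric] by (rule sparsity_norm_le[OF c])
  also have "\<dots> \<le> epowr (ennreal B * X) (1 / \<tau>)" using t by (intro epowr_mono le) auto
  also have "epowr (ennreal B * X) (1 / \<tau>) = ennreal (B powr (1 / \<tau>)) * epowr X (1 / \<tau>)"
    by (rule epowr_cmult[OF B]) (use t in simp)
  finally show ?thesis .
qed

lemma sparsity_norm_le_approx_norm:
  assumes f: "f \<in> carrier_vec m" and t: "0 < \<tau>" "\<tau> \<le> 1"
  shows "sparsity_norm \<Phi> \<tau> f \<le> ennreal ((88 * K * R) powr (1 / \<tau>) * 2 powr (1 / \<tau>)) * approx_norm \<Phi> (1 / \<tau> - 1 / 2) \<tau> f"
proof -
  let ?S = "\<Sum>n. ennreal (series_term \<tau> f n)"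
  obtain L c where c: "c \<in> carrier_vec N" "\<Phi> *\<^sub>v c = f"
    "power_sum \<tau> c \<le> 22 * K * R * (l2_norm f powr \<tau> + (\<Sum>i<L. dyadic_error \<tau> f i))"
    using telescoping[OF f t] by blast
  define P where "P = (\<Sum>n<2 ^ L. series_term \<tau> f n)"
  have P: "0 \<le> P" unfolding P_def by (intro sum_nonneg) simp
  have PS: "ennreal P \<le> ?S"
  proof -
    have "ennreal P = (\<Sum>n<2 ^ L. ennreal (series_term \<tau> f n))"
      unfolding P_def by (rule sum_ennreal[symmetric]) simp
    also have "\<dots> \<le> ?S" by (rule sum_le_suminf) auto
    finally show ?thesis .
  qed
  define E where "E = (\<Sum>i<L. dyadic_error \<tau> f i)"
  have "E \<le> (\<Sum>i<Suc L. dyadic_error \<tau> f i)" unfolding E_def by simp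
  also have "\<dots> \<le> l2_norm f powr \<tau> + 2 * P" unfolding P_def by (rule sum_dyadic_error_le[OF f t])
  finally have EP: "l2_norm f powr \<tau> + E \<le> 2 * (l2_norm f powr \<tau> + P)" by simp
  have "power_sum \<tau> c \<le> 22 * K * R * (l2_norm f powr \<tau> + E)" using c(3) by (simp only: E_def)
  also have "\<dots> \<le> 22 * K * R * (2 * (l2_norm f powr \<tau> + P))"
    by (rule mult_left_mono[OF EP]) (use K R in auto)
  also have "\<dots> \<le> 88 * K * R * (l2_norm f powr \<tau> + P)"
  proof -
    have scale: "22 * K * R * (2 * x) \<le> 88 * K * R * x" if "0 \<le> x" for x
    proof -
      have "44 * (K * R * x) \<le> 88 * (K * R * x)"
        using K R that by (intro mult_right_mono mult_nonneg_nonneg) auto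
      then show ?thesis by simp
    qed
    show ?thesis by (rule scale) (use P in simp)
  qed
  finally have "ennreal (power_sum \<tau> c) \<le> ennreal (88 * K * R * (l2_norm f powr \<tau> + P))"
    by (rule ennreal_leI)
  also have "\<dots> = ennreal (88 * K * R) * ennreal (l2_norm f powr \<tau> + P)"
    by (rule ennreal_mult) (use K R P in auto)
  also have "ennreal (l2_norm f powr \<tau> + P) = ennreal (l2_norm f powr \<tau>) + ennreal P"
    by (rule ennreal_plus) (use P in auto)
  also have "ennreal (88 * K * R) * (ennreal (l2_norm f powr \<tau>) + ennreal P)
      \<le> ennreal (88 * K * R) * (ennreal (l2_norm f powr \<tau>) + ?S)"
    by (intro mult_left_mono add_left_mono PS) simp
  finally have "ennreal (power_sum \<tau> c) \<le> ennreal (88 * K * R) * (ennreal (l2_norm f powr \<tau>) + ?S)" .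
  then have "sparsity_norm \<Phi> \<tau> f \<le> ennreal ((88 * K * R) powr (1 / \<tau>)) * epowr (ennreal (l2_norm f powr \<tau>) + ?S) (1 / \<tau>)"
    using K R t by (intro sparsity_norm_le_of_power_sum[OF _ _ c(1,2)]) auto
  also have "\<dots> \<le> ennreal ((88 * K * R) powr (1 / \<tau>)) *
      (ennreal (2 powr (1 / \<tau>)) * (epowr (ennreal (l2_norm f powr \<tau>)) (1 / \<tau>) + epowr ?S (1 / \<tau>)))"
    using t by (intro mult_left_mono epowr_add_le) auto
  also have "epowr (ennreal (l2_norm f powr \<tau>)) (1 / \<tau>) = ennreal (l2_norm f)"
    using t by (subst epowr_ennreal) (simp_all add: powr_powr)
  also have "ennreal (l2_norm f) + epowr ?S (1 / \<tau>) = approx_norm \<Phi> (1 / \<tau> - 1 / 2) \<tau> f"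
    unfolding approx_norm_def approx_seminorm_def ..
  finally show ?thesis by (simp only: ennreal_mult' powr_ge_zero mult.assoc)
qed

text \<open>Truncating \<open>c\<close> to its 2^i largest entries gives a competitor whose error is
  at most \<open>K\<close> times the tail of the rearrangement; \<open>sum_tail_le\<close> sums
  these tails.\<close>

lemma sum_dyadic_error_le_power_sum:
  assumes c: "c \<in> carrier_vec N" "\<Phi> *\<^sub>v c = f" and t: "0 < \<tau>" "\<tau> \<le> 1"
  shows "(\<Sum>i<L. dyadic_error \<tau> f i) \<le> K * (5 / (1 - 2 powr - (1 - \<tau> / 2))) * power_sum \<tau> c"
proof -
  obtain a h where ah: "rearrangement a N" "\<And>k. h k \<in> carrier_vec N" "\<And>k. l0_norm (h k) \<le> k"
    "\<And>q. power_sum q c = (\<Sum>j<N. a j powr q)"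
    "\<And>k. l2_norm (c - h k) = sqrt (\<Sum>j\<in>{k..<N}. (a j)\<^sup>2)"
    using decreasing_rearrangement[OF c(1)] by metis
  interpret rearrangement a N by (rule ah(1))
  let ?T = "\<lambda>i. \<Sum>j\<in>{2 ^ i..<N}. (a j)\<^sup>2"
  have "dyadic_error \<tau> f i \<le> K * (2 powr (i * (1 - \<tau> / 2)) * ?T i powr (\<tau> / 2))" for i
  proof -
    have "best_approx_error \<Phi> (2 ^ i) f powr \<tau> \<le> (K * sqrt (?T i)) powr \<tau>"
      using best_approx_error_le_tail[OF c(1) ah(2,3), of "2 ^ i"] c(2) t by (intro powr_mono2) (auto simp: ah(5))
    also have "\<dots> = K powr \<tau> * ?T i powr (\<tau> / 2)"
      by (simp add: powr_mult powr_half_sqrt[symmetric] powr_powr sum_nonneg)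
    also have "\<dots> \<le> K * ?T i powr (\<tau> / 2)" using K t by (intro mult_right_mono powr_le_self_of_ge_1) auto
    finally show ?thesis by (simp add: mult.left_commute mult_left_mono)
  qed
  then have "(\<Sum>i<L. dyadic_error \<tau> f i) \<le> K * (\<Sum>i<L. 2 powr (i * (1 - \<tau> / 2)) * ?T i powr (\<tau> / 2))"
    unfolding sum_distrib_left[of K] by (intro sum_mono)
  also have "\<dots> \<le> K * (5 / (1 - 2 powr - (1 - \<tau> / 2)) * power_sum \<tau> c)"
    unfolding ah(4) using K by (intro mult_left_mono sum_tail_le t) auto
  finally show ?thesis by simp
qed

text \<open>Some preimage of \<open>f\<close> exists, so the hypothesis makes \<open>X\<close>
  finite and the comparison reduces to real numbers.\<close>

lemma le_sparsity_norm:
  assumes f: "f \<in> carrier_vec m" and C: "0 < C"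
    and le: "\<And>c. c \<in> carrier_vec N \<Longrightarrow> \<Phi> *\<^sub>v c = f \<Longrightarrow> X \<le> ennreal (C * lp_norm \<tau> c)"
  shows "X \<le> ennreal C * sparsity_norm \<Phi> \<tau> f"
proof -
  obtain c where c: "c \<in> carrier_vec N" "\<Phi> *\<^sub>v c = f" using onto[OF f] by blast
  obtain x where x: "X = ennreal x" "0 \<le> x"
    using le[OF c] by (metis ennreal_cases ennreal_less_top not_le top.not_eq_extremum)
  show ?thesis unfolding x(1)
  proof (rule sparsity_norm_greatest[OF x(2) C])
    fix c assume c: "c \<in> carrier_vec N" "\<Phi> *\<^sub>v c = f"
    from le[OF this] show "x \<le> C * lp_norm \<tau> c"
      unfolding x(1) using C by (subst (asm) ennreal_le_iff) (auto intro!: mult_nonneg_nonneg)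
  qed
qed

lemma approx_norm_le_sparsity_norm:
  assumes f: "f \<in> carrier_vec m" and t: "0 < \<tau>" "\<tau> \<le> 1"
  shows "approx_norm \<Phi> (1 / \<tau> - 1 / 2) \<tau> f
    \<le> ennreal (K + (K * (5 / (1 - 2 powr - (1 - \<tau> / 2)))) powr (1 / \<tau>)) * sparsity_norm \<Phi> \<tau> f"
proof -
  let ?S = "\<Sum>n. ennreal (series_term \<tau> f n)"
  let ?B = "K * (5 / (1 - 2 powr - (1 - \<tau> / 2)))"
  let ?C = "K + ?B powr (1 / \<tau>)"
  have "2 powr - (1 - \<tau> / 2) < 2 powr 0" using t by (intro powr_less_mono) auto
  then have B: "0 < ?B" using K by (intro mult_pos_pos) auto
  show ?thesis
  proof (rule le_sparsity_norm[OF f])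
    show "0 < ?C" using K by (intro add_pos_nonneg) auto
    fix c assume c: "c \<in> carrier_vec N" "\<Phi> *\<^sub>v c = f"
    have "(\<Sum>n<k. ennreal (series_term \<tau> f n)) \<le> ennreal (?B * power_sum \<tau> c)" for k
    proof -
      have "k \<le> 2 ^ k - 1" using less_exp[of k] by arith
      then have "(\<Sum>n<k. series_term \<tau> f n) \<le> (\<Sum>n<2 ^ k - 1. series_term \<tau> f n)"
        by (intro sum_mono2 lessThan_subset_iff[THEN iffD2]) auto
      also have "\<dots> \<le> (\<Sum>i<k. dyadic_error \<tau> f i)" by (rule sum_series_term_le[OF t])
      also have "\<dots> \<le> ?B * power_sum \<tau> c" by (rule sum_dyadic_error_le_power_sum[OF c t])
      finally have "ennreal (\<Sum>n<k. series_term \<tau> f n) \<le> ennreal (?B * power_sum \<tau> c)" by (rule ennreal_leI)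
      then show ?thesis by (subst sum_ennreal) auto
    qed
    then have "?S \<le> ennreal (?B * power_sum \<tau> c)"
      unfolding suminf_eq_SUP by (rule SUP_least)
    then have "epowr ?S (1 / \<tau>) \<le> epowr (ennreal (?B * power_sum \<tau> c)) (1 / \<tau>)" using t by (intro epowr_mono) auto
    also have "\<dots> = ennreal (?B powr (1 / \<tau>) * lp_norm \<tau> c)"
      unfolding lp_norm_power_sum powr_mult[symmetric]
      by (rule epowr_ennreal, rule mult_nonneg_nonneg[OF less_imp_le[OF B] power_sum_nonneg])
    finally have "approx_seminorm \<Phi> (1 / \<tau> - 1 / 2) \<tau> f \<le> ennreal (?B powr (1 / \<tau>) * lp_norm \<tau> c)"
      by (simp add: approx_seminorm_def)
    moreover have "ennreal (l2_norm f) \<le> ennreal (K * lp_norm \<tau> c)"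
      using l2_norm_le_lp_norm_preimage[OF t(1) _ c] t by (intro ennreal_leI) auto
    ultimately have "approx_norm \<Phi> (1 / \<tau> - 1 / 2) \<tau> f \<le> ennreal (K * lp_norm \<tau> c) + ennreal (?B powr (1 / \<tau>) * lp_norm \<tau> c)"
      unfolding approx_norm_def by (intro add_mono)
    also have "\<dots> = ennreal (?C * lp_norm \<tau> c)"
      using K by (subst ennreal_plus[symmetric]) (auto simp: distrib_right)
    finally show "approx_norm \<Phi> (1 / \<tau> - 1 / 2) \<tau> f \<le> ennreal (?C * lp_norm \<tau> c)" .
  qed
qed

end

section \<open>Discretising the interpolation integral\<close>

lemma epowr_weight:
  assumes "0 < t" "0 \<le> x"
  shows "epowr (ennreal (t powr - \<theta>) * ennreal x) \<tau> * ennreal (1 / t) = ennreal (t powr - (\<theta> * \<tau> + 1) * x powr \<tau>)"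
proof -
  have "- (\<theta> * \<tau> + 1) = - \<theta> * \<tau> + - 1" by simp
  then have "t powr - (\<theta> * \<tau> + 1) = t powr (- \<theta> * \<tau>) * t powr (- 1)" by (simp only: powr_add)
  also have "t powr (- 1) = 1 / t" using assms by (simp add: powr_minus_divide)
  finally have e: "t powr - (\<theta> * \<tau> + 1) = t powr (- \<theta> * \<tau>) * (1 / t)" .
  have "epowr (ennreal (t powr - \<theta>) * ennreal x) \<tau> = ennreal ((t powr - \<theta> * x) powr \<tau>)"
    unfolding ennreal_mult[OF powr_ge_zero assms(2), symmetric]
    by (rule epowr_ennreal) (use assms in simp)
  also have "(t powr - \<theta> * x) powr \<tau> = t powr (- \<theta> * \<tau>) * x powr \<tau>"
    by (simp only: powr_mult powr_powr)
  finally show ?thesis using assms unfolding e by (simp add: ennreal_mult'[symmetric] mult_ac)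
qed

lemma nn_integral_powr_atLeast_1:
  fixes e :: real
  assumes "1 < e"
  shows "(\<integral>\<^sup>+t. ennreal (t powr - e) * indicator {1..} t \<partial>lborel) = ennreal (1 / (e - 1))"
proof -
  have "((\<lambda>t. t powr (1 - e) / (1 - e)) \<longlongrightarrow> 0 / (1 - e)) at_top"
    using assms by (intro tendsto_divide tendsto_neg_powr filterlim_ident tendsto_const) auto
  moreover have "((\<lambda>t. t powr (1 - e) / (1 - e)) has_real_derivative t powr - e) (at t)" if "1 \<le> t" for t
  proof -
    have "((\<lambda>t. t powr (1 - e)) has_real_derivative (1 - e) * t powr (1 - e - 1)) (at t)"
      using that by (intro has_real_derivative_powr) auto
    from DERIV_cdivide[OF this, of "1 - e"] show ?thesis using assms by simp
  qed
  ultimately have "(\<integral>\<^sup>+t. ennreal (t powr - e) * indicator {1..} t \<partial>lborel) = ennreal (0 / (1 - e) - 1 powr (1 - e) / (1 - e))"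
    by (intro nn_integral_FTC_atLeast) auto
  also have "0 / (1 - e) - 1 powr (1 - e) / (1 - e) = 1 / (e - 1)" using assms by (simp add: field_simps)
  finally show ?thesis .
qed

lemma dyadic_scale_exists:
  fixes t s :: real
  assumes "0 < t" "t \<le> 1" "0 < s"
  shows "\<exists>i::nat. t \<in> {2 powr - (Suc i * s)<..2 powr - (i * s)}"
proof -
  define y where "y = - log 2 t / s"
  have y: "0 \<le> y" using assms by (simp add: y_def divide_nonpos_pos)
  have t: "t = 2 powr - (y * s)" using assms by (simp add: y_def powr_log_cancel)
  have "real (nat \<lfloor>y\<rfloor>) \<le> y" "y < real (Suc (nat \<lfloor>y\<rfloor>))" using y by linarith+
  then have "nat \<lfloor>y\<rfloor> * s \<le> y * s" "y * s < Suc (nat \<lfloor>y\<rfloor>) * s" using assms by auto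
  then show ?thesis unfolding t by (intro exI[of _ "nat \<lfloor>y\<rfloor>"]) simp
qed

context dictionary
begin

abbreviation (input) interp_integrand :: "real \<Rightarrow> real \<Rightarrow> real \<Rightarrow> real vec \<Rightarrow> real \<Rightarrow> ennreal" where
  "interp_integrand p \<theta> \<tau> f t \<equiv> epowr (ennreal (t powr - \<theta>) * K_functional \<Phi> p f t) \<tau> * ennreal (1 / t)"

lemma interp_integrand_le:
  assumes "0 < t" "0 \<le> x" "0 < \<tau>" "K_functional \<Phi> p f t \<le> ennreal x"
  shows "interp_integrand p \<theta> \<tau> f t \<le> ennreal (t powr - (\<theta> * \<tau> + 1) * x powr \<tau>)"
  unfolding epowr_weight[OF assms(1,2), symmetric] using assms by (intro mult_right_mono epowr_mono mult_left_mono) auto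

lemma le_interp_integrand:
  assumes "0 < t" "0 \<le> x" "0 < \<tau>" "ennreal x \<le> K_functional \<Phi> p f t"
  shows "ennreal (t powr - (\<theta> * \<tau> + 1) * x powr \<tau>) \<le> interp_integrand p \<theta> \<tau> f t"
  unfolding epowr_weight[OF assms(1,2), symmetric] using assms by (intro mult_right_mono epowr_mono mult_left_mono) auto

text \<open>On (2^(-(i+1)s), 2^(-is)] the increasing K-functional is replaced by its value at the
  right end and the decreasing power of t by its value at the left end. For t > 1 the K-functional
  is at most the norm of \<open>f\<close>, and integrating the power contributes
  1/(\<theta>\<tau>).\<close>

lemma interp_integral_le:
  fixes \<kappa> :: "nat \<Rightarrow> real"
  assumes f: "f \<in> carrier_vec m" and t: "0 < \<tau>" and p: "0 < p" and \<theta>: "0 < \<theta>" and s: "0 < s"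
    and \<kappa>: "\<And>i. 0 \<le> \<kappa> i" "\<And>i. K_functional \<Phi> p f (2 powr - (i * s)) \<le> ennreal (\<kappa> i)"
    and B: "\<And>M. (\<Sum>i<M. 2 powr (i * (s * (\<theta> * \<tau>))) * \<kappa> i powr \<tau>) \<le> B"
  shows "(\<integral>\<^sup>+t\<in>{0<..}. interp_integrand p \<theta> \<tau> f t \<partial>lborel)
    \<le> ennreal (2 powr (s * (\<theta> * \<tau> + 1)) * B + l2_norm f powr \<tau> / (\<theta> * \<tau>))"
proof -
  let ?e = "\<theta> * \<tau> + 1"
  have te: "0 < \<theta> * \<tau>" using \<theta> t by simp
  let ?I = "\<lambda>i. {2 powr - (Suc i * s)<..2 powr - (i * s)}"
  define q where "q i = 2 powr (Suc i * s * ?e) * \<kappa> i powr \<tau>" for i :: nat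
  have q: "0 \<le> q i" for i by (simp add: q_def)
  let ?F = "ennreal (l2_norm f powr \<tau>)"
  have "(\<integral>\<^sup>+t\<in>{0<..}. interp_integrand p \<theta> \<tau> f t \<partial>lborel)
    \<le> (\<integral>\<^sup>+t. (\<Sum>i. ennreal (q i) * indicator (?I i) t) + ?F * (ennreal (t powr - ?e) * indicator {1..} t) \<partial>lborel)"
  proof (rule nn_integral_mono)
    fix u :: real
    show "interp_integrand p \<theta> \<tau> f u * indicator {0<..} u
      \<le> (\<Sum>i. ennreal (q i) * indicator (?I i) u) + ?F * (ennreal (u powr - ?e) * indicator {1..} u)"
    proof (cases "0 < u")
      case True
      show ?thesis
      proof (cases "u \<le> 1")
        case u1: True
        obtain i where i: "u \<in> ?I i" using dyadic_scale_exists[OF True u1 s] by blast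
        have "K_functional \<Phi> p f u \<le> ennreal (\<kappa> i)"
          using K_functional_mono[of u "2 powr - (i * s)" p f] \<kappa>(2)[of i] i by (auto intro: order_trans)
        then have "interp_integrand p \<theta> \<tau> f u \<le> ennreal (u powr - ?e * \<kappa> i powr \<tau>)"
          by (rule interp_integrand_le[OF True \<kappa>(1) t])
        also have "\<dots> \<le> ennreal (q i)"
        proof -
          have "u powr - ?e \<le> (2 powr - (Suc i * s)) powr - ?e"
            using i te by (intro powr_mono2') auto
          also have "\<dots> = 2 powr (Suc i * s * ?e)" by (simp only: powr_powr minus_mult_minus)
          finally show ?thesis unfolding q_def by (intro ennreal_leI mult_right_mono) auto
        qed
        also have "\<dots> = (\<Sum>i\<in>{i}. ennreal (q i) * indicator (?I i) u)" using i by simp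
        also have "\<dots> \<le> (\<Sum>i. ennreal (q i) * indicator (?I i) u)" by (rule sum_le_suminf) auto
        finally have "interp_integrand p \<theta> \<tau> f u \<le> (\<Sum>i. ennreal (q i) * indicator (?I i) u)" .
        then have "interp_integrand p \<theta> \<tau> f u * indicator {0<..} u \<le> (\<Sum>i. ennreal (q i) * indicator (?I i) u)"
          using True by simp
        then show ?thesis by (rule add_increasing2[rotated]) simp
      next
        case False
        have "interp_integrand p \<theta> \<tau> f u \<le> ennreal (u powr - ?e * l2_norm f powr \<tau>)"
          by (rule interp_integrand_le[OF True _ t K_functional_le_l2_norm[OF f p]]) simp
        also have "\<dots> = ?F * (ennreal (u powr - ?e) * indicator {1..} u)"
          using False by (simp add: ennreal_mult'[symmetric] mult.commute)
        finally have "interp_integrand p \<theta> \<tau> f u * indicator {0<..} u \<le> ?F * (ennreal (u powr - ?e) * indicator {1..} u)"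
          using True by simp
        then show ?thesis by (rule add_increasing[rotated]) simp
      qed
    qed simp
  qed
  also have "\<dots> = (\<Sum>i. \<integral>\<^sup>+t. ennreal (q i) * indicator (?I i) t \<partial>lborel)
      + ?F * (\<integral>\<^sup>+t. ennreal (t powr - ?e) * indicator {1..} t \<partial>lborel)"
    by (subst nn_integral_add) (auto simp: nn_integral_suminf nn_integral_cmult)
  also have "(\<integral>\<^sup>+t. ennreal (t powr - ?e) * indicator {1..} t \<partial>lborel) = ennreal (1 / (\<theta> * \<tau>))"
    using nn_integral_powr_atLeast_1[of ?e] \<theta> t by simp
  also have "?F * ennreal (1 / (\<theta> * \<tau>)) = ennreal (l2_norm f powr \<tau> / (\<theta> * \<tau>))"
    by (subst ennreal_mult'[symmetric]) auto
  also have "(\<Sum>i. \<integral>\<^sup>+t. ennreal (q i) * indicator (?I i) t \<partial>lborel) \<le> ennreal (2 powr (s * ?e) * B)"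
    unfolding suminf_eq_SUP
  proof (rule SUP_least)
    fix M
    have one: "(\<integral>\<^sup>+t. ennreal (q i) * indicator (?I i) t \<partial>lborel)
       \<le> ennreal (2 powr (s * ?e) * (2 powr (i * (s * (\<theta> * \<tau>))) * \<kappa> i powr \<tau>))" for i
    proof -
      have le: "2 powr - (Suc i * s) \<le> 2 powr - (i * s)" using s by simp
      have "(\<integral>\<^sup>+t. ennreal (q i) * indicator (?I i) t \<partial>lborel) = ennreal (q i) * emeasure lborel (?I i)"
        by (rule nn_integral_cmult_indicator) simp
      also have "emeasure lborel (?I i) = ennreal (2 powr - (i * s) - 2 powr - (Suc i * s))"
        by (rule emeasure_lborel_Ioc[OF le])
      also have "ennreal (q i) * \<dots> \<le> ennreal (q i) * ennreal (2 powr - (i * s))"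
        by (intro mult_left_mono ennreal_leI) auto
      also have "\<dots> = ennreal (q i * 2 powr - (i * s))" by (simp add: ennreal_mult q)
      also have "q i * 2 powr - (i * s) = 2 powr (Suc i * s * ?e + - (i * s)) * \<kappa> i powr \<tau>"
        by (simp only: q_def powr_add) simp
      also have "Suc i * s * ?e + - (i * s) = s * ?e + i * (s * (\<theta> * \<tau>))" by (simp add: algebra_simps)
      also have "2 powr (s * ?e + i * (s * (\<theta> * \<tau>))) * \<kappa> i powr \<tau>
          = 2 powr (s * ?e) * (2 powr (i * (s * (\<theta> * \<tau>))) * \<kappa> i powr \<tau>)"
        by (simp only: powr_add mult.assoc)
      finally show ?thesis .
    qed
    have "(\<Sum>i<M. \<integral>\<^sup>+t. ennreal (q i) * indicator (?I i) t \<partial>lborel)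
       \<le> (\<Sum>i<M. ennreal (2 powr (s * ?e) * (2 powr (i * (s * (\<theta> * \<tau>))) * \<kappa> i powr \<tau>)))"
      by (intro sum_mono one)
    also have "\<dots> = ennreal (2 powr (s * ?e) * (\<Sum>i<M. 2 powr (i * (s * (\<theta> * \<tau>))) * \<kappa> i powr \<tau>))"
      by (subst sum_ennreal) (auto simp: sum_distrib_left)
    also have "\<dots> \<le> ennreal (2 powr (s * ?e) * B)" by (intro ennreal_leI mult_left_mono B) simp
    finally show "(\<Sum>i<M. \<integral>\<^sup>+t. ennreal (q i) * indicator (?I i) t \<partial>lborel) \<le> ennreal (2 powr (s * ?e) * B)" .
  qed
  also have "ennreal (2 powr (s * ?e) * B) + ennreal (l2_norm f powr \<tau> / (\<theta> * \<tau>))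
      = ennreal (2 powr (s * ?e) * B + l2_norm f powr \<tau> / (\<theta> * \<tau>))"
    using B[of 0] \<theta> t by (intro ennreal_plus[symmetric]) auto
  finally show ?thesis by (simp add: add_right_mono)
qed

text \<open>The intervals (2^(-is), 2^(s-is)] lie to the right of the sampling points, so there the
  sampled K-functional is a lower bound. The level i = 0 uses (1, 2^s], and the interval length
  2^(-is) (2^s - 1) explains the constant.\<close>

lemma le_interp_integral:
  fixes \<kappa> :: "nat \<Rightarrow> real"
  assumes t: "0 < \<tau>" and \<theta>: "0 < \<theta>" and s: "0 < s"
    and k: "\<And>i. 0 \<le> \<kappa> i" "\<And>i. ennreal (\<kappa> i) \<le> K_functional \<Phi> p f (2 powr - (i * s))"
  shows "ennreal ((2 powr - (s * (\<theta> * \<tau> + 1)) * (2 powr s - 1)) * (\<Sum>i<L. 2 powr (i * (s * (\<theta> * \<tau>))) * \<kappa> i powr \<tau>))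
    \<le> (\<integral>\<^sup>+t\<in>{0<..}. interp_integrand p \<theta> \<tau> f t \<partial>lborel)"
proof -
  let ?e = "\<theta> * \<tau> + 1"
  have te: "0 < \<theta> * \<tau>" using \<theta> t by simp
  let ?I = "\<lambda>i::nat. {2 powr - (i * s)<..2 powr (s - i * s)}"
  define q where "q i = 2 powr ((i * s - s) * ?e) * \<kappa> i powr \<tau>" for i :: nat
  have q: "0 \<le> q i" for i by (simp add: q_def)
  have disj: "i = j" if "u \<in> ?I i" "u \<in> ?I j" for u i j
  proof -
    have "\<not> i < j" if "u \<in> ?I i" "u \<in> ?I j" for i j
    proof
      assume "i < j"
      then have "real (Suc i) * s \<le> real j * s" using s by (intro mult_right_mono) auto
      then have "2 powr (s - j * s) \<le> 2 powr - (i * s)" by (intro powr_mono) (auto simp: algebra_simps)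
      moreover have "2 powr - (i * s) < u" "u \<le> 2 powr (s - j * s)" using that by auto
      ultimately show False by linarith
    qed
    then show ?thesis using that by (meson linorder_neqE_nat)
  qed
  have one: "ennreal ((2 powr - (s * ?e) * (2 powr s - 1)) * (2 powr (i * (s * (\<theta> * \<tau>))) * \<kappa> i powr \<tau>))
      = ennreal (q i) * emeasure lborel (?I i)" for i
  proof -
    have "2 powr - (i * s) \<le> 2 powr (s - i * s)" using s by simp
    then have "ennreal (q i) * emeasure lborel (?I i) = ennreal (q i * (2 powr (s - i * s) - 2 powr - (i * s)))"
      by (subst emeasure_lborel_Ioc) (auto simp: ennreal_mult'[symmetric] q)
    also have "2 powr (s - i * s) - 2 powr - (i * s) = 2 powr - (i * s) * (2 powr s - 1)"
      by (simp add: powr_diff powr_minus field_simps)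
    also have "q i * (2 powr - (i * s) * (2 powr s - 1)) = 2 powr ((i * s - s) * ?e + - (i * s)) * ((2 powr s - 1) * \<kappa> i powr \<tau>)"
      by (simp only: q_def powr_add) (simp only: mult_ac)
    also have "(i * s - s) * ?e + - (i * s) = - (s * ?e) + i * (s * (\<theta> * \<tau>))" by (simp add: algebra_simps)
    also have "2 powr (- (s * ?e) + i * (s * (\<theta> * \<tau>))) * ((2 powr s - 1) * \<kappa> i powr \<tau>)
       = (2 powr - (s * ?e) * (2 powr s - 1)) * (2 powr (i * (s * (\<theta> * \<tau>))) * \<kappa> i powr \<tau>)"
      by (simp only: powr_add mult_ac)
    finally show ?thesis by simp
  qed
  have "1 \<le> 2 powr s" using s powr_mono[of 0 s 2] by simp
  then have "ennreal ((2 powr - (s * ?e) * (2 powr s - 1)) * (\<Sum>i<L. 2 powr (i * (s * (\<theta> * \<tau>))) * \<kappa> i powr \<tau>))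
    = (\<Sum>i<L. ennreal ((2 powr - (s * ?e) * (2 powr s - 1)) * (2 powr (i * (s * (\<theta> * \<tau>))) * \<kappa> i powr \<tau>)))"
    by (subst sum_ennreal) (auto simp: sum_distrib_left)
  also have "\<dots> = (\<Sum>i<L. \<integral>\<^sup>+t. ennreal (q i) * indicator (?I i) t \<partial>lborel)"
    unfolding one by (intro sum.cong refl nn_integral_cmult_indicator[symmetric]) simp
  also have "\<dots> = (\<integral>\<^sup>+t. (\<Sum>i<L. ennreal (q i) * indicator (?I i) t) \<partial>lborel)"
    by (rule nn_integral_sum[symmetric]) simp
  also have "\<dots> \<le> (\<integral>\<^sup>+t\<in>{0<..}. interp_integrand p \<theta> \<tau> f t \<partial>lborel)"
  proof (rule nn_integral_mono)
    fix u :: real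
    show "(\<Sum>i<L. ennreal (q i) * indicator (?I i) u) \<le> interp_integrand p \<theta> \<tau> f u * indicator {0<..} u"
    proof (cases "\<exists>i<L. u \<in> ?I i")
      case True
      then obtain i where i: "i < L" "u \<in> ?I i" by blast
      have "2 powr - (i * s) < u" using i(2) by simp
      then have u: "0 < u" by (rule less_trans[rotated]) simp
      have "(\<Sum>i<L. ennreal (q i) * indicator (?I i) u) = (\<Sum>j\<in>{i}. ennreal (q j) * indicator (?I j) u)"
      proof (rule sum.mono_neutral_right)
        show "\<forall>j\<in>{..<L} - {i}. ennreal (q j) * indicator (?I j) u = 0"
          using disj[OF i(2)] by (auto simp: indicator_def)
      qed (use i in auto)
      also have "\<dots> = ennreal (q i)" using i by simp
      also have "\<dots> \<le> ennreal (u powr - ?e * \<kappa> i powr \<tau>)"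
      proof -
        have "2 powr ((i * s - s) * ?e) = (2 powr (s - i * s)) powr - ?e"
          by (simp only: powr_powr) (simp add: algebra_simps)
        also have "\<dots> \<le> u powr - ?e" using i u te by (intro powr_mono2') auto
        finally show ?thesis unfolding q_def by (intro ennreal_leI mult_right_mono) auto
      qed
      also have "\<dots> \<le> interp_integrand p \<theta> \<tau> f u"
      proof (rule le_interp_integrand[OF u k(1) t])
        show "ennreal (\<kappa> i) \<le> K_functional \<Phi> p f u"
          using k(2)[of i] K_functional_mono[of "2 powr - (i * s)" u p f] i by (auto intro: order_trans)
      qed
      finally show ?thesis using u by simp
    next
      case False
      then have "(\<Sum>i<L. ennreal (q i) * indicator (?I i) u) = 0" by (intro sum.neutral) (auto simp: indicator_def)
      then show ?thesis by simp
    qed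
  qed
  finally show ?thesis .
qed

context
  fixes \<tau> p \<theta> :: real
  assumes t: "0 < \<tau>" "\<tau> \<le> 1" and p: "0 < p" and \<theta>: "0 < \<theta>" "\<theta> < 1"
    and r: "1 / \<tau> - 1 / 2 = \<theta> * (1 / p - 1 / 2)"
begin

text \<open>As 1/\<tau> - 1/2 is positive, so is 1/p - 1/2; then \<theta> < 1 gives 1/\<tau> < 1/p.
  The last identity turns the weights of the discretised integral into those of the dyadic
  errors.\<close>

lemma smoothness_pos: "0 < 1 / p - 1 / 2" and p_less: "p < \<tau>"
  and smoothness_times: "(1 / p - 1 / 2) * (\<theta> * \<tau>) = 1 - \<tau> / 2"
proof -
  have "1 \<le> 1 / \<tau>" using t by simp
  then have r0: "0 < \<theta> * (1 / p - 1 / 2)" unfolding r[symmetric] by linarith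
  then show s: "0 < 1 / p - 1 / 2" using \<theta> by (simp add: zero_less_mult_iff)
  have "\<theta> * (1 / p - 1 / 2) < 1 * (1 / p - 1 / 2)" using \<theta> s by (intro mult_strict_right_mono) auto
  then have "1 / \<tau> < 1 / p" unfolding r[symmetric] by simp
  then show "p < \<tau>" using t p by (simp add: field_simps)
  have "(1 / p - 1 / 2) * (\<theta> * \<tau>) = (1 / \<tau> - 1 / 2) * \<tau>" unfolding r by simp
  also have "\<dots> = 1 - \<tau> / 2" using t by (simp add: field_simps)
  finally show "(1 / p - 1 / 2) * (\<theta> * \<tau>) = 1 - \<tau> / 2" .
qed

text \<open>At t = 2^(-is) the coefficient vector is split into its 2^i largest entries and the
  rest. The rests are summed by \<open>sum_tail_le\<close>, the heads by \<open>sum_head_le\<close>;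
  in \<open>Ci\<close> the term with \<open>B\<close> stems from t \<le> 1 and
  \<open>K / (\<theta> * \<tau>)\<close> from t > 1.\<close>

lemma interp_norm_le_sparsity_norm:
  fixes u B Ci :: real
  defines "u \<equiv> 2 powr - ((1 - p / \<tau>) / 2)"
  defines "B \<equiv> K * (5 / (1 - 2 powr - (1 - \<tau> / 2))) + (1 / (1 - u)) powr (\<tau> / p) * (5 / (1 - u powr (\<tau> / p)))"
  defines "Ci \<equiv> 2 powr ((1 / p - 1 / 2) * (\<theta> * \<tau> + 1)) * B + K / (\<theta> * \<tau>)"
  assumes f: "f \<in> carrier_vec m"
  shows "interp_norm \<Phi> p \<theta> \<tau> f \<le> ennreal (Ci powr (1 / \<tau>)) * sparsity_norm \<Phi> \<tau> f"
proof -
  let ?s = "1 / p - 1 / 2"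
  have u: "0 < u" "u < 1" using p_less p t powr_less_mono[of "- ((1 - p / \<tau>) / 2)" 0 2] by (auto simp: u_def)
  have uq: "u powr (\<tau> / p) < 1" using u p t powr_less_mono2[of "\<tau> / p" u 1] by auto
  have "2 powr - (1 - \<tau> / 2) < 2 powr 0" using t by (intro powr_less_mono) auto
  then have B0: "0 \<le> B" unfolding B_def using K u uq by (intro add_nonneg_nonneg mult_nonneg_nonneg) auto
  have Ci: "0 < Ci" unfolding Ci_def using B0 K t \<theta> by (intro add_nonneg_pos mult_nonneg_nonneg) auto
  show ?thesis
  proof (rule le_sparsity_norm[OF f])
    show "0 < Ci powr (1 / \<tau>)" using Ci by simp
    fix c assume c: "c \<in> carrier_vec N" "\<Phi> *\<^sub>v c = f"
    obtain a h where ah: "rearrangement a N" "\<And>k. h k \<in> carrier_vec N" "\<And>k. l0_norm (h k) \<le> k"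
      "\<And>q k. 0 < q \<Longrightarrow> power_sum q (h k) = (\<Sum>j<k. a j powr q)"
      "\<And>q. power_sum q c = (\<Sum>j<N. a j powr q)"
      "\<And>k. l2_norm (c - h k) = sqrt (\<Sum>j\<in>{k..<N}. (a j)\<^sup>2)"
      using decreasing_rearrangement[OF c(1)] by metis
    interpret rearrangement a N by (rule ah(1))
    define \<kappa> where "\<kappa> i = K * l2_norm (c - h (2 ^ i)) + 2 powr - (i * ?s) * lp_norm p (h (2 ^ i))" for i
    let ?X = "\<lambda>i. 2 powr (i * (1 - \<tau> / 2)) * (\<Sum>j\<in>{2 ^ i..<N}. (a j)\<^sup>2) powr (\<tau> / 2)"
    let ?Y = "\<lambda>i. 2 powr (i * (1 - \<tau> / p)) * (\<Sum>j<2 ^ i. a j powr p) powr (\<tau> / p)"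
    have k0: "0 \<le> \<kappa> i" for i using K by (simp add: \<kappa>_def)
    have term_le: "2 powr (i * (?s * (\<theta> * \<tau>))) * \<kappa> i powr \<tau> \<le> K * ?X i + ?Y i" for i
    proof -
      have "\<kappa> i powr \<tau> \<le> (K * l2_norm (c - h (2 ^ i))) powr \<tau> + (2 powr - (i * ?s) * lp_norm p (h (2 ^ i))) powr \<tau>"
        unfolding \<kappa>_def using K t by (intro powr_add_le) auto
      also have "(K * l2_norm (c - h (2 ^ i))) powr \<tau> \<le> K * (\<Sum>j\<in>{2 ^ i..<N}. (a j)\<^sup>2) powr (\<tau> / 2)"
      proof -
        have "l2_norm (c - h (2 ^ i)) powr \<tau> = (\<Sum>j\<in>{2 ^ i..<N}. (a j)\<^sup>2) powr (\<tau> / 2)"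
          unfolding ah(6) by (simp add: powr_half_sqrt[symmetric] powr_powr sum_nonneg)
        then show ?thesis using K t by (simp add: powr_mult powr_le_self_of_ge_1 mult_right_mono)
      qed
      also have "(2 powr - (i * ?s) * lp_norm p (h (2 ^ i))) powr \<tau> = 2 powr (- (i * ?s) * \<tau>) * (\<Sum>j<2 ^ i. a j powr p) powr (\<tau> / p)"
        unfolding lp_norm_power_sum ah(4)[OF p] powr_mult powr_powr by simp
      finally have "2 powr (i * (1 - \<tau> / 2)) * \<kappa> i powr \<tau> \<le> 2 powr (i * (1 - \<tau> / 2)) *
          (K * (\<Sum>j\<in>{2 ^ i..<N}. (a j)\<^sup>2) powr (\<tau> / 2) + 2 powr (- (i * ?s) * \<tau>) * (\<Sum>j<2 ^ i. a j powr p) powr (\<tau> / p))"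
        by (intro mult_left_mono) auto
      also have "\<dots> = K * ?X i + (2 powr (i * (1 - \<tau> / 2)) * 2 powr (- (i * ?s) * \<tau>)) * (\<Sum>j<2 ^ i. a j powr p) powr (\<tau> / p)"
        by (simp only: distrib_left mult_ac)
      also have "2 powr (i * (1 - \<tau> / 2)) * 2 powr (- (i * ?s) * \<tau>) = 2 powr (i * (1 - \<tau> / p))"
        by (simp add: powr_add[symmetric] algebra_simps)
      finally show ?thesis by (simp only: smoothness_times)
    qed
    have sumB: "(\<Sum>i<M. 2 powr (i * (?s * (\<theta> * \<tau>))) * \<kappa> i powr \<tau>) \<le> B * power_sum \<tau> c" for M
    proof -
      have "(\<Sum>i<M. 2 powr (i * (?s * (\<theta> * \<tau>))) * \<kappa> i powr \<tau>) \<le> (\<Sum>i<M. K * ?X i + ?Y i)"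
        by (intro sum_mono term_le)
      also have "\<dots> = K * (\<Sum>i<M. ?X i) + (\<Sum>i<M. ?Y i)" by (simp add: sum.distrib sum_distrib_left)
      also have "\<dots> \<le> K * (5 / (1 - 2 powr - (1 - \<tau> / 2)) * power_sum \<tau> c)
          + (1 / (1 - u)) powr (\<tau> / p) * (5 / (1 - u powr (\<tau> / p))) * power_sum \<tau> c"
        unfolding ah(5) u_def using K t p p_less by (intro add_mono mult_left_mono sum_tail_le sum_head_le) auto
      also have "\<dots> = B * power_sum \<tau> c" by (simp only: B_def distrib_right mult.assoc)
      finally show ?thesis .
    qed
    have Kle: "K_functional \<Phi> p f (2 powr - (i * ?s)) \<le> ennreal (\<kappa> i)" for i
      unfolding \<kappa>_def c(2)[symmetric] by (rule K_functional_le_split[OF c(1) ah(2)]) simp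
    have "(\<integral>\<^sup>+t\<in>{0<..}. interp_integrand p \<theta> \<tau> f t \<partial>lborel)
      \<le> ennreal (2 powr (?s * (\<theta> * \<tau> + 1)) * (B * power_sum \<tau> c) + l2_norm f powr \<tau> / (\<theta> * \<tau>))"
      by (rule interp_integral_le[OF f t(1) p \<theta>(1) smoothness_pos k0 Kle sumB])
    also have "\<dots> \<le> ennreal (Ci * power_sum \<tau> c)"
    proof (rule ennreal_leI)
      have "l2_norm f powr \<tau> \<le> (K * lp_norm \<tau> c) powr \<tau>"
        using l2_norm_le_lp_norm_preimage[OF t(1) _ c] t by (intro powr_mono2) auto
      also have "\<dots> = K powr \<tau> * power_sum \<tau> c"
        unfolding lp_norm_power_sum powr_mult powr_powr using t by simp
      also have "\<dots> \<le> K * power_sum \<tau> c" using K t by (intro mult_right_mono powr_le_self_of_ge_1) auto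
      finally have "l2_norm f powr \<tau> / (\<theta> * \<tau>) \<le> K * power_sum \<tau> c / (\<theta> * \<tau>)"
        using \<theta> t by (intro divide_right_mono) auto
      then show "2 powr (?s * (\<theta> * \<tau> + 1)) * (B * power_sum \<tau> c) + l2_norm f powr \<tau> / (\<theta> * \<tau>) \<le> Ci * power_sum \<tau> c"
        by (simp add: Ci_def distrib_right)
    qed
    finally have "interp_norm \<Phi> p \<theta> \<tau> f \<le> epowr (ennreal (Ci * power_sum \<tau> c)) (1 / \<tau>)"
      unfolding interp_norm_def using t by (intro epowr_mono) auto
    also have "\<dots> = ennreal ((Ci * power_sum \<tau> c) powr (1 / \<tau>))"
      by (rule epowr_ennreal) (use Ci in simp)
    finally show "interp_norm \<Phi> p \<theta> \<tau> f \<le> ennreal (Ci powr (1 / \<tau>) * lp_norm \<tau> c)"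
      by (simp only: powr_mult lp_norm_power_sum)
  qed
qed

text \<open>Both the norm of \<open>f\<close> and the dyadic errors are at most \<open>K\<close>
  times sampled values of the K-functional, so \<open>telescoping\<close> yields 22 K R (K Z + K Z);
  this is the 44 K^2 R in \<open>Cl\<close>, and the denominator is the constant of
  \<open>le_interp_integral\<close>.\<close>

lemma sparsity_norm_le_interp_norm:
  fixes Cl :: real
  defines "Cl \<equiv> 44 * K\<^sup>2 * R / (2 powr - ((1 / p - 1 / 2) * (\<theta> * \<tau> + 1)) * (2 powr (1 / p - 1 / 2) - 1))"
  assumes f: "f \<in> carrier_vec m"
  shows "sparsity_norm \<Phi> \<tau> f \<le> ennreal (Cl powr (1 / \<tau>)) * interp_norm \<Phi> p \<theta> \<tau> f"
proof -
  let ?s = "1 / p - 1 / 2"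
  let ?J = "\<integral>\<^sup>+t\<in>{0<..}. interp_integrand p \<theta> \<tau> f t \<partial>lborel"
  define c0 where "c0 = 2 powr - (?s * (\<theta> * \<tau> + 1)) * (2 powr ?s - 1)"
  have "1 < 2 powr ?s" using smoothness_pos powr_less_mono[of 0 ?s 2] by simp
  then have c0: "0 < c0" by (simp add: c0_def)
  have Cl: "Cl = 44 * K\<^sup>2 * R / c0" by (simp add: Cl_def c0_def)
  have Cl0: "0 < Cl" unfolding Cl using c0 K R by (intro divide_pos_pos mult_pos_pos) auto
  define \<kappa> where "\<kappa> i = enn2real (K_functional \<Phi> p f (2 powr - (i * ?s)))" for i :: nat
  have k0: "0 \<le> \<kappa> i" for i by (simp add: \<kappa>_def)
  have k: "ennreal (\<kappa> i) = K_functional \<Phi> p f (2 powr - (i * ?s))" for i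
  proof -
    have "K_functional \<Phi> p f (2 powr - (i * ?s)) < \<top>"
      using K_functional_le_l2_norm[OF f p] by (rule le_less_trans) simp
    then show ?thesis by (simp add: \<kappa>_def)
  qed
  have p1: "p \<le> 1" using p_less t by simp
  have real_le: "x \<le> K * \<kappa> i" if "ennreal x \<le> ennreal K * K_functional \<Phi> p f (2 powr - (i * ?s))" for x i
  proof -
    have "ennreal x \<le> ennreal (K * \<kappa> i)" using that K k0[of i] by (simp add: k[symmetric] ennreal_mult)
    then show ?thesis using K k0[of i] by (subst (asm) ennreal_le_iff) auto
  qed
  have sig: "best_approx_error \<Phi> (2 ^ i) f \<le> K * \<kappa> i" for i
  proof (rule real_le)
    have "real (2 ^ i) powr - ?s = (2 powr real i) powr - ?s" by (simp add: powr_realpow)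
    also have "\<dots> = 2 powr - (i * ?s)" by (simp only: powr_powr mult_minus_right)
    finally show "ennreal (best_approx_error \<Phi> (2 ^ i) f) \<le> ennreal K * K_functional \<Phi> p f (2 powr - (i * ?s))"
      using best_approx_error_le_K_functional[OF f _ p p1, of "2 ^ i"] by simp
  qed
  have F: "l2_norm f \<le> K * \<kappa> 0"
    by (rule real_le) (use l2_norm_le_K_functional[OF f p p1] in simp)
  have Kpow: "(K * x) powr \<tau> \<le> K * x powr \<tau>" for x
    using powr_le_self_of_ge_1[OF K t(2)] K by (simp add: powr_mult mult_right_mono)
  obtain L c where c: "c \<in> carrier_vec N" "\<Phi> *\<^sub>v c = f"
    "power_sum \<tau> c \<le> 22 * K * R * (l2_norm f powr \<tau> + (\<Sum>i<L. dyadic_error \<tau> f i))"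
    using telescoping[OF f t] by blast
  \<comment> \<open>The range \<open>Suc L\<close> guarantees the term i = 0, which controls the
    norm of \<open>f\<close>, even if \<open>L\<close> is 0.\<close>
  define Z where "Z = (\<Sum>i<Suc L. 2 powr (i * (?s * (\<theta> * \<tau>))) * \<kappa> i powr \<tau>)"
  have "(\<Sum>i<L. dyadic_error \<tau> f i) \<le> (\<Sum>i<Suc L. dyadic_error \<tau> f i)" by simp
  also have "\<dots> \<le> (\<Sum>i<Suc L. K * (2 powr (i * (?s * (\<theta> * \<tau>))) * \<kappa> i powr \<tau>))"
  proof (rule sum_mono)
    fix i
    have "best_approx_error \<Phi> (2 ^ i) f powr \<tau> \<le> (K * \<kappa> i) powr \<tau>" using sig t by (intro powr_mono2) auto
    also note Kpow
    finally show "dyadic_error \<tau> f i \<le> K * (2 powr (i * (?s * (\<theta> * \<tau>))) * \<kappa> i powr \<tau>)"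
      unfolding smoothness_times by (simp add: mult.left_commute mult_left_mono)
  qed
  also have "\<dots> = K * Z" by (simp only: Z_def sum_distrib_left)
  finally have E: "(\<Sum>i<L. dyadic_error \<tau> f i) \<le> K * Z" .
  have "l2_norm f powr \<tau> \<le> (K * \<kappa> 0) powr \<tau>" using F t by (intro powr_mono2) auto
  also have "\<dots> \<le> K * \<kappa> 0 powr \<tau>" by (rule Kpow)
  also have "\<kappa> 0 powr \<tau> \<le> Z"
    unfolding Z_def using member_le_sum[of 0 "{..<Suc L}" "\<lambda>i. 2 powr (i * (?s * (\<theta> * \<tau>))) * \<kappa> i powr \<tau>"] by simp
  finally have F': "l2_norm f powr \<tau> \<le> K * Z" using K by (simp add: mult_left_mono)
  have "power_sum \<tau> c \<le> 22 * K * R * (K * Z + K * Z)"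
    using E F' K R by (intro order_trans[OF c(3)] mult_left_mono add_mono) auto
  also have "\<dots> = Cl * (c0 * Z)" using c0 by (simp add: Cl power2_eq_square)
  finally have "ennreal (power_sum \<tau> c) \<le> ennreal Cl * ennreal (c0 * Z)"
    using Cl0 by (simp add: ennreal_mult'[symmetric] ennreal_leI)
  also have "\<dots> \<le> ennreal Cl * ?J"
    unfolding c0_def Z_def
    by (intro mult_left_mono le_interp_integral t(1) \<theta>(1) smoothness_pos k0) (simp_all add: k)
  finally show ?thesis
    unfolding interp_norm_def by (rule sparsity_norm_le_of_power_sum[OF t(1) Cl0 c(1,2)])
qed

end

end

section \<open>Uniform constants and the final choice of parameters\<close>

lemma equal_with_equiv_norms_max:
  assumes "V = {f \<in> H. nV f < \<top>}" "W = {f \<in> H. nW f < \<top>}" "0 < A"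
    and "\<And>f. f \<in> H \<Longrightarrow> nV f \<le> ennreal A * nW f" "\<And>f. f \<in> H \<Longrightarrow> nW f \<le> ennreal B * nV f"
  shows "equal_with_equiv_norms (max A B) V nV W nW"
proof (rule equal_with_equiv_normsI[OF _ assms(1,2)])
  show "0 < max A B" using assms(3) by simp
  fix f assume f: "f \<in> H"
  have "ennreal A * nW f \<le> ennreal (max A B) * nW f" "ennreal B * nV f \<le> ennreal (max A B) * nV f"
    by (intro mult_right_mono ennreal_leI; simp)+
  then show "nV f \<le> ennreal (max A B) * nW f" "nW f \<le> ennreal (max A B) * nV f"
    using assms(4,5)[OF f] by (auto intro: order_trans)
qed

lemma approx_space_equiv:
  assumes K: "1 \<le> K" and R: "1 < R" and t: "0 < \<tau>" "\<tau> \<le> 1"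
  shows "\<exists>C. \<forall>\<Phi>. well_conditioned K R \<Phi> \<longrightarrow>
    equal_with_equiv_norms C (approx_space \<Phi> (1 / \<tau> - 1 / 2) \<tau>) (approx_norm \<Phi> (1 / \<tau> - 1 / 2) \<tau>)
      (sparsity_space \<Phi> \<tau>) (sparsity_norm \<Phi> \<tau>)"
proof (intro exI allI impI)
  fix \<Phi> assume "well_conditioned K R \<Phi>"
  then interpret dictionary \<Phi> K R using K R by unfold_locales
  show "equal_with_equiv_norms
    (max (K + (K * (5 / (1 - 2 powr - (1 - \<tau> / 2)))) powr (1 / \<tau>)) ((88 * K * R) powr (1 / \<tau>) * 2 powr (1 / \<tau>)))
    (approx_space \<Phi> (1 / \<tau> - 1 / 2) \<tau>) (approx_norm \<Phi> (1 / \<tau> - 1 / 2) \<tau>) (sparsity_space \<Phi> \<tau>) (sparsity_norm \<Phi> \<tau>)"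
  proof (rule equal_with_equiv_norms_max[OF approx_space_def sparsity_space_def])
    show "0 < K + (K * (5 / (1 - 2 powr - (1 - \<tau> / 2)))) powr (1 / \<tau>)"
      using K by (intro add_pos_nonneg) auto
  qed (rule approx_norm_le_sparsity_norm[OF _ t] sparsity_norm_le_approx_norm[OF _ t], assumption)+
qed

text \<open>The quantifier over \<theta> stands inside that over \<open>D\<close>: the relation
  determines \<theta> from \<tau> and \<open>p\<close>, so constants built from \<theta> are
  functions of these. If no \<theta> is admissible, the claim is vacuous.\<close>

lemma interp_space_equiv:
  assumes K: "1 \<le> K" and R: "1 < R" and t: "0 < \<tau>" "\<tau> \<le> 1"
  shows "\<exists>D. \<forall>\<Phi> \<theta>. well_conditioned K R \<Phi> \<and> 0 < p \<and> 0 < \<theta> \<and> \<theta> < 1 \<and> 1 / \<tau> - 1 / 2 = \<theta> * (1 / p - 1 / 2) \<longrightarrow>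
    equal_with_equiv_norms D (sparsity_space \<Phi> \<tau>) (sparsity_norm \<Phi> \<tau>)
      (interp_space \<Phi> p \<theta> \<tau>) (interp_norm \<Phi> p \<theta> \<tau>)"
proof (cases "\<exists>\<theta>. 0 < p \<and> 0 < \<theta> \<and> \<theta> < 1 \<and> 1 / \<tau> - 1 / 2 = \<theta> * (1 / p - 1 / 2)")
  case True
  then obtain \<theta> where \<theta>: "0 < p" "0 < \<theta>" "\<theta> < 1" "1 / \<tau> - 1 / 2 = \<theta> * (1 / p - 1 / 2)" by blast
  have "1 \<le> 1 / \<tau>" using t by simp
  then have ne: "1 / p - 1 / 2 \<noteq> 0" using \<theta>(4) by auto
  have unique: "\<theta>' = \<theta>" if "1 / \<tau> - 1 / 2 = \<theta>' * (1 / p - 1 / 2)" for \<theta>'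
    using that \<theta>(4) ne by (metis mult_right_cancel)
  define u where "u = 2 powr - ((1 - p / \<tau>) / 2)"
  define B where "B = K * (5 / (1 - 2 powr - (1 - \<tau> / 2))) + (1 / (1 - u)) powr (\<tau> / p) * (5 / (1 - u powr (\<tau> / p)))"
  define Ci where "Ci = 2 powr ((1 / p - 1 / 2) * (\<theta> * \<tau> + 1)) * B + K / (\<theta> * \<tau>)"
  define Cl where "Cl = 44 * K\<^sup>2 * R / (2 powr - ((1 / p - 1 / 2) * (\<theta> * \<tau> + 1)) * (2 powr (1 / p - 1 / 2) - 1))"
  \<comment> \<open>The inner maximum with 1 supplies the positivity of the constant.\<close>
  have "equal_with_equiv_norms (max (max 1 (Cl powr (1 / \<tau>))) (Ci powr (1 / \<tau>))) (sparsity_space \<Phi> \<tau>) (sparsity_norm \<Phi> \<tau>)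
      (interp_space \<Phi> p \<theta> \<tau>) (interp_norm \<Phi> p \<theta> \<tau>)" if "well_conditioned K R \<Phi>" for \<Phi>
  proof -
    interpret dictionary \<Phi> K R using K R that by unfold_locales
    show ?thesis
    proof (rule equal_with_equiv_norms_max[OF sparsity_space_def interp_space_def])
      fix f :: "real vec" assume f: "f \<in> carrier_vec m"
      show "interp_norm \<Phi> p \<theta> \<tau> f \<le> ennreal (Ci powr (1 / \<tau>)) * sparsity_norm \<Phi> \<tau> f"
        unfolding Ci_def B_def u_def by (rule interp_norm_le_sparsity_norm[OF t \<theta> f])
      have "sparsity_norm \<Phi> \<tau> f \<le> ennreal (Cl powr (1 / \<tau>)) * interp_norm \<Phi> p \<theta> \<tau> f"
        unfolding Cl_def by (rule sparsity_norm_le_interp_norm[OF t \<theta> f])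
      also have "\<dots> \<le> ennreal (max 1 (Cl powr (1 / \<tau>))) * interp_norm \<Phi> p \<theta> \<tau> f"
        by (intro mult_right_mono ennreal_leI) auto
      finally show "sparsity_norm \<Phi> \<tau> f \<le> ennreal (max 1 (Cl powr (1 / \<tau>))) * interp_norm \<Phi> p \<theta> \<tau> f" .
    qed simp
  qed
  then show ?thesis using unique by blast
qed blast

theorem theorem1p5:
  shows "\<exists>(\<gamma> :: real \<Rightarrow> real) (m\<^sub>0 :: real \<Rightarrow> nat)
           (C :: real \<Rightarrow> real \<Rightarrow> real) (D :: real \<Rightarrow> real \<Rightarrow> real \<Rightarrow> real).
     (\<forall>R>1. \<gamma> R > 0) \<and>
     (\<forall>R\<ge>127/100. \<gamma> R > 7 / 10 ^ 6) \<and>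
     (\<forall>\<^sub>F R in at_top. 15 / 10 ^ 4 \<le> \<gamma> R \<and> \<gamma> R < 25 / 10 ^ 4) \<and>
     (\<forall>(m :: nat) (N :: nat) (R :: real).
        R = real N / real m \<and> R > 1 \<and> m \<ge> m\<^sub>0 R \<longrightarrow>
        (\<exists>E \<in> sets (gaussian_entries m N).
           measure (gaussian_entries m N) E \<le> 10 * R\<^sup>2 * exp (- \<gamma> R * real m) \<and>
           (\<forall>\<omega> \<in> space (gaussian_entries m N) - E.
              let \<Phi> = mat m N \<omega> in
              \<forall>\<tau> r. 0 < \<tau> \<and> \<tau> \<le> 1 \<and> r = 1 / \<tau> - 1 / 2 \<longrightarrow>
                equal_with_equiv_norms (C \<tau> R)
                  (approx_space \<Phi> r \<tau>) (approx_norm \<Phi> r \<tau>)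
                  (sparsity_space \<Phi> \<tau>) (sparsity_norm \<Phi> \<tau>) \<and>
                (\<forall>p \<theta>. 0 < p \<and> 0 < \<theta> \<and> \<theta> < 1 \<and> r = \<theta> * (1 / p - 1 / 2) \<longrightarrow>
                  equal_with_equiv_norms (D \<tau> p R)
                    (sparsity_space \<Phi> \<tau>) (sparsity_norm \<Phi> \<tau>)
                    (interp_space \<Phi> p \<theta> \<tau>) (interp_norm \<Phi> p \<theta> \<tau>)))))"
proof -
  define good where "good K R \<longleftrightarrow> 1 \<le> K \<and> (\<forall>m N. R = real N / real m \<longrightarrow>
    (\<exists>E\<in>sets (gaussian_entries m N). measure (gaussian_entries m N) E \<le> 3 * exp (- real m) \<and>
      (\<forall>\<omega>\<in>space (gaussian_entries m N) - E. well_conditioned K R (mat m N \<omega>))))" for K R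
  \<comment> \<open>Choosing \<open>K\<close>, \<open>C\<close> and \<open>D\<close> as functions of
    R, of (\<tau>, R) and of (\<tau>, p, R) makes them independent of \<open>m\<close>,
    \<open>N\<close> and the sample.\<close>
  define K where "K R = (SOME K. good K R)" for R
  have good: "good (K R) R" if "1 < R" for R
    unfolding K_def by (rule someI_ex) (use gaussian_well_conditioned[OF that] in \<open>simp add: good_def\<close>)
  then have K: "1 \<le> K R" if "1 < R" for R using that by (simp add: good_def)
  define PC where "PC C \<tau> R \<longleftrightarrow> (\<forall>\<Phi>. well_conditioned (K R) R \<Phi> \<longrightarrow>
      equal_with_equiv_norms C (approx_space \<Phi> (1 / \<tau> - 1 / 2) \<tau>) (approx_norm \<Phi> (1 / \<tau> - 1 / 2) \<tau>)
        (sparsity_space \<Phi> \<tau>) (sparsity_norm \<Phi> \<tau>))" for C \<tau> R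
  define C where "C \<tau> R = (SOME C. PC C \<tau> R)" for \<tau> R
  have C: "PC (C \<tau> R) \<tau> R" if "0 < \<tau>" "\<tau> \<le> 1" "1 < R" for \<tau> R
    unfolding C_def by (rule someI_ex) (unfold PC_def, rule approx_space_equiv[OF K[OF that(3)] that(3,1,2)])
  define PD where "PD D \<tau> p R \<longleftrightarrow> (\<forall>\<Phi> \<theta>. well_conditioned (K R) R \<Phi> \<and> 0 < p \<and> 0 < \<theta> \<and> \<theta> < 1 \<and>
      1 / \<tau> - 1 / 2 = \<theta> * (1 / p - 1 / 2) \<longrightarrow>
      equal_with_equiv_norms D (sparsity_space \<Phi> \<tau>) (sparsity_norm \<Phi> \<tau>)
        (interp_space \<Phi> p \<theta> \<tau>) (interp_norm \<Phi> p \<theta> \<tau>))" for D \<tau> p R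
  define D where "D \<tau> p R = (SOME D. PD D \<tau> p R)" for \<tau> p R
  have D: "PD (D \<tau> p R) \<tau> p R" if "0 < \<tau>" "\<tau> \<le> 1" "1 < R" for \<tau> p R
    unfolding D_def by (rule someI_ex) (unfold PD_def, rule interp_space_equiv[OF K[OF that(3)] that(3,1,2)])
  have equiv: "let \<Phi> = mat m N \<omega> in
              \<forall>\<tau> r. 0 < \<tau> \<and> \<tau> \<le> 1 \<and> r = 1 / \<tau> - 1 / 2 \<longrightarrow>
                equal_with_equiv_norms (C \<tau> R)
                  (approx_space \<Phi> r \<tau>) (approx_norm \<Phi> r \<tau>)
                  (sparsity_space \<Phi> \<tau>) (sparsity_norm \<Phi> \<tau>) \<and>
                (\<forall>p \<theta>. 0 < p \<and> 0 < \<theta> \<and> \<theta> < 1 \<and> r = \<theta> * (1 / p - 1 / 2) \<longrightarrow>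
                  equal_with_equiv_norms (D \<tau> p R)
                    (sparsity_space \<Phi> \<tau>) (sparsity_norm \<Phi> \<tau>)
                    (interp_space \<Phi> p \<theta> \<tau>) (interp_norm \<Phi> p \<theta> \<tau>))"
    if R: "1 < R" and wc: "well_conditioned (K R) R (mat m N \<omega>)" for m N R \<omega>
    unfolding Let_def
  proof (intro allI impI conjI)
    fix \<tau> r :: real assume "0 < \<tau> \<and> \<tau> \<le> 1 \<and> r = 1 / \<tau> - 1 / 2"
    then have t: "0 < \<tau>" "\<tau> \<le> 1" and r: "r = 1 / \<tau> - 1 / 2" by auto
    show "equal_with_equiv_norms (C \<tau> R) (approx_space (mat m N \<omega>) r \<tau>) (approx_norm (mat m N \<omega>) r \<tau>)
        (sparsity_space (mat m N \<omega>) \<tau>) (sparsity_norm (mat m N \<omega>) \<tau>)"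
      unfolding r by (rule C[OF t R, unfolded PC_def, rule_format, OF wc])
    fix p \<theta> :: real assume "0 < p \<and> 0 < \<theta> \<and> \<theta> < 1 \<and> r = \<theta> * (1 / p - 1 / 2)"
    then show "equal_with_equiv_norms (D \<tau> p R) (sparsity_space (mat m N \<omega>) \<tau>) (sparsity_norm (mat m N \<omega>) \<tau>)
        (interp_space (mat m N \<omega>) p \<theta> \<tau>) (interp_norm (mat m N \<omega>) p \<theta> \<tau>)"
      unfolding r by (intro D[OF t R, of p, unfolded PD_def, rule_format] conjI wc) simp_all
  qed
  show ?thesis
  \<comment> \<open>The failure probability 3 exp(-m) holds for every R > 1 and every
    \<open>m\<close> in question, so the constant rate 0.002 meets all three conditions on \<gamma>
    at once, and the threshold can be 0. The case m = 0 is excluded by R > 1, since division by 0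
    yields 0.\<close>
  proof (rule exI[of _ "\<lambda>_. 1 / 500"], rule exI[of _ "\<lambda>_. 0"], rule exI[of _ C], rule exI[of _ D], intro conjI allI impI)
    fix m N :: nat and R :: real
    assume "R = real N / real m \<and> 1 < R \<and> 0 \<le> m"
    then have R: "R = real N / real m" "1 < R" by auto
    obtain E where E: "E \<in> sets (gaussian_entries m N)"
      "measure (gaussian_entries m N) E \<le> 3 * exp (- real m)"
      "\<And>\<omega>. \<omega> \<in> space (gaussian_entries m N) - E \<Longrightarrow> well_conditioned (K R) R (mat m N \<omega>)"
      using good[OF R(2)] R(1) unfolding good_def by blast
    have "1 \<le> R\<^sup>2" using R(2) by (simp add: one_le_power)
    then have "3 * exp (- real m) \<le> 10 * R\<^sup>2 * exp (- (1 / 500) * real m)"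
      by (intro mult_mono) auto
    with E(2) have pE: "measure (gaussian_entries m N) E \<le> 10 * R\<^sup>2 * exp (- (1 / 500) * real m)" by linarith
    show "\<exists>E \<in> sets (gaussian_entries m N).
           measure (gaussian_entries m N) E \<le> 10 * R\<^sup>2 * exp (- (1 / 500) * real m) \<and>
           (\<forall>\<omega> \<in> space (gaussian_entries m N) - E.
              let \<Phi> = mat m N \<omega> in
              \<forall>\<tau> r. 0 < \<tau> \<and> \<tau> \<le> 1 \<and> r = 1 / \<tau> - 1 / 2 \<longrightarrow>
                equal_with_equiv_norms (C \<tau> R)
                  (approx_space \<Phi> r \<tau>) (approx_norm \<Phi> r \<tau>)
                  (sparsity_space \<Phi> \<tau>) (sparsity_norm \<Phi> \<tau>) \<and>
                (\<forall>p \<theta>. 0 < p \<and> 0 < \<theta> \<and> \<theta> < 1 \<and> r = \<theta> * (1 / p - 1 / 2) \<longrightarrow>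
                  equal_with_equiv_norms (D \<tau> p R)
                    (sparsity_space \<Phi> \<tau>) (sparsity_norm \<Phi> \<tau>)
                    (interp_space \<Phi> p \<theta> \<tau>) (interp_norm \<Phi> p \<theta> \<tau>)))"
      by (rule bexI[OF _ E(1)], rule conjI[OF pE], rule ballI, rule equiv[OF R(2)], rule E(3))
  qed (auto simp: eventually_at_top_linorder)
qed

end
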